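(* Let $H=H_B+H_{\rm err}$ be a time-independent noise Hamiltonian with $H_B=\mathbb I\otimes B_0$, $H_{\rm err}=\sum_\alpha S_\alpha\otimes B_\alpha$, $\|H_B\|\le\beta$, $\|H_{\rm err}\|\le J$, $\epsilon=\beta+J$. Let $p_1$ be a cyclic, time-symmetric sequence of $R\ge2$ ideal zero-width pulses with pulse interval $\tau_0$ that achieves first-order decoupling, such that each pulse either commutes or anticommutes with each $S_\alpha$, and let $p_k$ be the level-$k$ concatenated sequence, of duration $T^{(k)}=R^k\tau_0$. Define recursively $\beta^{(0)}=\beta$, $J^{(0)}=J$, $\epsilon^{(k)}=\beta^{(k)}+J^{(k)}$, $x_k=\epsilon^{(k-1)}T^{(k)}$, and for $k\ge1$ $$c_3^{(k)}=\tfrac29+9.43\,x_k^2,\qquad \beta^{(k)}=\beta^{(k-1)}+c_3^{(k)}J^{(k-1)}x_k^2,\qquad J^{(k)}=2c_3^{(k)}J^{(k-1)}x_k^2.$$ Let $\ell\ge0$ and suppose that for all $1\le k\le\ell$ we have $x_k\le0.54$ and $2c_3^{(k)}(\epsilon^{(k-1)})^2\le(\bar c\,\epsilon)^2$ for a constant $\bar c>0$. Then for every $0\le k\le\ell$ the effective noise strength $\eta_{\rm DD}^{(k)}=\|H_{\rm err}^{(k)}\|T^{(k)}$ of the level-$k$ sequence satisfies $$\eta_{\rm DD}^{(k)}\le R^{k(k+2)}(\bar c\,\epsilon\tau_0)^{2k}(J\tau_0).$$ Moreover, if $\log_R(1/\bar c\epsilon\tau_0)>\tfrac12$ and these hypotheses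 hold with $\ell=k_{\max}$, the largest integer $k$ with $k+\frac12<\log_R(1/\bar c\epsilon\tau_0)$, then $$\eta_{\rm DD}^{(k_{\max})}/(J\tau_0)\le R^{-3/4}(\bar c\,\epsilon\tau_0)^{\log_R(1/\bar c\epsilon\tau_0)-2}.$$
   Context: The system Hilbert space is finite dimensional, operators are bounded, $\|\cdot\|$ is the operator norm. $\{S_\alpha\}$ is a Hermitian basis of the traceless operators on the system, with ${\rm tr}(S_\alpha S_\beta)=0$ for $\alpha\ne\beta$. Level-0 sequence $p_0$: idle evolution under $H$ for time $\tau_0$. Level-1: pulses $P_1,\dots,P_R$ (instantaneous system unitaries, possibly the identity), $P_R\cdots P_1=\mathbb I$ up to a phase; $p_1$ is: evolve for $\tau_0$, apply $P_1$, evolve for $\tau_0$, apply $P_2$, …, evolve for $\tau_0$, apply $P_R$. Level $k$: $p_k=P_R\,p_{k-1}\,P_{R-1}\,p_{k-1}\cdots P_1\,p_{k-1}$ (operations applied right to left). Let $Q_j=P_j\cdots P_1$, $Q_0=\mathbb I$. First-order decoupling: $\sum_{j=0}^{R-1}Q_j^\dagger S_\alpha Q_j=0$ for every $\alpha$. Time-symmetric: $Q_{R-1-j}=Q_j$ up to a phase for $0\le j\le R-1$. Effective Hamiltonians: $H^{(0)}=H$. Given $H^{(k-1)}$, the level-$k$ toggling-frame Hamiltonian is the piecewise constant function equal to $Q_j^\dagger H^{(k-1)}Q_j$ on $[jT^{(k-1)},(j+1)T^{(k-1)})$, $j=0,\dots,R-1$; let $\Omega^{(k)}$ be the sum of its Magnus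 expansion over $[0,T^{(k)}]$, and define $H^{(k)}$ by $\Omega^{(k)}=-iT^{(k)}H^{(k)}$. Thus $\exp(-iT^{(k)}H^{(k)})$ is (up to a phase) the evolution operator of the full level-$k$ sequence. Decompose uniquely $H^{(k)}=H_B^{(k)}+H_{\rm err}^{(k)}$ with $H_B^{(k)}=\mathbb I\otimes B_0^{(k)}$ and $H_{\rm err}^{(k)}=\sum_\alpha S_\alpha\otimes B_\alpha^{(k)}$. Magnus expansion: the Magnus terms $\Omega_n$ of a Hamiltonian $K(t)$ on $[0,T]$ are the coefficients in $U_\lambda(T)=\exp(\sum_n\lambda^n\Omega_n)$, where $U_\lambda$ is the evolution operator generated by $\lambda K(t)$; the Magnus expansion is $\sum_n\Omega_n$. *)

theory Defs
  imports "HOL-Analysis.Analysis"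
begin

section \<open>Complex Hilbert spaces\<close>

text \<open>The inner product \<open>cinner\<close> is conjugate-linear in its first argument; the real inner
  product inherited from \<open>real_inner\<close> is its real part, so the norms agree.\<close>

class complex_hilbert = real_inner + banach +
  fixes scaleC :: "complex \<Rightarrow> 'a \<Rightarrow> 'a"  (infixr "*\<^sub>C" 75)
    and cinner :: "'a \<Rightarrow> 'a \<Rightarrow> complex"
  assumes scaleC_add_right: "c *\<^sub>C (x + y) = c *\<^sub>C x + c *\<^sub>C y"
    and scaleC_add_left: "(c + d) *\<^sub>C x = c *\<^sub>C x + d *\<^sub>C x"
    and scaleC_scaleC: "c *\<^sub>C d *\<^sub>C x = (c * d) *\<^sub>C x"
    and scaleR_scaleC: "r *\<^sub>R x = complex_of_real r *\<^sub>C x"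
    and cinner_commute: "cinner x y = cnj (cinner y x)"
    and cinner_add_left: "cinner (x + y) z = cinner x z + cinner y z"
    and cinner_scaleC_left: "cinner (c *\<^sub>C x) y = cnj c * cinner x y"
    and inner_cinner: "x \<bullet> y = Re (cinner x y)"

instantiation complex :: complex_hilbert
begin

definition scaleC_complex :: "complex \<Rightarrow> complex \<Rightarrow> complex"
  where "scaleC_complex c x = c * x"

definition cinner_complex :: "complex \<Rightarrow> complex \<Rightarrow> complex"
  where "cinner_complex x y = cnj x * y"

instance
  by standard
    (auto simp: scaleC_complex_def cinner_complex_def algebra_simps scaleR_conv_of_real
      inner_complex_def)

end

instantiation vec :: (complex_hilbert, finite) complex_hilbert
begin

definition scaleC_vec :: "complex \<Rightarrow> 'a ^ 'b \<Rightarrow> 'a ^ 'b"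
  where "scaleC_vec c x = (\<chi> i. c *\<^sub>C x $ i)"

definition cinner_vec :: "'a ^ 'b \<Rightarrow> 'a ^ 'b \<Rightarrow> complex"
  where "cinner_vec x y = (\<Sum>i\<in>UNIV. cinner (x $ i) (y $ i))"

instance
proof
  fix c d :: complex and r :: real and x y z :: "'a ^ 'b"
  show "c *\<^sub>C (x + y) = c *\<^sub>C x + c *\<^sub>C y"
    by (simp add: scaleC_vec_def vec_eq_iff scaleC_add_right)
  show "(c + d) *\<^sub>C x = c *\<^sub>C x + d *\<^sub>C x"
    by (simp add: scaleC_vec_def vec_eq_iff scaleC_add_left)
  show "c *\<^sub>C d *\<^sub>C x = (c * d) *\<^sub>C x"
    by (simp add: scaleC_vec_def vec_eq_iff scaleC_scaleC)
  show "r *\<^sub>R x = complex_of_real r *\<^sub>C x"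
    by (simp add: scaleC_vec_def vec_eq_iff scaleR_scaleC)
  show "cinner x y = cnj (cinner y x)"
    unfolding cinner_vec_def cnj_sum by (rule sum.cong[OF refl]) (rule cinner_commute)
  show "cinner (x + y) z = cinner x z + cinner y z"
    by (simp add: cinner_vec_def cinner_add_left sum.distrib)
  show "cinner (c *\<^sub>C x) y = cnj c * cinner x y"
    by (simp add: cinner_vec_def scaleC_vec_def cinner_scaleC_left sum_distrib_left)
  show "x \<bullet> y = Re (cinner x y)"
    by (simp add: inner_vec_def cinner_vec_def inner_cinner)
qed

end

lemma norm_scaleC: "norm (c *\<^sub>C x) = cmod c * norm (x :: 'a :: complex_hilbert)"
proof -
  have "cinner (c *\<^sub>C x) (c *\<^sub>C x) = cnj c * (c * cinner x x)"
    by (metis cinner_commute cinner_scaleC_left complex_cnj_cnj complex_cnj_mult)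
  also have "\<dots> = complex_of_real ((cmod c)\<^sup>2) * cinner x x"
    by (metis complex_norm_square mult.assoc mult.commute)
  finally have "(c *\<^sub>C x) \<bullet> (c *\<^sub>C x) = (cmod c)\<^sup>2 * (x \<bullet> x)"
    by (simp add: inner_cinner)
  then show ?thesis
    by (simp add: norm_eq_sqrt_inner real_sqrt_mult)
qed

lemma bounded_linear_scaleC: "bounded_linear (\<lambda>x :: 'a :: complex_hilbert. c *\<^sub>C x)"
proof (rule bounded_linear_intro)
  fix x y :: 'a and r :: real
  show "c *\<^sub>C (x + y) = c *\<^sub>C x + c *\<^sub>C y" by (rule scaleC_add_right)
  show "c *\<^sub>C r *\<^sub>R x = r *\<^sub>R c *\<^sub>C x"
    by (simp add: scaleR_scaleC scaleC_scaleC mult.commute)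
  show "norm (c *\<^sub>C x) \<le> norm x * cmod c" by (simp add: norm_scaleC)
qed


section \<open>Bounded operators\<close>

text \<open>The type \<open>'a \<Rightarrow>\<^sub>L 'a\<close> consists of the bounded real-linear maps; the bounded operators of
  the Hilbert space are the complex-linear ones among them. Its norm is the operator norm.\<close>

definition clinear_op :: "('a :: complex_hilbert \<Rightarrow>\<^sub>L 'a) \<Rightarrow> bool"
  where "clinear_op A \<longleftrightarrow> (\<forall>c x. A (c *\<^sub>C x) = c *\<^sub>C A x)"

definition selfadjoint_op :: "('a :: complex_hilbert \<Rightarrow>\<^sub>L 'a) \<Rightarrow> bool"
  where "selfadjoint_op A \<longleftrightarrow> clinear_op A \<and> (\<forall>x y. cinner (A x) y = cinner x (A y))"

lift_definition scale_op :: "complex \<Rightarrow> ('a :: complex_hilbert \<Rightarrow>\<^sub>L 'a) \<Rightarrow> ('a \<Rightarrow>\<^sub>L 'a)"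
  is "\<lambda>c A x. c *\<^sub>C A x"
  by (rule bounded_linear_compose[OF bounded_linear_scaleC])

definition exp_op :: "('a :: complex_hilbert \<Rightarrow>\<^sub>L 'a) \<Rightarrow> ('a \<Rightarrow>\<^sub>L 'a)"
  where "exp_op A = (\<Sum>n. (1 / fact n) *\<^sub>R (((o\<^sub>L) A ^^ n) id_blinfun))"

lemma bounded_linear_vec_lambda:
  fixes f :: "'n :: finite \<Rightarrow> 'a :: real_normed_vector \<Rightarrow> 'b :: real_normed_vector"
  assumes "\<And>i. bounded_linear (f i)"
  shows "bounded_linear (\<lambda>x. \<chi> i. f i x)"
proof -
  have "\<forall>i. \<exists>C. \<forall>x. norm (f i x) \<le> norm x * C"
    using assms bounded_linear.bounded by blast
  then obtain C where C: "\<And>i x. norm (f i x) \<le> norm x * C i" by metis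
  show ?thesis
  proof (rule bounded_linear_intro)
    fix x y :: 'a and r :: real
    show "(\<chi> i. f i (x + y)) = (\<chi> i. f i x) + (\<chi> i. f i y)"
      by (simp add: vec_eq_iff linear_add[OF bounded_linear.linear[OF assms]])
    show "(\<chi> i. f i (r *\<^sub>R x)) = r *\<^sub>R (\<chi> i. f i x)"
      by (simp add: vec_eq_iff linear_scale[OF bounded_linear.linear[OF assms]])
    have "norm (\<chi> i. f i x) \<le> (\<Sum>i\<in>UNIV. norm (f i x))"
      unfolding norm_vec_def by (rule order_trans[OF L2_set_le_sum]) simp_all
    also have "\<dots> \<le> (\<Sum>i\<in>UNIV. norm x * C i)" by (rule sum_mono) (rule C)
    finally show "norm (\<chi> i. f i x) \<le> norm x * (\<Sum>i\<in>UNIV. C i)"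
      by (simp add: sum_distrib_left)
  qed
qed

text \<open>The space \<open>\<complex>\<^sup>n \<otimes> \<H>\<close>, for a bath Hilbert space \<open>\<H>\<close>, is the type of \<open>n\<close>-tuples of elements of
  \<open>\<H>\<close>, on which \<open>M \<otimes> B\<close> acts as the block operator with blocks \<open>M\<^sub>i\<^sub>j B\<close>.\<close>

lift_definition tensor_op ::
  "complex ^ 'n ^ 'n \<Rightarrow> ('b :: complex_hilbert \<Rightarrow>\<^sub>L 'b) \<Rightarrow> (('b ^ 'n :: finite) \<Rightarrow>\<^sub>L ('b ^ 'n))"
    (infixr "\<otimes>\<^sub>o" 72)
  is "\<lambda>M B v. \<chi> i. \<Sum>j\<in>UNIV. M $ i $ j *\<^sub>C B (v $ j)"
  by (intro bounded_linear_vec_lambda bounded_linear_sum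
      bounded_linear_compose[OF bounded_linear_scaleC]
      bounded_linear_compose[OF _ bounded_linear_vec_nth])


section \<open>System operators\<close>

definition scale_mat :: "complex \<Rightarrow> complex ^ 'n ^ 'n \<Rightarrow> complex ^ 'n ^ 'n"
  where "scale_mat c M = (\<chi> i j. c * M $ i $ j)"

definition dagger :: "complex ^ 'n ^ 'n \<Rightarrow> complex ^ 'n ^ 'n"
  where "dagger M = (\<chi> i j. cnj (M $ j $ i))"

definition unitary_mat :: "complex ^ 'n :: finite ^ 'n \<Rightarrow> bool"
  where "unitary_mat U \<longleftrightarrow> dagger U ** U = mat 1 \<and> U ** dagger U = mat 1"

definition eq_up_to_phase :: "complex ^ 'n ^ 'n \<Rightarrow> complex ^ 'n ^ 'n \<Rightarrow> bool"
  where "eq_up_to_phase M N \<longleftrightarrow> (\<exists>c. cmod c = 1 \<and> M = scale_mat c N)"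

interpretation cmat: vector_space "scale_mat :: complex \<Rightarrow> complex ^ 'n ^ 'n \<Rightarrow> _"
  by standard (simp_all add: scale_mat_def vec_eq_iff algebra_simps)

definition hermitian_traceless_basis :: "'i set \<Rightarrow> ('i \<Rightarrow> complex ^ 'n :: finite ^ 'n) \<Rightarrow> bool"
  where "hermitian_traceless_basis I S \<longleftrightarrow>
    finite I \<and> inj_on S I \<and> cmat.independent (S ` I) \<and>
    cmat.span (S ` I) = {M. trace M = 0} \<and> (\<forall>\<alpha>\<in>I. dagger (S \<alpha>) = S \<alpha>)"

definition trace_orthogonal :: "'i set \<Rightarrow> ('i \<Rightarrow> complex ^ 'n :: finite ^ 'n) \<Rightarrow> bool"
  where "trace_orthogonal I S \<longleftrightarrow>
    (\<forall>\<alpha>\<in>I. \<forall>\<beta>\<in>I. \<alpha> \<noteq> \<beta> \<longrightarrow> trace (S \<alpha> ** S \<beta>) = 0)"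

text \<open>The part \<open>\<Sum>\<^sub>\<alpha> S\<^sub>\<alpha> \<otimes> B\<^sub>\<alpha>\<close> in the decomposition \<open>X = 1 \<otimes> B\<^sub>0 + \<Sum>\<^sub>\<alpha> S\<^sub>\<alpha> \<otimes> B\<^sub>\<alpha>\<close>, which is unique
  when \<open>S\<close> is a basis of the traceless matrices.\<close>

definition err_part ::
  "'i set \<Rightarrow> ('i \<Rightarrow> complex ^ 'n ^ 'n) \<Rightarrow> (('b :: complex_hilbert ^ 'n :: finite) \<Rightarrow>\<^sub>L ('b ^ 'n)) \<Rightarrow>
    (('b ^ 'n) \<Rightarrow>\<^sub>L ('b ^ 'n))"
  where "err_part I S X = (THE E. \<exists>B\<^sub>0 B. clinear_op B\<^sub>0 \<and> (\<forall>\<alpha>\<in>I. clinear_op (B \<alpha>)) \<and>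
    E = (\<Sum>\<alpha>\<in>I. S \<alpha> \<otimes>\<^sub>o B \<alpha>) \<and> X = mat 1 \<otimes>\<^sub>o B\<^sub>0 + E)"


section \<open>Magnus expansion\<close>

text \<open>\<open>U\<close> solves \<open>U'(t) = -i K(t) U(t)\<close>, \<open>U(0) = 1\<close> on \<open>[0,T]\<close>; the integral form of the equation
  accommodates jumps of \<open>K\<close>.\<close>

definition evolution_on ::
  "real \<Rightarrow> (real \<Rightarrow> ('a :: complex_hilbert \<Rightarrow>\<^sub>L 'a)) \<Rightarrow> (real \<Rightarrow> ('a \<Rightarrow>\<^sub>L 'a)) \<Rightarrow> bool"
  where "evolution_on T K U \<longleftrightarrow> continuous_on {0..T} U \<and>
    (\<forall>t\<in>{0..T}. ((\<lambda>s. scale_op (- \<i>) (K s o\<^sub>L U s)) has_integral (U t - id_blinfun)) {0..t})"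

text \<open>The expansion starts at order one; order zero is set to \<open>0\<close>. The identity
  \<open>U\<^sub>\<lambda>(T) = exp (\<Sum>\<^sub>n \<lambda>\<^sup>n \<Omega>\<^sub>n)\<close> is required near \<open>\<lambda> = 0\<close>, where it determines the coefficients; the
  series need not converge at \<open>\<lambda> = 1\<close>.\<close>

definition magnus_terms ::
  "real \<Rightarrow> (real \<Rightarrow> ('a :: complex_hilbert \<Rightarrow>\<^sub>L 'a)) \<Rightarrow> nat \<Rightarrow> ('a \<Rightarrow>\<^sub>L 'a)"
  where "magnus_terms T K = (THE \<Omega>. \<Omega> 0 = 0 \<and> (\<exists>r>0. \<forall>l::real. \<bar>l\<bar> < r \<longrightarrow>
    summable (\<lambda>n. l ^ n *\<^sub>R \<Omega> n) \<and>
    (\<exists>U. evolution_on T (\<lambda>t. l *\<^sub>R K t) U \<and> U T = exp_op (\<Sum>n. l ^ n *\<^sub>R \<Omega> n))))"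

definition magnus_sum ::
  "real \<Rightarrow> (real \<Rightarrow> ('a :: complex_hilbert \<Rightarrow>\<^sub>L 'a)) \<Rightarrow> ('a \<Rightarrow>\<^sub>L 'a)"
  where "magnus_sum T K = (\<Sum>n. magnus_terms T K n)"


section \<open>Pulse sequences\<close>

text \<open>The pulses are \<open>P 1, \<dots>, P R\<close>. A sequence is the list of its steps in chronological order.\<close>

datatype 'p step = Idle real | Pulse 'p

primrec concat_seq :: "(nat \<Rightarrow> 'p) \<Rightarrow> nat \<Rightarrow> real \<Rightarrow> nat \<Rightarrow> 'p step list"
  where
    "concat_seq P R \<tau> 0 = [Idle \<tau>]"
  | "concat_seq P R \<tau> (Suc k) =
      concat (map (\<lambda>j. concat_seq P R \<tau> k @ [Pulse (P j)]) [1..<Suc R])"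

definition seq_duration :: "'p step list \<Rightarrow> real"
  where "seq_duration xs = (\<Sum>x\<leftarrow>xs. case x of Idle t \<Rightarrow> t | Pulse _ \<Rightarrow> 0)"

definition level_time :: "(nat \<Rightarrow> 'p) \<Rightarrow> nat \<Rightarrow> real \<Rightarrow> nat \<Rightarrow> real"
  where "level_time P R \<tau> k = seq_duration (concat_seq P R \<tau> k)"

lemma level_time_eq: "level_time P R \<tau> k = real R ^ k * \<tau>"
proof (induction k)
  case 0
  show ?case by (simp add: level_time_def seq_duration_def)
next
  case (Suc k)
  have "seq_duration (concat (map (\<lambda>j. xs @ [Pulse (P j)]) js)) = real (length js) * seq_duration xs"
    for js and xs :: "'a step list"
    by (induction js) (simp_all add: seq_duration_def algebra_simps)
  then show ?case using Suc by (simp add: level_time_def del: upt_Suc)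
qed

primrec partial_pulse :: "(nat \<Rightarrow> complex ^ 'n :: finite ^ 'n) \<Rightarrow> nat \<Rightarrow> complex ^ 'n ^ 'n"
  where
    "partial_pulse P 0 = mat 1"
  | "partial_pulse P (Suc j) = P (Suc j) ** partial_pulse P j"

definition cyclic_pulses :: "(nat \<Rightarrow> complex ^ 'n :: finite ^ 'n) \<Rightarrow> nat \<Rightarrow> bool"
  where "cyclic_pulses P R \<longleftrightarrow> eq_up_to_phase (partial_pulse P R) (mat 1)"

definition time_symmetric :: "(nat \<Rightarrow> complex ^ 'n :: finite ^ 'n) \<Rightarrow> nat \<Rightarrow> bool"
  where "time_symmetric P R \<longleftrightarrow>
    (\<forall>j<R. eq_up_to_phase (partial_pulse P (R - 1 - j)) (partial_pulse P j))"

definition first_order_decoupling ::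
  "'i set \<Rightarrow> ('i \<Rightarrow> complex ^ 'n :: finite ^ 'n) \<Rightarrow> (nat \<Rightarrow> complex ^ 'n ^ 'n) \<Rightarrow> nat \<Rightarrow> bool"
  where "first_order_decoupling I S P R \<longleftrightarrow>
    (\<forall>\<alpha>\<in>I. (\<Sum>j<R. dagger (partial_pulse P j) ** S \<alpha> ** partial_pulse P j) = 0)"

definition commute_or_anticommute ::
  "'i set \<Rightarrow> ('i \<Rightarrow> complex ^ 'n :: finite ^ 'n) \<Rightarrow> (nat \<Rightarrow> complex ^ 'n ^ 'n) \<Rightarrow> nat \<Rightarrow> bool"
  where "commute_or_anticommute I S P R \<longleftrightarrow>
    (\<forall>j\<in>{1..R}. \<forall>\<alpha>\<in>I. P j ** S \<alpha> = S \<alpha> ** P j \<or> P j ** S \<alpha> = - (S \<alpha> ** P j))"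


section \<open>Effective Hamiltonians of the concatenated sequence\<close>

definition toggling_ham ::
  "(nat \<Rightarrow> complex ^ 'n ^ 'n) \<Rightarrow> nat \<Rightarrow> real \<Rightarrow> (('b :: complex_hilbert ^ 'n :: finite) \<Rightarrow>\<^sub>L ('b ^ 'n)) \<Rightarrow>
    real \<Rightarrow> (('b ^ 'n) \<Rightarrow>\<^sub>L ('b ^ 'n))"
  where "toggling_ham P R T X t = (\<Sum>j<R. indicat_real {real j * T ..< real (Suc j) * T} t *\<^sub>R
    ((dagger (partial_pulse P j) \<otimes>\<^sub>o id_blinfun) o\<^sub>L X o\<^sub>L (partial_pulse P j \<otimes>\<^sub>o id_blinfun)))"

text \<open>The successor case solves \<open>\<Omega> = -i T H\<close> for \<open>H\<close>.\<close>

primrec eff_ham ::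
  "(nat \<Rightarrow> complex ^ 'n ^ 'n) \<Rightarrow> nat \<Rightarrow> real \<Rightarrow> (('b :: complex_hilbert ^ 'n :: finite) \<Rightarrow>\<^sub>L ('b ^ 'n)) \<Rightarrow>
    nat \<Rightarrow> (('b ^ 'n) \<Rightarrow>\<^sub>L ('b ^ 'n))"
  where
    "eff_ham P R \<tau> H 0 = H"
  | "eff_ham P R \<tau> H (Suc k) =
      scale_op (\<i> / complex_of_real (level_time P R \<tau> (Suc k)))
        (magnus_sum (level_time P R \<tau> (Suc k))
          (toggling_ham P R (level_time P R \<tau> k) (eff_ham P R \<tau> H k)))"

definition noise_strength ::
  "'i set \<Rightarrow> ('i \<Rightarrow> complex ^ 'n ^ 'n) \<Rightarrow> (nat \<Rightarrow> complex ^ 'n ^ 'n) \<Rightarrow> nat \<Rightarrow> real \<Rightarrow>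
    (('b :: complex_hilbert ^ 'n :: finite) \<Rightarrow>\<^sub>L ('b ^ 'n)) \<Rightarrow> nat \<Rightarrow> real"
  where "noise_strength I S P R \<tau> H k =
    norm (err_part I S (eff_ham P R \<tau> H k)) * level_time P R \<tau> k"

end

theory Submission
  imports Defs
begin

text \<open>Since the pulse sequence is time-symmetric, the evolution operator \<open>U(\<lambda>)\<close> of a level satisfies
  \<open>U(\<lambda>) U(-\<lambda>) = 1\<close>, so its logarithm \<open>\<Omega>\<close> satisfies \<open>2 sinh \<Omega> = U(1) - U(-1)\<close>: only the odd-order
  terms of the time-ordered product matter. Write \<open>w\<close> for the first-order term, to which only the
  bath part contributes, and compare with the same equation for \<open>w\<close> alone. As \<open>sinh y - y\<close> is a
  contraction for small \<open>y\<close>, \<open>\<Omega> - w\<close> is bounded by the third-order difference plus a remainder of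
  order five. In the third-order difference, first-order decoupling and time symmetry turn the part
  linear in the error Hamiltonian into a double commutator with the bath Hamiltonian, whose weights
  are small enough for the constant \<open>2/9\<close>. Averaging over the conjugations by the \<open>Q\<^sub>j\<close> projects an
  operator onto its bath part; this projection has norm one, hence the factor \<open>2\<close> for the error part.\<close>

section \<open>Absolutely convergent power series in a Banach algebra\<close>

text \<open>The constant 2/9 rules out a termwise estimate of the third-order difference. Norms
  alone, with \<beta> and \<gamma> bounding bath and error parts, give ((\<beta> + \<gamma>)^3 -
  \<beta>^3) / 6 per R^3, which for small \<gamma> is about \<beta>^2 \<gamma> / 2. The double
  commutator lowers this 1/2 to 0.15. The logarithm series is too lossy for the final estimate,
  since its majorant cannot see that even orders cancel. It is still needed for existence: the
  Magnus terms are the coefficients of the formal logarithm, and their absolute summability makes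
  the sum at \<lambda> = 1 meaningful. Hence everything is carried as formal series in a real
  parameter \<lambda> with noncommuting coefficients. \<open>magnus_terms\<close> is a definite
  description, so uniqueness must be shown as well; it comes from the same contraction property of
  sinh y - y, which makes exp injective on a small ball.\<close>

lemma suminf_swap_abs:
  fixes f :: "nat \<Rightarrow> nat \<Rightarrow> 'c :: banach"
  assumes inner: "\<And>m. summable (\<lambda>n. norm (f m n))"
    and outer: "summable (\<lambda>m. \<Sum>n. norm (f m n))"
  shows "summable (\<lambda>n. norm (\<Sum>m. f m n))"
    and "(\<Sum>m. \<Sum>n. f m n) = (\<Sum>n. \<Sum>m. f m n)"
proof -
  have inf_eq: "infsum g UNIV = suminf g" if "summable (\<lambda>n. norm (g n))" for g :: "nat \<Rightarrow> 'd :: banach"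
    using norm_summable_imp_has_sum[OF that summable_sums[OF summable_norm_cancel[OF that]]]
    by (rule infsumI)
  have on_iff: "(\<lambda>n. norm (g n)) summable_on UNIV \<longleftrightarrow> summable (\<lambda>n. norm (g n))"
    for g :: "nat \<Rightarrow> 'd :: banach"
    by (rule summable_on_UNIV_nonneg_real_iff) simp
  note iff = Infinite_Sum.abs_summable_on_Sigma_iff[where A = "UNIV :: nat set" and B = "\<lambda>_. UNIV :: nat set"]
  have abs1: "(\<lambda>x. norm (case_prod f x)) summable_on UNIV \<times> UNIV"
  proof (rule iffD2[OF iff], intro conjI ballI)
    fix m show "(\<lambda>n. norm (case (m, n) of (m, n) \<Rightarrow> f m n)) summable_on UNIV"
      using inner[of m] by (simp add: on_iff)
    have "(\<Sum>\<^sub>\<infinity>n. norm (f m n)) = (\<Sum>n. norm (f m n))" for m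
      by (simp add: inf_eq inner)
    moreover have "\<And>m. 0 \<le> (\<Sum>n. norm (f m n))" by (rule suminf_nonneg[OF inner]) simp
    ultimately show "(\<lambda>m. norm (\<Sum>\<^sub>\<infinity>n. norm (case (m, n) of (m, n) \<Rightarrow> f m n))) summable_on UNIV"
      using outer on_iff[of "\<lambda>m. \<Sum>n. norm (f m n)"] by simp
  qed
  \<comment> \<open>Summability over index pairs is independent of any order, so it survives
    swapping the coordinates; read columnwise it gives the other iterated sum.\<close>
  have "(\<lambda>x. norm (case_prod (\<lambda>n m. f m n) x)) summable_on UNIV \<times> UNIV"
    using abs1 summable_on_reindex[of prod.swap "UNIV \<times> UNIV" "\<lambda>x. norm (case_prod f x)"]
    by (simp add: o_def case_prod_unfold)
  note sw = this[THEN iffD1[OF iff]]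
  have swapped: "\<And>n. summable (\<lambda>m. norm (f m n))"
    using sw[THEN conjunct1] on_iff[of "\<lambda>m. f m _"] by simp
  have "(\<lambda>n. norm (\<Sum>m. norm (f m n))) summable_on UNIV"
    using sw[THEN conjunct2] by (simp add: inf_eq swapped)
  then have "summable (\<lambda>n. \<Sum>m. norm (f m n))"
    using on_iff[of "\<lambda>n. \<Sum>m. norm (f m n)"] by (simp add: suminf_nonneg[OF swapped])
  then show s1: "summable (\<lambda>n. norm (\<Sum>m. f m n))"
    by (rule summable_comparison_test') (simp add: summable_norm[OF swapped])
  have "summable (\<lambda>m. norm (\<Sum>n. f m n))"
    using outer by (rule summable_comparison_test') (simp add: summable_norm[OF inner])
  then have "(\<Sum>m. \<Sum>n. f m n) = (\<Sum>\<^sub>\<infinity>m. \<Sum>\<^sub>\<infinity>n. f m n)"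
    by (simp add: inf_eq inner)
  also have "\<dots> = (\<Sum>\<^sub>\<infinity>n. \<Sum>\<^sub>\<infinity>m. f m n)"
    by (rule infsum_swap_banach[OF abs_summable_summable[of "case_prod f" "UNIV \<times> UNIV", OF abs1]])
  also have "\<dots> = (\<Sum>n. \<Sum>m. f m n)"
    by (simp add: inf_eq swapped s1)
  finally show "(\<Sum>m. \<Sum>n. f m n) = (\<Sum>n. \<Sum>m. f m n)" .
qed

section \<open>Series with absolutely summable coefficients, and their values at real parameters in
  [-1, 1]\<close>

definition fps_bounded :: "'c :: real_normed_algebra_1 fps \<Rightarrow> real \<Rightarrow> bool"
  where "fps_bounded F q \<longleftrightarrow>
    summable (\<lambda>n. norm (fps_nth F n)) \<and> (\<Sum>n. norm (fps_nth F n)) \<le> q"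

definition fps_sum :: "real \<Rightarrow> 'c :: real_normed_algebra_1 fps \<Rightarrow> 'c"
  where "fps_sum l F = (\<Sum>n. l ^ n *\<^sub>R fps_nth F n)"

lemma fps_bounded_nonneg: "fps_bounded F q \<Longrightarrow> 0 \<le> q"
  unfolding fps_bounded_def by (meson norm_ge_zero order_trans suminf_nonneg)

lemma summable_fps_sum:
  assumes "fps_bounded F q" "\<bar>l\<bar> \<le> 1"
  shows "summable (\<lambda>n. norm (l ^ n *\<^sub>R fps_nth F n))"
proof (rule summable_comparison_test')
  show "summable (\<lambda>n. norm (fps_nth F n))" using assms by (simp add: fps_bounded_def)
  show "norm (norm (l ^ n *\<^sub>R fps_nth F n)) \<le> norm (fps_nth F n)" for n
    using assms by (simp add: power_abs mult_left_le_one_le power_le_one)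
qed

lemma norm_fps_sum_le:
  fixes F :: "'c :: {real_normed_algebra_1, banach} fps"
  assumes "fps_bounded F q" "\<bar>l\<bar> \<le> 1"
  shows "(\<Sum>n. norm (l ^ n *\<^sub>R fps_nth F n)) \<le> q" "norm (fps_sum l F) \<le> q"
proof -
  have "(\<Sum>n. norm (l ^ n *\<^sub>R fps_nth F n)) \<le> (\<Sum>n. norm (fps_nth F n))"
    using assms
    by (intro suminf_le summable_fps_sum[OF assms])
      (auto simp: fps_bounded_def power_abs mult_left_le_one_le power_le_one)
  then show "(\<Sum>n. norm (l ^ n *\<^sub>R fps_nth F n)) \<le> q"
    using assms by (simp add: fps_bounded_def)
  then show "norm (fps_sum l F) \<le> q"
    unfolding fps_sum_def using summable_norm[OF summable_fps_sum[OF assms]] by linarith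
qed

lemma fps_bounded_mult:
  fixes F G :: "'c :: {real_normed_algebra_1, banach} fps"
  assumes F: "fps_bounded F p" and G: "fps_bounded G q"
  shows "fps_bounded (F * G) (p * q)"
proof -
  let ?a = "\<lambda>n. norm (fps_nth F n)" and ?b = "\<lambda>n. norm (fps_nth G n)"
  have s: "summable (\<lambda>n. norm (?a n))" "summable (\<lambda>n. norm (?b n))"
    using F G by (auto simp: fps_bounded_def)
  have le: "norm (fps_nth (F * G) n) \<le> (\<Sum>i\<le>n. ?a i * ?b (n - i))" for n
    unfolding fps_mult_nth atMost_atLeast0 by (intro sum_norm_le norm_mult_ineq)
  note cp = Cauchy_product_sums[OF s]
  have sm: "summable (\<lambda>n. norm (fps_nth (F * G) n))"
    using le by (intro summable_comparison_test'[OF sums_summable[OF cp]]) auto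
  have "(\<Sum>n. norm (fps_nth (F * G) n)) \<le> (\<Sum>n. ?a n) * (\<Sum>n. ?b n)"
    unfolding sums_unique[OF cp] by (intro suminf_le le sm sums_summable[OF cp])
  also have "\<dots> \<le> p * q"
    using F G fps_bounded_nonneg[OF F]
    by (intro mult_mono) (auto simp: fps_bounded_def intro!: suminf_nonneg)
  finally show ?thesis using sm by (simp add: fps_bounded_def)
qed

lemma fps_sum_mult:
  fixes F G :: "'c :: {real_normed_algebra_1, banach} fps"
  assumes F: "fps_bounded F p" and G: "fps_bounded G q" and l: "\<bar>l\<bar> \<le> 1"
  shows "fps_sum l (F * G) = fps_sum l F * fps_sum l G"
proof -
  have "fps_sum l F * fps_sum l G =
      (\<Sum>n. \<Sum>i\<le>n. (l ^ i *\<^sub>R fps_nth F i) * (l ^ (n - i) *\<^sub>R fps_nth G (n - i)))"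
    unfolding fps_sum_def
    by (rule Cauchy_product[OF summable_fps_sum[OF F l] summable_fps_sum[OF G l]])
  also have "\<dots> = fps_sum l (F * G)"
    unfolding fps_sum_def fps_mult_nth atMost_atLeast0 scaleR_right.sum
    by (intro suminf_cong sum.cong) (auto simp flip: power_add)
  finally show ?thesis ..
qed

lemma fps_bounded_1: "fps_bounded (1 :: 'c :: real_normed_algebra_1 fps) 1"
proof -
  have "(\<lambda>n. norm (fps_nth (1 :: 'c fps) n)) sums norm (fps_nth (1 :: 'c fps) 0)"
    using sums_finite[of "{0 :: nat}" "\<lambda>n. norm (fps_nth (1 :: 'c fps) n)"] by simp
  then show ?thesis by (simp add: fps_bounded_def sums_iff)
qed

lemma fps_sum_1: "fps_sum l (1 :: 'c :: real_normed_algebra_1 fps) = 1"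
  unfolding fps_sum_def
  using sums_finite[of "{0 :: nat}" "\<lambda>n. l ^ n *\<^sub>R fps_nth (1 :: 'c fps) n"]
  by (simp add: sums_iff)

lemma fps_bounded_power:
  fixes F :: "'c :: {real_normed_algebra_1, banach} fps"
  shows "fps_bounded F q \<Longrightarrow> fps_bounded (F ^ m) (q ^ m)"
  by (induction m) (simp_all add: fps_bounded_1 fps_bounded_mult)

lemma fps_sum_power:
  fixes F :: "'c :: {real_normed_algebra_1, banach} fps"
  assumes "fps_bounded F q" "\<bar>l\<bar> \<le> 1"
  shows "fps_sum l (F ^ m) = fps_sum l F ^ m"
  by (induction m)
    (simp_all add: fps_sum_1 fps_sum_mult[OF assms(1) fps_bounded_power[OF assms(1)] assms(2)])

section \<open>Substitution of a series without constant term into a scalar series\<close>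

lemma fps_power_nth_eq_0:
  fixes F :: "'c :: ring_1 fps"
  assumes "fps_nth F 0 = 0" "n < m"
  shows "fps_nth (F ^ m) n = 0"
  using assms(2)
proof (induction m arbitrary: n)
  case (Suc m)
  have "fps_nth F i * fps_nth (F ^ m) (n - i) = 0" if "i \<in> {0..n}" for i
  proof (cases "i = 0")
    case False
    then have "n - i < m" using that Suc.prems by auto
    then show ?thesis by (simp add: Suc.IH)
  qed (simp add: assms(1))
  then show ?case by (simp add: fps_mult_nth)
qed simp

text \<open>Composition of the scalar series with coefficients \<open>c\<close> and
  \<open>F\<close>. Cutting the sum at m = n loses nothing when \<open>F\<close> has no constant
  term, because \<open>F ^ m\<close> then starts at order m.\<close>

definition fps_subst :: "(nat \<Rightarrow> real) \<Rightarrow> 'c :: real_normed_algebra_1 fps \<Rightarrow> 'c fps"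
  where "fps_subst c F = Abs_fps (\<lambda>n. \<Sum>m\<le>n. c m *\<^sub>R fps_nth (F ^ m) n)"

text \<open>The double family of terms \<open>c m\<close> times the order-n coefficient of
  \<open>F ^ m\<close> is dominated, summed over n, by \<bar>c m\<bar> q^m; absolute summability
  then allows collecting by order n instead of by power m.\<close>

lemma fps_subst_sum:
  fixes F :: "'c :: {real_normed_algebra_1, banach} fps"
  assumes F: "fps_bounded F q" and F0: "fps_nth F 0 = 0"
    and c: "summable (\<lambda>m. \<bar>c m\<bar> * q ^ m)"
  shows "summable (\<lambda>n. norm (fps_nth (fps_subst c F) n))"
    and "\<bar>l\<bar> \<le> 1 \<Longrightarrow> fps_sum l (fps_subst c F) = (\<Sum>m. c m *\<^sub>R fps_sum l F ^ m)"
proof -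
  have nth: "l ^ n *\<^sub>R fps_nth (fps_subst c F) n = (\<Sum>m. c m *\<^sub>R l ^ n *\<^sub>R fps_nth (F ^ m) n)"
    for l n
    unfolding fps_subst_def
    by (subst suminf_finite[of "{..n}"])
      (auto simp: fps_power_nth_eq_0[OF F0] scaleR_right.sum mult.commute)
  have main: "summable (\<lambda>n. norm (l ^ n *\<^sub>R fps_nth (fps_subst c F) n)) \<and>
      fps_sum l (fps_subst c F) = (\<Sum>m. c m *\<^sub>R fps_sum l F ^ m)" if l: "\<bar>l\<bar> \<le> 1" for l
  proof -
    let ?f = "\<lambda>m n. c m *\<^sub>R l ^ n *\<^sub>R fps_nth (F ^ m) n"
    note b = fps_bounded_power[OF F]
    have inner: "summable (\<lambda>n. norm (?f m n))" for m
      unfolding norm_scaleR[of "c m"] by (rule summable_mult[OF summable_fps_sum[OF b l]])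
    have "(\<Sum>n. norm (?f m n)) = \<bar>c m\<bar> * (\<Sum>n. norm (l ^ n *\<^sub>R fps_nth (F ^ m) n))" for m
      unfolding norm_scaleR[of "c m"] by (rule suminf_mult[OF summable_fps_sum[OF b l]])
    then have le: "(\<Sum>n. norm (?f m n)) \<le> \<bar>c m\<bar> * q ^ m" for m
      using norm_fps_sum_le(1)[OF b l] by (simp add: mult_left_mono)
    have outer: "summable (\<lambda>m. \<Sum>n. norm (?f m n))"
      by (rule summable_comparison_test'[OF c]) (simp only: real_norm_def abs_of_nonneg[OF suminf_nonneg[OF inner norm_ge_zero]] le)
    have "(\<Sum>n. ?f m n) = c m *\<^sub>R fps_sum l F ^ m" for m
      unfolding fps_sum_power[OF F l, symmetric]
      unfolding fps_sum_def
      by (rule suminf_scaleR_right[symmetric])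
        (rule summable_norm_cancel[OF summable_fps_sum[OF b l]])
    then show ?thesis
      using suminf_swap_abs[of ?f, OF inner outer]
      unfolding fps_sum_def[of l "fps_subst c F"] nth by simp
  qed
  from main[of 1] show "summable (\<lambda>n. norm (fps_nth (fps_subst c F) n))" by simp
  from main show "\<bar>l\<bar> \<le> 1 \<Longrightarrow> fps_sum l (fps_subst c F) = (\<Sum>m. c m *\<^sub>R fps_sum l F ^ m)"
    by simp
qed

subsection \<open>The logarithm\<close>

definition log_coeff :: "nat \<Rightarrow> real"
  where "log_coeff n = (if n = 0 then 0 else (- 1) ^ (n - 1) / of_nat n)"

lemma sums_abs_log_coeff:
  assumes "0 \<le> q" "q < 1"
  shows "(\<lambda>n. \<bar>log_coeff n\<bar> * q ^ n) sums (- ln (1 - q))"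
proof -
  have "(\<lambda>n. - (- (q ^ n) / real n)) sums - ln (1 - q)"
    using sums_minus[OF ln_series'[of "- q"]] assms by simp
  moreover have "- (- (q ^ n) / real n) = \<bar>log_coeff n\<bar> * q ^ n" for n
    by (cases n) (auto simp: log_coeff_def abs_divide power_abs)
  ultimately show ?thesis by simp
qed

definition banach_log :: "'c :: {real_normed_algebra_1, banach} \<Rightarrow> 'c"
  where "banach_log X = (\<Sum>m. log_coeff m *\<^sub>R X ^ m)"

lemma norm_banach_log_le:
  assumes "norm X \<le> q" "q < 1"
  shows "norm (banach_log X) \<le> - ln (1 - q)"
proof -
  have q: "0 \<le> q" using assms norm_ge_zero order_trans by blast
  note s = sums_abs_log_coeff[OF q assms(2)]
  have le: "norm (log_coeff m *\<^sub>R X ^ m) \<le> \<bar>log_coeff m\<bar> * q ^ m" for m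
    using order_trans[OF norm_power_ineq power_mono[OF assms(1) norm_ge_zero]]
    by (auto intro: mult_left_mono)
  show ?thesis
    unfolding banach_log_def sums_unique[OF s]
    by (rule norm_suminf_le[OF le sums_summable[OF s]])
qed

text \<open>Reduction to the formal identity exp (ln (1 + t)) = 1 + t over the reals. The powers of
  the single element \<open>X\<close> commute, so the coefficients of \<open>F ^ m\<close> are those
  of the real series times \<open>X ^ n\<close>, and the identity carries over coefficientwise;
  evaluation is at parameter 1.\<close>

lemma exp_banach_log:
  fixes X :: "'c :: {real_normed_algebra_1, banach}"
  assumes "norm X < 1"
  shows "exp (banach_log X) = 1 + X"
proof -
  define F where "F = Abs_fps (\<lambda>n. log_coeff n *\<^sub>R X ^ n)"
  have L: "fps_nth (fps_ln 1) n = log_coeff n" for n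
    by (simp add: fps_ln_nth log_coeff_def)
  have Fn: "fps_nth F n = log_coeff n *\<^sub>R X ^ n" for n by (simp add: F_def)
  note s = sums_abs_log_coeff[OF norm_ge_zero assms]
  have le: "norm (fps_nth F n) \<le> \<bar>log_coeff n\<bar> * norm X ^ n" for n
    by (simp add: F_def mult_left_mono norm_power_ineq)
  have sF: "summable (\<lambda>n. norm (fps_nth F n))"
    using le by (intro summable_comparison_test'[OF sums_summable[OF s]]) auto
  then have F: "fps_bounded F (\<Sum>n. norm (fps_nth F n))" (is "fps_bounded F ?q")
    by (simp add: fps_bounded_def)
  have F0: "fps_nth F 0 = 0" by (simp add: F_def log_coeff_def)
  have c: "summable (\<lambda>m. \<bar>1 / fact m\<bar> * ?q ^ m)"
    using summable_exp_generic[of ?q] by (simp add: field_simps)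
  have Fpow: "fps_nth (F ^ m) n = fps_nth (fps_ln 1 ^ m) n *\<^sub>R X ^ n" for m n
  proof (induction m arbitrary: n)
    case (Suc m)
    show ?case
      by (simp add: fps_mult_nth Suc scaleR_left.sum Fn L mult.commute flip: power_add)
  qed simp
  have nth: "fps_nth (fps_subst (\<lambda>m. 1 / fact m) F) n = fps_nth (1 + fps_X) n *\<^sub>R X ^ n" for n
  proof -
    have e: "(fps_exp 1 :: real fps) oo fps_ln 1 = 1 + fps_X"
    proof -
      have "(fps_exp 1 - 1) oo (fps_ln 1 :: real fps) = fps_X"
        unfolding fps_ln_fps_exp_inv[OF one_neq_zero] by (rule fps_inv_right) simp_all
      then show ?thesis by (simp add: fps_compose_sub_distrib algebra_simps)
    qed
    have "fps_nth (fps_subst (\<lambda>m. 1 / fact m) F) n =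
        fps_nth ((fps_exp 1 :: real fps) oo fps_ln 1) n *\<^sub>R X ^ n"
      by (simp add: fps_subst_def Fpow fps_compose_nth scaleR_left.sum atMost_atLeast0)
    then show ?thesis by (simp only: e)
  qed
  have "exp (banach_log X) = exp (fps_sum 1 F)"
    by (simp add: banach_log_def fps_sum_def F_def)
  also have "\<dots> = fps_sum 1 (fps_subst (\<lambda>m. 1 / fact m) F)"
    using fps_subst_sum(2)[OF F F0 c, of 1] by (simp add: exp_def divide_inverse)
  also have "\<dots> = (\<Sum>n\<in>{0, 1}. fps_nth (1 + fps_X :: real fps) n *\<^sub>R X ^ n)"
    unfolding fps_sum_def nth by (subst suminf_finite[of "{0, 1}"]) auto
  also have "\<dots> = 1 + X" by simp
  finally show ?thesis .
qed

subsection \<open>Uniqueness of coefficients\<close>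

text \<open>Once the lower coefficients vanish, dividing by l^n leaves \<open>- c n\<close> equal to
  a tail that is O(l) by a geometric majorant; l tends to 0 from the right.\<close>

lemma powser_eq_0_imp_coeff_0:
  fixes c :: "nat \<Rightarrow> 'c :: banach"
  assumes r: "r > 0" and s: "\<And>l :: real. \<bar>l\<bar> < r \<Longrightarrow> (\<lambda>n. l ^ n *\<^sub>R c n) sums 0"
  shows "c n = 0"
proof (induction n rule: less_induct)
  case (less n)
  define h where "h = r / 2"
  have h: "0 < h" "h < r" using r by (auto simp: h_def)
  have "summable (\<lambda>k. h ^ k *\<^sub>R c k)" using s[of h] h by (auto simp: sums_iff)
  then have "Bseq (\<lambda>k. h ^ k *\<^sub>R c k)"
    using summable_LIMSEQ_zero convergentI convergent_imp_Bseq by blast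
  then obtain K where K: "K > 0" "\<And>k. norm (h ^ k *\<^sub>R c k) \<le> K" by (auto elim: BseqE)
  have bound: "norm (c n) \<le> l * (2 * K / h ^ Suc n)" if l: "0 < l" "l < h / 2" for l
  proof -
    have lr: "\<bar>l\<bar> < r" using l h by simp
    have 1: "(\<lambda>k. l ^ (k + n) *\<^sub>R c (k + n)) sums 0"
      using sums_iff_shift[of "\<lambda>k. l ^ k *\<^sub>R c k" n 0] s[OF lr] less.IH by simp
    have 2: "(\<lambda>k. l ^ k *\<^sub>R c (k + n)) sums 0"
    proof -
      have "(\<lambda>k. inverse (l ^ n) *\<^sub>R l ^ (k + n) *\<^sub>R c (k + n)) sums (inverse (l ^ n) *\<^sub>R 0)"
        by (rule bounded_linear.sums[OF bounded_linear_scaleR_right 1])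
      moreover have "inverse (l ^ n) *\<^sub>R l ^ (k + n) *\<^sub>R c (k + n) = l ^ k *\<^sub>R c (k + n)" for k
        using l by (simp add: power_add)
      ultimately show ?thesis by (simp only: scaleR_zero_right)
    qed
    then have 3: "(\<lambda>k. l ^ Suc k *\<^sub>R c (Suc k + n)) sums (- c n)"
      using sums_Suc_iff[of "\<lambda>k. l ^ k *\<^sub>R c (k + n)" "- c n"] by simp
    have le: "norm (l ^ Suc k *\<^sub>R c (Suc k + n)) \<le> l * K / h ^ Suc n * (1 / 2) ^ k" for k
    proof -
      have "norm (c (Suc k + n)) \<le> K / h ^ (Suc k + n)"
        using K(2)[of "Suc k + n"] h by (simp add: field_simps)
      then have "norm (l ^ Suc k *\<^sub>R c (Suc k + n)) \<le> l ^ Suc k * (K / h ^ (Suc k + n))"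
        using l mult_left_mono[of "norm (c (Suc k + n))" "K / h ^ (Suc k + n)" "l ^ Suc k"]
        by (simp add: power_abs abs_mult)
      also have "\<dots> = l * K / h ^ Suc n * (l / h) ^ k"
        using h by (simp add: field_simps power_add)
      also have "\<dots> \<le> l * K / h ^ Suc n * (1 / 2) ^ k"
        using l h K by (intro mult_left_mono power_mono) (auto simp: field_simps)
      finally show ?thesis .
    qed
    have g: "(\<lambda>k. l * K / h ^ Suc n * (1 / 2) ^ k) sums (l * K / h ^ Suc n * 2)"
      using sums_mult[OF geometric_sums[of "1 / 2 :: real"], of "l * K / h ^ Suc n"] by simp
    have "norm (- c n) \<le> l * K / h ^ Suc n * 2"
      using norm_suminf_le[OF le sums_summable[OF g]] sums_unique[OF 3] sums_unique[OF g] by simp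
    then show ?thesis by (simp add: field_simps)
  qed
  have "((\<lambda>l. l * (2 * K / h ^ Suc n)) \<longlongrightarrow> 0 * (2 * K / h ^ Suc n)) (at_right 0)"
    by (intro tendsto_intros)
  moreover have "\<forall>\<^sub>F l in at_right 0. norm (c n) \<le> l * (2 * K / h ^ Suc n)"
    using eventually_at_right_less[of 0] eventually_at_right_field[of _ 0] bound h
    by (auto simp: eventually_at_right_field intro!: exI[of _ "h / 2"])
  ultimately have "norm (c n) \<le> 0 * (2 * K / h ^ Suc n)"
    by (intro tendsto_lowerbound) auto
  then show ?case by simp
qed

section \<open>Ordered products of exponentials\<close>

definition exp_fps :: "'c :: real_normed_algebra_1 \<Rightarrow> 'c fps"
  where "exp_fps a = Abs_fps (\<lambda>n. a ^ n /\<^sub>R fact n)"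

text \<open>The expansion in \<lambda> of exp (\<lambda> a_(j-1)) ... exp (\<lambda> a_0), later
  factors to the left: its coefficients are the time-ordered (Dyson) integrals of a generator that
  is constant on unit intervals.\<close>

primrec dyson :: "(nat \<Rightarrow> 'c :: real_normed_algebra_1) \<Rightarrow> nat \<Rightarrow> 'c fps"
  where
    "dyson a 0 = 1"
  | "dyson a (Suc j) = exp_fps (a j) * dyson a j"

lemma dyson_nth_Suc:
  "fps_nth (dyson a (Suc j)) n = (\<Sum>i\<le>n. (a j ^ i /\<^sub>R fact i) * fps_nth (dyson a j) (n - i))"
  by (simp add: fps_mult_nth exp_fps_def atMost_atLeast0)

lemma dyson_nth_0 [simp]: "fps_nth (dyson a j) 0 = 1"
  by (induction j) (simp_all add: exp_fps_def)

section \<open>Norm bounds by comparison with commuting scalars\<close>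

lemma power_add_over_fact:
  fixes x y :: real
  shows "(x + y) ^ n / fact n = (\<Sum>i\<le>n. x ^ i / fact i * (y ^ (n - i) / fact (n - i)))"
  using exp_series_add_commuting[of x y n] by (simp add: divide_inverse mult.commute)

lemma sum_power_over_fact_Suc:
  fixes x :: real
  shows "(\<Sum>i\<le>n. x ^ i / fact i * ((real j * x) ^ (n - i) / fact (n - i))) = (real (Suc j) * x) ^ n / fact n"
  using power_add_over_fact[of x "real j * x" n] by (simp add: distrib_right)

lemma norm_dyson_nth_le:
  fixes a :: "nat \<Rightarrow> 'c :: {real_normed_algebra_1, banach}"
  assumes "\<And>i. i < R \<Longrightarrow> norm (a i) \<le> \<alpha>" "j \<le> R"
  shows "norm (fps_nth (dyson a j) n) \<le> (real j * \<alpha>) ^ n / fact n"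
  using assms(2)
proof (induction j arbitrary: n)
  case 0
  show ?case by (cases n) auto
next
  case (Suc j)
  have a: "norm (a j) \<le> \<alpha>" using assms Suc.prems by simp
  then have "0 \<le> \<alpha>" using norm_ge_zero order_trans by blast
  have "norm (fps_nth (dyson a (Suc j)) n)
      \<le> (\<Sum>i\<le>n. \<alpha> ^ i / fact i * ((real j * \<alpha>) ^ (n - i) / fact (n - i)))"
    unfolding dyson_nth_Suc
  proof (intro sum_norm_le order_trans[OF norm_mult_ineq] mult_mono)
    fix i
    show "norm (a j ^ i /\<^sub>R fact i) \<le> \<alpha> ^ i / fact i"
      using order_trans[OF norm_power_ineq power_mono[OF a norm_ge_zero]]
      by (simp add: divide_inverse mult.commute[of _ "inverse _"] mult_left_mono)
    show "norm (fps_nth (dyson a j) (n - i)) \<le> (real j * \<alpha>) ^ (n - i) / fact (n - i)"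
      using Suc by simp
  qed (use \<open>0 \<le> \<alpha>\<close> in auto)
  also have "\<dots> = (real (Suc j) * \<alpha>) ^ n / fact n"
    by (rule sum_power_over_fact_Suc)
  finally show ?case .
qed

lemma norm_power_diff_le:
  fixes x y :: "'c :: real_normed_algebra_1"
  assumes "norm y \<le> \<beta>" "norm (x - y) \<le> \<gamma>"
  shows "norm (x ^ n - y ^ n) \<le> (\<beta> + \<gamma>) ^ n - \<beta> ^ n"
proof (induction n)
  case (Suc n)
  have nn: "0 \<le> \<beta>" "0 \<le> \<gamma>" using assms norm_ge_zero order_trans by blast+
  have x: "norm x \<le> \<beta> + \<gamma>" using norm_triangle_sub[of x y] assms by linarith
  have "x ^ Suc n - y ^ Suc n = x * (x ^ n - y ^ n) + (x - y) * y ^ n"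
    by (simp add: algebra_simps)
  also have "norm \<dots> \<le> (\<beta> + \<gamma>) * ((\<beta> + \<gamma>) ^ n - \<beta> ^ n) + \<gamma> * \<beta> ^ n"
  proof (intro norm_triangle_mono order_trans[OF norm_mult_ineq] mult_mono)
    show "norm (y ^ n) \<le> \<beta> ^ n"
      by (rule order_trans[OF norm_power_ineq power_mono[OF assms(1) norm_ge_zero]])
  qed (use nn x Suc assms in auto)
  finally show ?case by (simp add: algebra_simps)
qed simp

text \<open>Expanding every factor as b plus a deviation, the order-n difference consists of the
  words with at least one deviation. The scalar model of these words is the difference of the n-th
  powers of j (\<beta> + \<gamma>) and j \<beta>; the induction telescopes to it exactly.\<close>

lemma norm_dyson_nth_diff_le:
  fixes a :: "nat \<Rightarrow> 'c :: {real_normed_algebra_1, banach}"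
  assumes b: "norm b \<le> \<beta>" and a: "\<And>i. i < R \<Longrightarrow> norm (a i - b) \<le> \<gamma>" and j: "j \<le> R"
  shows "norm (fps_nth (dyson a j) n - (real j *\<^sub>R b) ^ n /\<^sub>R fact n)
    \<le> ((real j * (\<beta> + \<gamma>)) ^ n - (real j * \<beta>) ^ n) / fact n"
  using j
proof (induction j arbitrary: n)
  case 0
  show ?case by (cases n) auto
next
  case (Suc j)
  let ?c = "\<lambda>n. fps_nth (dyson a j) n" and ?d = "\<lambda>n. (real j *\<^sub>R b) ^ n /\<^sub>R fact n"
  have aj: "norm (a j - b) \<le> \<gamma>" using a Suc.prems by simp
  have nn: "0 \<le> \<beta>" "0 \<le> \<gamma>" using b aj norm_ge_zero order_trans by blast+
  have an: "norm (a i) \<le> \<beta> + \<gamma>" if "i < R" for i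
    using norm_triangle_sub[of "a i" b] a[OF that] b by linarith
  have c: "norm (?c m) \<le> (real j * (\<beta> + \<gamma>)) ^ m / fact m" for m
    using norm_dyson_nth_le[of R a, OF an] Suc.prems by simp
  have tele: "(p - q) / f * (u / g) + q / f * ((u - v) / g) = p / f * (u / g) - q / f * (v / g)"
    for p q f u v g :: real
    by (simp add: diff_divide_distrib left_diff_distrib right_diff_distrib)
  have "(real (Suc j) *\<^sub>R b) ^ n /\<^sub>R fact n = (b + real j *\<^sub>R b) ^ n /\<^sub>R fact n"
    by (simp add: algebra_simps)
  also have "\<dots> = (\<Sum>i\<le>n. (b ^ i /\<^sub>R fact i) * ?d (n - i))"
    by (rule exp_series_add_commuting) simp
  finally have diff: "fps_nth (dyson a (Suc j)) n - (real (Suc j) *\<^sub>R b) ^ n /\<^sub>R fact n =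
      (\<Sum>i\<le>n. (a j ^ i /\<^sub>R fact i - b ^ i /\<^sub>R fact i) * ?c (n - i)
        + (b ^ i /\<^sub>R fact i) * (?c (n - i) - ?d (n - i)))"
    unfolding dyson_nth_Suc
    by (simp only: sum_subtractf[symmetric] left_diff_distrib right_diff_distrib) simp
  have "norm (fps_nth (dyson a (Suc j)) n - (real (Suc j) *\<^sub>R b) ^ n /\<^sub>R fact n)
      \<le> (\<Sum>i\<le>n. ((\<beta> + \<gamma>) ^ i - \<beta> ^ i) / fact i * ((real j * (\<beta> + \<gamma>)) ^ (n - i) / fact (n - i))
      + \<beta> ^ i / fact i * (((real j * (\<beta> + \<gamma>)) ^ (n - i) - (real j * \<beta>) ^ (n - i)) / fact (n - i)))"
    unfolding diff
  proof (intro sum_norm_le norm_triangle_mono order_trans[OF norm_mult_ineq] mult_mono c)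
    fix i
    have "norm (a j ^ i /\<^sub>R fact i - b ^ i /\<^sub>R fact i) = norm (a j ^ i - b ^ i) / fact i"
      unfolding scaleR_diff_right[symmetric] by (simp add: divide_inverse)
    then show "norm (a j ^ i /\<^sub>R fact i - b ^ i /\<^sub>R fact i) \<le> ((\<beta> + \<gamma>) ^ i - \<beta> ^ i) / fact i"
      using norm_power_diff_le[OF b aj] by (simp add: divide_right_mono)
    show "norm (b ^ i /\<^sub>R fact i) \<le> \<beta> ^ i / fact i"
      using order_trans[OF norm_power_ineq power_mono[OF b norm_ge_zero]]
      by (simp add: divide_inverse mult.commute[of _ "inverse _"] mult_left_mono)
    show "norm (?c (n - i) - ?d (n - i))
        \<le> ((real j * (\<beta> + \<gamma>)) ^ (n - i) - (real j * \<beta>) ^ (n - i)) / fact (n - i)"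
      using Suc by simp
    show "0 \<le> ((\<beta> + \<gamma>) ^ i - \<beta> ^ i) / fact i"
      using nn by (simp add: power_mono)
  qed (use nn in auto)
  also have "\<dots> = (\<Sum>i\<le>n. (\<beta> + \<gamma>) ^ i / fact i * ((real j * (\<beta> + \<gamma>)) ^ (n - i) / fact (n - i)))
      - (\<Sum>i\<le>n. \<beta> ^ i / fact i * ((real j * \<beta>) ^ (n - i) / fact (n - i)))"
    unfolding tele sum_subtractf by (rule refl)
  also have "\<dots> = ((real (Suc j) * (\<beta> + \<gamma>)) ^ n - (real (Suc j) * \<beta>) ^ n) / fact n"
    unfolding sum_power_over_fact_Suc by (rule diff_divide_distrib[symmetric])
  finally show ?case .
qed

lemma fps_bounded_exp_fps:
  fixes a :: "'c :: {real_normed_algebra_1, banach}"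
  shows "fps_bounded (exp_fps a) (exp (norm a))"
proof -
  have le: "norm (fps_nth (exp_fps a) n) \<le> norm a ^ n /\<^sub>R fact n" for n
    by (simp add: exp_fps_def mult_left_mono norm_power_ineq)
  have s: "summable (\<lambda>n. norm (fps_nth (exp_fps a) n))"
    using le by (intro summable_comparison_test'[OF summable_exp_generic[of "norm a"]]) auto
  then show ?thesis
    using suminf_le[OF le s summable_exp_generic] by (simp add: fps_bounded_def exp_def)
qed

lemma fps_sum_exp_fps: "fps_sum l (exp_fps a) = exp (l *\<^sub>R a)"
  by (simp add: fps_sum_def exp_fps_def exp_def scaleR_power mult.commute)

lemma fps_sum_dyson:
  fixes a :: "nat \<Rightarrow> 'c :: {real_normed_algebra_1, banach}"
  assumes l: "\<bar>l\<bar> \<le> 1"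
  shows "fps_sum l (dyson a j) = (\<Prod>i\<leftarrow>rev [0..<j]. exp (l *\<^sub>R a i))"
proof (induction j)
  case (Suc j)
  have "\<exists>q. fps_bounded (dyson a j) q"
    by (induction j) (use fps_bounded_1 fps_bounded_mult[OF fps_bounded_exp_fps] in auto)
  then obtain q where "fps_bounded (dyson a j) q" ..
  from fps_sum_mult[OF fps_bounded_exp_fps this l] show ?case
    by (simp add: Suc fps_sum_exp_fps)
qed (simp add: fps_sum_1)

section \<open>Palindromic products and inversion of the parameter\<close>

lemma prod_exp_minus:
  fixes a :: "nat \<Rightarrow> 'c :: {real_normed_algebra_1, banach}"
  shows "(\<Prod>i\<leftarrow>xs. exp (- a i)) * (\<Prod>i\<leftarrow>rev xs. exp (a i)) = 1"
proof (induction xs)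
  case (Cons i xs)
  have "(\<Prod>i\<leftarrow>i # xs. exp (- a i)) * (\<Prod>i\<leftarrow>rev (i # xs). exp (a i)) =
      exp (- a i) * ((\<Prod>i\<leftarrow>xs. exp (- a i)) * (\<Prod>i\<leftarrow>rev xs. exp (a i))) * exp (a i)"
    by (simp add: mult.assoc)
  also have "\<dots> = 1"
    using exp_minus_inverse[of "- a i"] by (simp add: Cons)
  finally show ?case .
qed simp

text \<open>The inverse of a product of exponentials has negated exponents in reversed order; for a
  palindromic list the reversal has no effect, so negating the parameter inverts the
  product.\<close>

lemma fps_sum_dyson_inverse:
  fixes a :: "nat \<Rightarrow> 'c :: {real_normed_algebra_1, banach}"
  assumes sym: "\<And>i. i < R \<Longrightarrow> a (R - 1 - i) = a i"
  shows "fps_sum (- 1) (dyson a R) * fps_sum 1 (dyson a R) = 1"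
proof -
  have "map a (rev [0..<R]) = map a [0..<R]"
    by (rule nth_equalityI) (auto simp: rev_nth sym[simplified])
  then have "map (\<lambda>x. exp (- x)) (map a (rev [0..<R])) = map (\<lambda>x. exp (- x)) (map a [0..<R])"
    by (simp only:)
  then have "(\<Prod>i\<leftarrow>rev [0..<R]. exp (- a i)) = (\<Prod>i\<leftarrow>[0..<R]. exp (- a i))"
    by (simp add: o_def)
  then show ?thesis
    using prod_exp_minus[of a "[0..<R]"] by (simp add: fps_sum_dyson)
qed

lemma dyson_nth_1: "fps_nth (dyson a j) (Suc 0) = (\<Sum>i<j. a i)"
  by (induction j) (simp_all add: exp_fps_def)

subsection \<open>The third-order coefficient\<close>

lemma dyson_nth_2_Suc:
  "fps_nth (dyson a (Suc j)) 2 = fps_nth (dyson a j) 2 + a j * (\<Sum>i<j. a i) + (1 / 2) *\<^sub>R (a j * a j)"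
  by (simp only: dyson_nth_Suc eval_nat_numeral sum.atMost_Suc sum.atMost_Suc[of _ "Suc 0"])
    (simp add: dyson_nth_1 dyson_nth_Suc numeral_2_eq_2)

lemma dyson_nth_3_Suc:
  "fps_nth (dyson a (Suc j)) 3 = fps_nth (dyson a j) 3 + a j * fps_nth (dyson a j) 2
    + (1 / 2) *\<^sub>R (a j * a j * (\<Sum>i<j. a i)) + (1 / 6) *\<^sub>R (a j * a j * a j)"
  by (simp only: dyson_nth_Suc eval_nat_numeral sum.atMost_Suc)
    (simp add: dyson_nth_1 numeral_2_eq_2 numeral_3_eq_3 fact_numeral mult.assoc)

definition wsum :: "(nat \<Rightarrow> real) \<Rightarrow> (nat \<Rightarrow> 'c :: real_normed_vector) \<Rightarrow> nat \<Rightarrow> 'c"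
  where "wsum w e j = (\<Sum>i<j. w i *\<^sub>R e i)"

lemma wsum_0 [simp]: "wsum w e 0 = 0"
  and wsum_Suc: "wsum w e (Suc j) = wsum w e j + w j *\<^sub>R e j"
  by (simp_all add: wsum_def)

lemma wsum_add: "wsum w e j + wsum v e j = wsum (\<lambda>i. w i + v i) e j"
  by (simp add: wsum_def sum.distrib scaleR_left_distrib)

lemma wsum_scale: "c *\<^sub>R wsum w e j = wsum (\<lambda>i. c * w i) e j"
  by (simp add: wsum_def scaleR_right.sum)

lemma wsum_cong: "(\<And>i. i < j \<Longrightarrow> w i = v i) \<Longrightarrow> wsum w e j = wsum v e j"
  by (simp add: wsum_def)

lemma norm_wsum_le:
  assumes "\<And>i. i < j \<Longrightarrow> norm (e i) \<le> \<gamma>"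
  shows "norm (wsum w e j) \<le> (\<Sum>i<j. \<bar>w i\<bar>) * \<gamma>"
  unfolding wsum_def sum_distrib_right
  by (intro sum_norm_le) (use assms in \<open>auto intro: mult_left_mono\<close>)

text \<open>The integrals over \<open>[i, i + 1]\<close> of \<open>j - t\<close>, \<open>t\<close>, \<open>(j - t)\<^sup>2 / 2\<close>, \<open>t (j - t)\<close> and \<open>t\<^sup>2 / 2\<close>, which are the
  weights of \<open>e i\<close> in the time-ordered integrals.\<close>

abbreviation (input) "w\<^sub>A j \<equiv> (\<lambda>i. real j - real i - 1 / 2)"
abbreviation (input) "w\<^sub>C \<equiv> (\<lambda>i. real i + 1 / 2)"
abbreviation (input) "w\<^sub>p j \<equiv> (\<lambda>i. (real j - real i) * (real j - real i - 1) / 2 + 1 / 6)"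
abbreviation (input) "w\<^sub>q j \<equiv> (\<lambda>i. (real j - 1 - real i) * (real i + 1 / 2) + real i / 2 + 1 / 6)"
abbreviation (input) "w\<^sub>r \<equiv> (\<lambda>i. real i * (real i + 1) / 2 + 1 / 6)"

lemma wsum_A_Suc: "wsum (w\<^sub>A (Suc j)) e (Suc j) = wsum (w\<^sub>A j) e j + wsum (\<lambda>_. 1) e j + (1 / 2) *\<^sub>R e j"
  unfolding wsum_Suc wsum_scale wsum_add
  by (rule arg_cong2[where f = "(+)"], rule wsum_cong) (simp_all add: field_simps)

text \<open>On the old slots (j + 1 - t)^2 / 2 = (j - t)^2 / 2 + (j - t) + 1/2, and the new slot
  contributes the integral 1/6. The recursion for the middle weights likewise comes from t (j + 1 -
  t) = t (j - t) + t.\<close>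

lemma wsum_p_Suc:
  "wsum (w\<^sub>p (Suc j)) e (Suc j) =
    wsum (w\<^sub>p j) e j + wsum (w\<^sub>A j) e j + (1 / 2) *\<^sub>R wsum (\<lambda>_. 1) e j + (1 / 6) *\<^sub>R e j"
  unfolding wsum_Suc wsum_scale wsum_add
  by (rule arg_cong2[where f = "(+)"], rule wsum_cong) (simp_all add: field_simps)

lemma wsum_q_Suc:
  "wsum (w\<^sub>q (Suc j)) e (Suc j) = wsum (w\<^sub>q j) e j + wsum w\<^sub>C e j + (real j / 2 + 1 / 6) *\<^sub>R e j"
  unfolding wsum_Suc wsum_scale wsum_add
  by (rule arg_cong2[where f = "(+)"], rule wsum_cong) (simp_all add: field_simps)

text \<open>The parts of the coefficients of orders two and three that are of degree at least two in \<open>e\<close>.\<close>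

abbreviation dyson_rem2 :: "'c :: real_normed_algebra_1 \<Rightarrow> (nat \<Rightarrow> 'c) \<Rightarrow> nat \<Rightarrow> 'c"
  where "dyson_rem2 b e j \<equiv> fps_nth (dyson (\<lambda>i. b + e i) j) 2 - ((real j)\<^sup>2 / 2) *\<^sub>R (b * b)
    - (b * wsum (w\<^sub>A j) e j + wsum w\<^sub>C e j * b)"

abbreviation dyson_rem3 :: "'c :: real_normed_algebra_1 \<Rightarrow> (nat \<Rightarrow> 'c) \<Rightarrow> nat \<Rightarrow> 'c"
  where "dyson_rem3 b e j \<equiv> fps_nth (dyson (\<lambda>i. b + e i) j) 3 - (real j ^ 3 / 6) *\<^sub>R (b * b * b)
    - (b * b * wsum (w\<^sub>p j) e j + b * wsum (w\<^sub>q j) e j * b + wsum w\<^sub>r e j * b * b)"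

lemma sum_const_add_eq: "(\<Sum>i<j. b + e i) = real j *\<^sub>R b + wsum (\<lambda>_. 1) e j"
  for b :: "'c :: real_normed_algebra_1"
  by (simp add: wsum_def sum.distrib scaleR_conv_of_real)

lemma dyson_rem2_Suc:
  fixes b :: "'c :: real_normed_algebra_1"
  shows "dyson_rem2 b e (Suc j) = dyson_rem2 b e j + e j * wsum (\<lambda>_. 1) e j + (1 / 2) *\<^sub>R (e j * e j)"
proof -
  have 1: "((real (Suc j))\<^sup>2 / 2) *\<^sub>R (b * b) =
      ((real j)\<^sup>2 / 2) *\<^sub>R (b * b) + real j *\<^sub>R (b * b) + (1 / 2) *\<^sub>R (b * b)"
    by (simp add: power2_eq_square add_divide_distrib algebra_simps flip: scaleR_left_distrib)
  show ?thesis
    unfolding dyson_nth_2_Suc sum_const_add_eq 1 wsum_A_Suc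
    by (simp add: wsum_Suc algebra_simps)
qed

text \<open>The contributions of degree zero and one in \<open>e\<close> to the recursion of the
  third coefficient are the increments of the subtracted cubic and of the three weighted sums; what
  is left has degree at least two.\<close>

lemma dyson_rem3_Suc:
  fixes b :: "'c :: real_normed_algebra_1"
  shows "dyson_rem3 b e (Suc j) = dyson_rem3 b e j + b * dyson_rem2 b e j
    + e j * (b * wsum (w\<^sub>A j) e j + wsum w\<^sub>C e j * b + dyson_rem2 b e j)
    + (1 / 2) *\<^sub>R (b * e j * wsum (\<lambda>_. 1) e j + e j * b * wsum (\<lambda>_. 1) e j
        + real j *\<^sub>R (e j * e j * b) + e j * e j * wsum (\<lambda>_. 1) e j)
    + (1 / 6) *\<^sub>R (b * e j * e j + e j * b * e j + e j * e j * b + e j * e j * e j)"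
proof -
  have 1: "(real (Suc j) ^ 3 / 6) *\<^sub>R (b * b * b) =
      (real j ^ 3 / 6) *\<^sub>R (b * b * b) + ((real j)\<^sup>2 / 2) *\<^sub>R (b * b * b)
      + (real j / 2) *\<^sub>R (b * b * b) + (1 / 6) *\<^sub>R (b * b * b)"
    by (simp add: power2_eq_square power3_eq_cube field_simps flip: scaleR_left_distrib)
  have 2: "w\<^sub>r j = (real j)\<^sup>2 / 2 + real j / 2 + 1 / 6"
    by (simp add: power2_eq_square field_simps)
  show ?thesis
    unfolding dyson_nth_3_Suc sum_const_add_eq 1 wsum_p_Suc wsum_q_Suc
    unfolding wsum_Suc[of w\<^sub>r] 2
    by (simp add: algebra_simps)
qed

text \<open>For commuting scalars \<beta> and \<gamma> the third coefficient is (j (\<beta> +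
  \<gamma>))^3 / 6, and its part of degree at least two in \<gamma> is the stated bound. The
  recursions have nonnegative coefficients, so the norm estimates add up to the scalar value without
  loss.\<close>

lemma norm_dyson_rem3_le:
  fixes b :: "'c :: real_normed_algebra_1"
  assumes b: "norm b \<le> \<beta>" and e: "\<And>i. i < R \<Longrightarrow> norm (e i) \<le> \<gamma>" and j: "j \<le> R"
  shows "norm (dyson_rem3 b e j) \<le> real j ^ 3 * ((3 * \<beta> * \<gamma>\<^sup>2 + \<gamma> ^ 3) / 6)"
proof -
  have mul: "norm (x * y) \<le> p * q" if "norm x \<le> p" "norm y \<le> q" for x y :: 'c and p q
    using norm_mult_ineq mult_mono[OF that] that norm_ge_zero order_trans by metis
  have scale: "norm (r *\<^sub>R x) \<le> r * p" if "norm x \<le> p" "0 \<le> r" for x :: 'c and r p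
    using that by (simp add: mult_left_mono)
  note bd = norm_triangle_mono mul scale
  have E: "norm (wsum (\<lambda>_. 1) e j) \<le> real j * \<gamma>" if "j \<le> R" for j
    using norm_wsum_le[of j e \<gamma> "\<lambda>_. 1"] e that by auto
  have A: "norm (wsum (w\<^sub>A j) e j) \<le> (real j)\<^sup>2 / 2 * \<gamma>" if "j \<le> R" for j
    using that
  proof (induction j)
    case (Suc j)
    have "norm (wsum (w\<^sub>A (Suc j)) e (Suc j)) \<le> (real j)\<^sup>2 / 2 * \<gamma> + real j * \<gamma> + 1 / 2 * \<gamma>"
      unfolding wsum_A_Suc using Suc E e by (intro bd) auto
    then show ?case by (simp add: power2_eq_square field_simps)
  qed simp
  have C: "norm (wsum w\<^sub>C e j) \<le> (real j)\<^sup>2 / 2 * \<gamma>" if "j \<le> R" for j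
    using that
  proof (induction j)
    case (Suc j)
    have "norm (wsum w\<^sub>C e (Suc j)) \<le> (real j)\<^sup>2 / 2 * \<gamma> + w\<^sub>C j * \<gamma>"
      unfolding wsum_Suc using Suc e by (intro bd) auto
    then show ?case by (simp add: power2_eq_square field_simps)
  qed simp
  have r2: "norm (dyson_rem2 b e j) \<le> (real j)\<^sup>2 * \<gamma>\<^sup>2 / 2" if "j \<le> R" for j
    using that
  proof (induction j)
    case 0
    show ?case by (simp add: numeral_2_eq_2)
  next
    case (Suc j)
    have "norm (dyson_rem2 b e (Suc j))
        \<le> (real j)\<^sup>2 * \<gamma>\<^sup>2 / 2 + \<gamma> * (real j * \<gamma>) + 1 / 2 * (\<gamma> * \<gamma>)"
      unfolding dyson_rem2_Suc using Suc E e by (intro bd) auto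
    then show ?case by (simp add: power2_eq_square field_simps)
  qed
  have "norm (dyson_rem3 b e j) \<le> real j ^ 3 * ((3 * \<beta> * \<gamma>\<^sup>2 + \<gamma> ^ 3) / 6)"
    using j
  proof (induction j)
    case 0
    show ?case by (simp add: numeral_3_eq_3)
  next
    case (Suc j)
    have jR: "j < R" "j \<le> R" using Suc.prems by auto
    have "norm (dyson_rem3 b e (Suc j)) \<le> real j ^ 3 * ((3 * \<beta> * \<gamma>\<^sup>2 + \<gamma> ^ 3) / 6)
        + \<beta> * ((real j)\<^sup>2 * \<gamma>\<^sup>2 / 2)
        + \<gamma> * (\<beta> * ((real j)\<^sup>2 / 2 * \<gamma>) + (real j)\<^sup>2 / 2 * \<gamma> * \<beta> + (real j)\<^sup>2 * \<gamma>\<^sup>2 / 2)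
        + 1 / 2 * (\<beta> * \<gamma> * (real j * \<gamma>) + \<gamma> * \<beta> * (real j * \<gamma>) + real j * (\<gamma> * \<gamma> * \<beta>)
            + \<gamma> * \<gamma> * (real j * \<gamma>))
        + 1 / 6 * (\<beta> * \<gamma> * \<gamma> + \<gamma> * \<beta> * \<gamma> + \<gamma> * \<gamma> * \<beta> + \<gamma> * \<gamma> * \<gamma>)"
      unfolding dyson_rem3_Suc
      by (intro bd b e[OF jR(1)] E[OF jR(2)] A[OF jR(2)] C[OF jR(2)] r2[OF jR(2)] Suc.IH[OF jR(2)]) auto
    also have "\<dots> = real (Suc j) ^ 3 * ((3 * \<beta> * \<gamma>\<^sup>2 + \<gamma> ^ 3) / 6)"
      by (simp add: power2_eq_square power3_eq_cube field_simps)
    finally show ?case .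
  qed
  then show ?thesis .
qed

text \<open>The right-hand side is a difference of values of B_3 / 3, with B_3 the third Bernoulli
  polynomial; fourth powers use B_5 / 5. The shift s serves to centre the slots at the middle of the
  interval.\<close>

lemma sum_shifted_squares:
  "(\<Sum>i<n. (real i + s)\<^sup>2) = ((real n + s) ^ 3 / 3 - (real n + s)\<^sup>2 / 2 + (real n + s) / 6)
    - (s ^ 3 / 3 - s\<^sup>2 / 2 + s / 6)"
  by (induction n) (simp_all add: power2_eq_square power3_eq_cube field_simps)

lemma sum_shifted_fourth_powers:
  "(\<Sum>i<n. (real i + s) ^ 4) =
    ((real n + s) ^ 5 / 5 - (real n + s) ^ 4 / 2 + (real n + s) ^ 3 / 3 - (real n + s) / 30)
    - (s ^ 5 / 5 - s ^ 4 / 2 + s ^ 3 / 3 - s / 30)"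
  by (induction n) (simp_all add: eval_nat_numeral field_simps)

text \<open>By Cauchy-Schwarz: the variance of the second Bernoulli polynomial on the unit interval is
  \<open>1/180\<close>, and \<open>6/180 + 1/24 = 0.075\<close>.\<close>

lemma sum_abs_bernoulli_le:
  fixes R :: nat
  assumes "R \<ge> 2"
  shows "(\<Sum>i<R. \<bar>(real R)\<^sup>2 / 12 - (real i + (1 / 2 - real R / 2))\<^sup>2\<bar>) \<le> 0.075 * real R ^ 3"
proof -
  let ?r = "real R"
  let ?s = "1 / 2 - ?r / 2"
  let ?g = "\<lambda>i. ?r\<^sup>2 / 12 - (real i + ?s)\<^sup>2"
  have r: "?r \<ge> 2" using assms by simp
  \<comment> \<open>Young's inequality with threshold R^2 / 12. The optimal threshold would be the
    root mean square, about R^2 / sqrt 180; R^2 / 12 is close to it and rational.\<close>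
  have abs_le: "\<bar>y\<bar> \<le> 6 / ?r\<^sup>2 * y\<^sup>2 + ?r\<^sup>2 / 24" for y
  proof -
    have "0 \<le> (\<bar>y\<bar> - ?r\<^sup>2 / 12)\<^sup>2" by simp
    then have "\<bar>y\<bar> * ?r\<^sup>2 / 6 \<le> y\<^sup>2 + (?r\<^sup>2 / 12)\<^sup>2"
      by (simp add: power2_diff)
    then have "6 / ?r\<^sup>2 * (\<bar>y\<bar> * ?r\<^sup>2 / 6) \<le> 6 / ?r\<^sup>2 * (y\<^sup>2 + (?r\<^sup>2 / 12)\<^sup>2)"
      by (intro mult_left_mono) auto
    then show ?thesis using r by (simp add: power2_eq_square field_simps)
  qed
  have "(\<Sum>i<R. (?g i)\<^sup>2) = (\<Sum>i<R. (?r\<^sup>2 / 12)\<^sup>2 - ?r\<^sup>2 / 6 * (real i + ?s)\<^sup>2 + (real i + ?s) ^ 4)"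
    by (intro sum.cong refl) (simp add: power2_diff flip: power_mult)
  also have "\<dots> = ?r * (?r\<^sup>2 / 12)\<^sup>2 - ?r\<^sup>2 / 6 * (\<Sum>i<R. (real i + ?s)\<^sup>2) + (\<Sum>i<R. (real i + ?s) ^ 4)"
    by (simp add: sum.distrib sum_subtractf sum_distrib_left)
  also have "\<dots> = ?r ^ 5 / 180 - ?r ^ 3 / 36 + 7 * ?r / 240"
    unfolding sum_shifted_squares sum_shifted_fourth_powers
    by (simp add: eval_nat_numeral field_simps)
  also have "\<dots> \<le> ?r ^ 5 / 180"
  proof -
    have "?r * (7 / 240) \<le> ?r * (?r\<^sup>2 / 36)"
      using r mult_mono[of 2 ?r 2 ?r] by (intro mult_left_mono) (auto simp: power2_eq_square)
    then show ?thesis by (simp add: power2_eq_square power3_eq_cube)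
  qed
  finally have sq: "(\<Sum>i<R. (?g i)\<^sup>2) \<le> ?r ^ 5 / 180" .
  have "(\<Sum>i<R. \<bar>?g i\<bar>) \<le> (\<Sum>i<R. 6 / ?r\<^sup>2 * (?g i)\<^sup>2 + ?r\<^sup>2 / 24)"
    by (intro sum_mono abs_le)
  also have "\<dots> = 6 / ?r\<^sup>2 * (\<Sum>i<R. (?g i)\<^sup>2) + ?r * (?r\<^sup>2 / 24)"
    by (simp add: sum.distrib sum_distrib_left)
  also have "\<dots> \<le> 6 / ?r\<^sup>2 * (?r ^ 5 / 180) + ?r * (?r\<^sup>2 / 24)"
    using sq by (intro add_right_mono mult_left_mono) auto
  also have "\<dots> = 0.075 * ?r ^ 3"
    using r by (simp add: eval_nat_numeral field_simps)
  finally show ?thesis .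
qed

text \<open>Since the sequence is palindromic and the \<open>e i\<close> sum to zero, the part of the third-order
  coefficient that is linear in \<open>e\<close> is the double commutator of \<open>b\<close> with a single weighted sum of
  the \<open>e i\<close>, whose weights are free up to a constant.\<close>

lemma norm_dyson_nth_3_diff_le:
  fixes b :: "'c :: {real_normed_algebra_1, banach}"
  assumes b: "norm b \<le> \<beta>" and e: "\<And>i. i < R \<Longrightarrow> norm (e i) \<le> \<gamma>" and R: "R \<ge> 2"
    and sum0: "(\<Sum>i<R. e i) = 0" and sym: "\<And>i. i < R \<Longrightarrow> e (R - 1 - i) = e i"
  shows "norm (fps_nth (dyson (\<lambda>i. b + e i) R) 3 - (real R *\<^sub>R b) ^ 3 /\<^sub>R fact 3)
    \<le> 2 / 9 * \<gamma> * (\<beta> + \<gamma>)\<^sup>2 * real R ^ 3"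
proof -
  have nn: "0 \<le> \<beta>" "0 \<le> \<gamma>" using order_trans[OF norm_ge_zero b] order_trans[OF norm_ge_zero e[of 0]] R by auto
  let ?p = "wsum (w\<^sub>p R) e R" and ?q = "wsum (w\<^sub>q R) e R" and ?r = "wsum w\<^sub>r e R"
  have const: "wsum (\<lambda>_. c) e R = 0" for c
    using sum0 by (simp add: wsum_def flip: scaleR_right.sum)
  \<comment> \<open>Reversing the slots exchanges the weights (R - t)^2 / 2 and t^2 / 2.\<close>
  have pr: "?p = ?r"
    unfolding wsum_def
  proof (rule sum.reindex_bij_witness[of _ "\<lambda>i. R - 1 - i" "\<lambda>i. R - 1 - i"])
    fix i assume "i \<in> {..<R}"
    then have i: "i < R" by simp
    then have "real (R - 1 - i) = real R - real i - 1" by simp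
    then show "w\<^sub>r (R - 1 - i) *\<^sub>R e (R - 1 - i) = w\<^sub>p R i *\<^sub>R e i"
      using sym[OF i] by (simp add: mult.commute)
  qed auto
  \<comment> \<open>The three weights add up to ((R - t) + t)^2 / 2, a constant, and constants are
    annihilated because the \<open>e i\<close> sum to zero.\<close>
  have "?p + ?r + ?q = wsum (\<lambda>_. (real R)\<^sup>2 / 2) e R"
    unfolding wsum_add by (rule wsum_cong) (simp add: power2_eq_square field_simps)
  then have "?q = - (?r + ?r)"
    unfolding const pr by (simp only: add_eq_0_iff)
  then have q: "?q = - (2 *\<^sub>R ?r)" by (simp only: scaleR_2)
  have "norm ?q \<le> 0.075 * real R ^ 3 * \<gamma>"
  proof -
    \<comment> \<open>From t (R - t) = R^2 / 4 - (t - R/2)^2. Of the constant only R^2 / 12 is kept,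
      the mean of (t - R/2)^2 over the interval, so that the remaining weights nearly average to
      zero; the last 1/12 comes from integrating over a slot.\<close>
    have "?q = wsum (\<lambda>i. (real R)\<^sup>2 / 12 - (real i + (1 / 2 - real R / 2))\<^sup>2) e R
        + wsum (\<lambda>i. (real R)\<^sup>2 / 6 - 1 / 12) e R"
      unfolding wsum_add by (rule wsum_cong) (simp add: power2_eq_square field_simps)
    then have "norm ?q \<le> (\<Sum>i<R. \<bar>(real R)\<^sup>2 / 12 - (real i + (1 / 2 - real R / 2))\<^sup>2\<bar>) * \<gamma>"
      unfolding const using norm_wsum_le[OF e, of R "\<lambda>i. i"] by (simp add: norm_wsum_le[OF e])
    also have "\<dots> \<le> 0.075 * real R ^ 3 * \<gamma>"
      using sum_abs_bernoulli_le[OF R] nn by (intro mult_right_mono) auto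
    finally show ?thesis .
  qed
  then have r: "norm ?r \<le> 0.0375 * real R ^ 3 * \<gamma>" unfolding q by simp
  \<comment> \<open>The norms of the three terms count 1 + 2 + 1 = 4 copies of that of
    \<open>?r\<close>, and 4 * 0.0375 = 0.15.\<close>
  have lin: "norm (b * b * ?p + b * ?q * b + ?r * b * b) \<le> 0.15 * real R ^ 3 * \<gamma> * \<beta>\<^sup>2"
  proof -
    have m3: "norm (x * y * z) \<le> norm x * norm y * norm z" for x y z :: 'c
      by (meson mult_right_mono norm_ge_zero norm_mult_ineq order_trans)
    have bb: "norm b * norm b \<le> \<beta> * \<beta>" using b nn by (intro mult_mono) auto
    have "norm (b * b * ?p + b * ?q * b + ?r * b * b)
        \<le> norm b * norm b * norm ?r + 2 * (norm b * norm ?r * norm b) + norm ?r * norm b * norm b"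
      using m3[of b b ?r] m3[of b ?r b] m3[of ?r b b]
      unfolding pr q by (intro norm_triangle_mono) auto
    also have "\<dots> = 4 * (norm b * norm b) * norm ?r" by simp
    also have "\<dots> \<le> 4 * (\<beta> * \<beta>) * (0.0375 * real R ^ 3 * \<gamma>)"
      by (rule mult_mono[OF mult_left_mono[OF bb] r]) (use nn in auto)
    finally show ?thesis by (simp add: power2_eq_square mult_ac)
  qed
  have eq: "fps_nth (dyson (\<lambda>i. b + e i) R) 3 - (real R *\<^sub>R b) ^ 3 /\<^sub>R fact 3
      = dyson_rem3 b e R + (b * b * ?p + b * ?q * b + ?r * b * b)"
    by (simp add: power3_eq_cube fact_numeral mult.assoc)
  have "norm (fps_nth (dyson (\<lambda>i. b + e i) R) 3 - (real R *\<^sub>R b) ^ 3 /\<^sub>R fact 3)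
      \<le> real R ^ 3 * ((3 * \<beta> * \<gamma>\<^sup>2 + \<gamma> ^ 3) / 6) + 0.15 * real R ^ 3 * \<gamma> * \<beta>\<^sup>2"
    unfolding eq by (intro norm_triangle_mono norm_dyson_rem3_le[OF b e] lin) auto
  also have "\<dots> = real R ^ 3 * \<gamma> * (\<beta> * \<gamma> / 2 + \<gamma>\<^sup>2 / 6 + 0.15 * \<beta>\<^sup>2)"
    by (simp add: power2_eq_square power3_eq_cube field_simps)
  also have "\<dots> \<le> real R ^ 3 * \<gamma> * (2 / 9 * (\<beta> + \<gamma>)\<^sup>2)"
  proof (intro mult_left_mono)
    \<comment> \<open>Termwise comparison fails, as \<beta> \<gamma> has coefficient 1/2 on one side
      and only 4/9 on the other. This expression is exactly the difference of the two sides, the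
      deficit being absorbed in the square.\<close>
    have "0 \<le> (\<beta> - \<gamma>)\<^sup>2 / 18 + (2 / 9 - 0.15 - 1 / 18) * \<beta>\<^sup>2 + \<beta> * \<gamma> / 18"
      using nn by (intro add_nonneg_nonneg) auto
    then show "\<beta> * \<gamma> / 2 + \<gamma>\<^sup>2 / 6 + 0.15 * \<beta>\<^sup>2 \<le> 2 / 9 * (\<beta> + \<gamma>)\<^sup>2"
      by (simp add: power2_eq_square field_simps)
  qed (use nn in auto)
  finally show ?thesis by (simp add: mult_ac)
qed

section \<open>The logarithm of a palindromic product of exponentials\<close>

definition bsinh :: "'c :: {real_normed_algebra_1, banach} \<Rightarrow> 'c"
  where "bsinh y = (1 / 2) *\<^sub>R (exp y - exp (- y))"

text \<open>Indices are shifted by one: m stands for order m + 1, so \<open>even m\<close> selects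
  the odd orders.\<close>

lemma fps_odd_part_sums:
  fixes V :: "'c :: {real_normed_algebra_1, banach} fps"
  assumes V: "fps_bounded V q"
  shows "(\<lambda>m. if even m then fps_nth V (Suc m) else 0) sums
    ((1 / 2) *\<^sub>R (fps_sum 1 V - fps_sum (- 1) V))"
proof -
  have s: "(\<lambda>n. l ^ n *\<^sub>R fps_nth V n) sums fps_sum l V" if "\<bar>l\<bar> \<le> 1" for l
    unfolding fps_sum_def using summable_norm_cancel[OF summable_fps_sum[OF V that]]
    by (rule summable_sums)
  have "(\<lambda>n. (1 / 2) *\<^sub>R (1 ^ n *\<^sub>R fps_nth V n - (- 1) ^ n *\<^sub>R fps_nth V n)) sums
      ((1 / 2) *\<^sub>R (fps_sum 1 V - fps_sum (- 1) V))" (is "?f sums ?S")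
    by (intro sums_scaleR_right sums_diff s) auto
  then have "(\<lambda>m. ?f (Suc m)) sums ?S"
    by (subst sums_Suc_iff) simp
  moreover have "?f (Suc m) = (if even m then fps_nth V (Suc m) else 0)" for m
    by (simp flip: scaleR_2)
  ultimately show ?thesis by (simp only:)
qed

lemma bsinh_sums:
  "(\<lambda>m. if even m then y ^ Suc m /\<^sub>R fact (Suc m) else 0) sums bsinh y"
  using fps_odd_part_sums[OF fps_bounded_exp_fps, of y]
  by (simp add: fps_sum_exp_fps bsinh_def del: fact_Suc power_Suc cong: if_cong)
    (simp add: exp_fps_def del: fact_Suc power_Suc cong: if_cong)

lemma norm_power_Suc_diff_le:
  fixes y z :: "'c :: real_normed_algebra_1"
  assumes "norm y \<le> M" "norm z \<le> M"
  shows "norm (y ^ Suc m - z ^ Suc m) \<le> real (Suc m) * M ^ m * norm (y - z)"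
proof (induction m)
  case (Suc m)
  have "0 \<le> M" using assms norm_ge_zero order_trans by blast
  have "y ^ Suc (Suc m) - z ^ Suc (Suc m) = y * (y ^ Suc m - z ^ Suc m) + (y - z) * z ^ Suc m"
    by (simp add: algebra_simps)
  also have "norm \<dots> \<le> M * (real (Suc m) * M ^ m * norm (y - z)) + norm (y - z) * M ^ Suc m"
  proof (intro norm_triangle_mono order_trans[OF norm_mult_ineq] mult_mono)
    show "norm (z ^ Suc m) \<le> M ^ Suc m"
      by (rule order_trans[OF norm_power_ineq power_mono[OF assms(2) norm_ge_zero]])
  qed (use \<open>0 \<le> M\<close> Suc assms in auto)
  also have "\<dots> = real (Suc (Suc m)) * M ^ Suc m * norm (y - z)"
    by (simp add: algebra_simps)
  finally show ?case .
qed simp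

text \<open>On the ball of radius M the term of order m + 1 has Lipschitz constant M^m / m!. Over
  even m these sum to cosh M, and subtracting the identity removes the summand 1 of m = 0.\<close>

lemma bsinh_minus_id_lipschitz:
  assumes "norm y \<le> M" "norm z \<le> M"
  shows "norm ((bsinh y - y) - (bsinh z - z)) \<le> (cosh M - 1) * norm (y - z)"
proof -
  let ?t = "\<lambda>m. (if even m then y ^ Suc m /\<^sub>R fact (Suc m) else 0)
      - (if even m then z ^ Suc m /\<^sub>R fact (Suc m) else 0)"
  let ?g = "\<lambda>m. (if even m then M ^ m /\<^sub>R fact m else 0) * norm (y - z)"
  have t: "?t sums (bsinh y - bsinh z)" by (intro sums_diff bsinh_sums)
  have g: "?g sums (cosh M * norm (y - z))" by (intro sums_mult2 cosh_converges)
  have le: "norm (?t m) \<le> ?g m" for m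
  proof (cases "even m")
    case True
    have "norm (?t m) = norm (y ^ Suc m - z ^ Suc m) / fact (Suc m)"
      using True by (simp add: divide_inverse del: fact_Suc power_Suc flip: scaleR_diff_right)
    also have "\<dots> \<le> real (Suc m) * M ^ m * norm (y - z) / fact (Suc m)"
      by (intro divide_right_mono norm_power_Suc_diff_le assms) simp
    also have "\<dots> = ?g m"
      using True by (simp add: field_simps del: of_nat_Suc)
    finally show ?thesis .
  qed simp
  have t': "(\<lambda>m. ?t (Suc m)) sums (bsinh y - bsinh z - ?t 0)"
    using t by (subst sums_Suc_iff) simp
  have g': "(\<lambda>m. ?g (Suc m)) sums (cosh M * norm (y - z) - ?g 0)"
    using g by (subst sums_Suc_iff) simp
  have "norm (bsinh y - bsinh z - ?t 0) \<le> cosh M * norm (y - z) - ?g 0"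
    unfolding sums_unique[OF t'] sums_unique[OF g']
    by (rule norm_suminf_le[OF le sums_summable[OF g']])
  then show ?thesis by (simp add: algebra_simps)
qed

section \<open>Numerical bounds on the range [0, 0.54]\<close>

lemma exp_054_le: "exp (0.54 :: real) \<le> 1.7162"
proof -
  obtain t where t: "\<bar>t\<bar> \<le> \<bar>0.54 :: real\<bar>"
    "exp 0.54 = (\<Sum>m<6. 0.54 ^ m / fact m) + exp t / fact 6 * (0.54 :: real) ^ 6"
    using Maclaurin_exp_le[of "0.54 :: real" 6] by blast
  have "exp t \<le> exp 1" using t(1) by simp
  then have "exp t \<le> 3" using exp_le by linarith
  then show ?thesis
    unfolding t(2) by (simp add: fact_numeral eval_nat_numeral)
qed

text \<open>The Lagrange remainders at x and -x are averaged; each intermediate exponential is at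
  most 1.7162, and 2 * 1.7162 / 48 is just below 0.0716.\<close>

lemma cosh_le_quartic:
  fixes x :: real
  assumes "0 \<le> x" "x \<le> 0.54"
  shows "cosh x \<le> 1 + x\<^sup>2 / 2 + 0.0716 * x ^ 4"
proof -
  obtain t where t: "\<bar>t\<bar> \<le> \<bar>x\<bar>" "exp x = (\<Sum>m<4. x ^ m / fact m) + exp t / fact 4 * x ^ 4"
    using Maclaurin_exp_le[of x 4] by blast
  obtain u where u: "\<bar>u\<bar> \<le> \<bar>- x\<bar>" "exp (- x) = (\<Sum>m<4. (- x) ^ m / fact m) + exp u / fact 4 * (- x) ^ 4"
    using Maclaurin_exp_le[of "- x" 4] by blast
  have "exp t \<le> exp 0.54" "exp u \<le> exp 0.54" using t(1) u(1) assms by auto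
  then have "exp t + exp u \<le> 3.4324" using exp_054_le by linarith
  then have "(exp t + exp u) / 48 * x ^ 4 \<le> 0.0716 * x ^ 4" by (intro mult_right_mono) auto
  moreover have "cosh x = 1 + x\<^sup>2 / 2 + (exp t + exp u) / 48 * x ^ 4"
    unfolding cosh_def t(2) u(2) by (simp add: fact_numeral eval_nat_numeral field_simps)
  ultimately show ?thesis by linarith
qed

text \<open>Meant for s = 2 - exp x, with 0.2838 = 2 - 1.7162. The point is 1.9039 < 2, which makes
  the contraction factor cosh M - 1 at M = - ln s less than 1. This requires s > 2 - sqrt 3, that is
  exp x < sqrt 3 or x < 0.5493..., only slightly beyond 0.54.\<close>

lemma cosh_log_radius_le:
  fixes s :: real
  assumes "0.2838 \<le> s" "s \<le> 1"
  shows "cosh (- ln s) \<le> 1.9039"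
proof -
  have s: "1419 \<le> 5000 * s" "s > 0" using assms by simp_all
  \<comment> \<open>The factors vanish at 0.2838 and at 3.524, a number slightly above 1 / 0.2838;
    up to scale the product is s^2 - 3.8078 s plus a constant just above 1, and 3.8078 = 2 *
    1.9039.\<close>
  have "(5000 * s - 1419) * (250 * s - 881) \<le> 0"
    using assms s by (intro mult_nonneg_nonpos) linarith+
  moreover have "(5000 * s - 1419) * (250 * s - 881) = 1250000 * (s * s) - 4759750 * s + 1250139"
    by (simp add: algebra_simps)
  ultimately have "s * s + 1 \<le> 19039 / 5000 * s" by linarith
  then have "(s * s + 1) / s \<le> 19039 / 5000" using s by (simp only: pos_divide_le_eq)
  moreover have "(s * s + 1) / s = s + 1 / s" using s by (simp add: add_divide_distrib)
  moreover have "cosh (- ln s) = (s + 1 / s) / 2"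
    using s by (simp add: cosh_def exp_minus inverse_eq_divide)
  ultimately show ?thesis by simp
qed

lemma dyson_minus_one_bounded:
  fixes a :: "nat \<Rightarrow> 'c :: {real_normed_algebra_1, banach}"
  assumes "\<And>i. i < R \<Longrightarrow> norm (a i) \<le> \<alpha>" "0 \<le> \<alpha>"
  shows "fps_bounded (dyson a R) (exp (real R * \<alpha>))"
    and "fps_bounded (dyson a R - 1) (exp (real R * \<alpha>) - 1)"
proof -
  let ?x = "real R * \<alpha>"
  have ex: "(\<lambda>n. ?x ^ n /\<^sub>R fact n) sums exp ?x" by (rule exp_converges)
  have le: "norm (fps_nth (dyson a R) n) \<le> ?x ^ n /\<^sub>R fact n" for n
    using norm_dyson_nth_le[of R a \<alpha> R n] assms by (simp add: divide_inverse mult.commute)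
  have s: "summable (\<lambda>n. norm (fps_nth (dyson a R) n))"
    using le by (intro summable_comparison_test'[OF sums_summable[OF ex]]) auto
  show b1: "fps_bounded (dyson a R) (exp ?x)"
    using suminf_le[OF le s sums_summable[OF ex]] s sums_unique[OF ex] by (simp add: fps_bounded_def)
  have "(\<lambda>n. norm (fps_nth (dyson a R) n) - (if n = 0 then 1 else 0))
      sums ((\<Sum>n. norm (fps_nth (dyson a R) n)) - 1)"
    using sums_If_finite[of "\<lambda>n :: nat. n = 0" "\<lambda>_. 1 :: real"]
    by (intro sums_diff summable_sums s) simp
  moreover have "norm (fps_nth (dyson a R) n) - (if n = 0 then 1 else 0) = norm (fps_nth (dyson a R - 1) n)" for n
    by simp
  ultimately have "(\<lambda>n. norm (fps_nth (dyson a R - 1) n)) sums ((\<Sum>n. norm (fps_nth (dyson a R) n)) - 1)"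
    by (simp only:)
  then show "fps_bounded (dyson a R - 1) (exp ?x - 1)"
    using b1 by (auto simp: fps_bounded_def sums_iff)
qed

text \<open>\<open>N\<close> is meant to be the image of the complex-linear operators in an enlarged
  algebra, a subalgebra that does not contain the unit; therefore order zero is left out.\<close>

lemma dyson_nth_mem:
  fixes a :: "nat \<Rightarrow> 'c :: real_normed_algebra_1"
  assumes N: "subspace N" "\<And>x y. x \<in> N \<Longrightarrow> y \<in> N \<Longrightarrow> x * y \<in> N"
    and a: "\<And>i. i < j \<Longrightarrow> a i \<in> N"
  shows "n > 0 \<Longrightarrow> fps_nth (dyson a j) n \<in> N"
  using a
proof (induction j arbitrary: n)
  case 0
  then show ?case by (simp add: subspace_0[OF N(1)])
next
  case (Suc j)
  have pow: "m > 0 \<Longrightarrow> a j ^ m \<in> N" for m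
  proof (induction m)
    case (Suc m)
    then show ?case using Suc.prems \<open>\<And>i. i < Suc j \<Longrightarrow> a i \<in> N\<close> N(2) by (cases "m = 0") auto
  qed simp
  show ?case
    unfolding dyson_nth_Suc
  proof (rule subspace_sum[OF N(1)])
    fix i assume "i \<in> {..n}"
    then consider "i = 0" | "i = n" "i > 0" | "0 < i" "i < n" by force
    then show "a j ^ i /\<^sub>R fact i * fps_nth (dyson a j) (n - i) \<in> N"
    proof cases
      case 1
      then show ?thesis using Suc by simp
    next
      case 2
      then show ?thesis using pow by (simp add: subspace_scale[OF N(1)])
    next
      case 3
      then show ?thesis using pow Suc by (simp add: subspace_scale[OF N(1)] N(2))
    qed
  qed
qed

lemma fps_power_nth_mem:
  fixes F :: "'c :: real_normed_algebra_1 fps"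
  assumes N: "subspace N" "\<And>x y. x \<in> N \<Longrightarrow> y \<in> N \<Longrightarrow> x * y \<in> N"
    and F: "\<And>n. fps_nth F n \<in> N" and m: "m > 0"
  shows "fps_nth (F ^ m) n \<in> N"
  using m
proof (induction m arbitrary: n)
  case (Suc m)
  show ?case
  proof (cases "m = 0")
    case False
    then show ?thesis
      by (auto simp: fps_mult_nth intro!: subspace_sum[OF N(1)] N(2) F Suc.IH)
  qed (simp add: F)
qed simp

text \<open>The identity for all \<bar>l\<bar> \<le> 1, and not only for l = 1, is what identifies
  the \<open>\<Omega> n\<close> with Magnus terms; membership in \<open>N\<close> carries complex
  linearity to each of them.\<close>

theorem palindromic_log:
  fixes b :: "'c :: {real_normed_algebra_1, banach}"
  assumes b: "norm b \<le> \<beta>" and e: "\<And>i. i < R \<Longrightarrow> norm (e i) \<le> \<gamma>" and R: "R \<ge> 2"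
    and sum0: "(\<Sum>i<R. e i) = 0" and sym: "\<And>i. i < R \<Longrightarrow> e (R - 1 - i) = e i"
    and x: "x = real R * (\<beta> + \<gamma>)" "x \<le> 0.54"
    and N: "subspace N" "\<And>x y. x \<in> N \<Longrightarrow> y \<in> N \<Longrightarrow> x * y \<in> N"
    and mem: "\<And>i. i < R \<Longrightarrow> b + e i \<in> N"
  obtains \<Omega> where "\<Omega> 0 = 0" "\<And>n. \<Omega> n \<in> N" "summable (\<lambda>n. norm (\<Omega> n))"
    "\<And>l. \<bar>l\<bar> \<le> 1 \<Longrightarrow> exp (\<Sum>n. l ^ n *\<^sub>R \<Omega> n) = fps_sum l (dyson (\<lambda>i. b + e i) R)"
    "norm ((\<Sum>n. \<Omega> n) - real R *\<^sub>R b) \<le> (2 / 9 + 9.43 * x\<^sup>2) * x\<^sup>2 * (real R * \<gamma>)"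
proof -
  define a where "a = (\<lambda>i. b + e i)"
  define V where "V = dyson a R"
  define \<alpha> where "\<alpha> = \<beta> + \<gamma>"
  define G where "G = real R * \<gamma>"
  define w where "w = real R *\<^sub>R b"
  have nn: "0 \<le> \<beta>" "0 \<le> \<gamma>"
    using order_trans[OF norm_ge_zero b] order_trans[OF norm_ge_zero e[of 0]] R by auto
  then have x0: "0 \<le> x" "0 \<le> G" and xa: "x = real R * \<alpha>" and xG: "x = real R * \<beta> + G"
    by (auto simp: x(1) G_def \<alpha>_def algebra_simps)
  have an: "norm (a i) \<le> \<alpha>" if "i < R" for i
    unfolding a_def \<alpha>_def using norm_triangle_mono[OF b e[OF that]] .
  have "0 \<le> \<alpha>" using nn by (simp add: \<alpha>_def)
  note bd = dyson_minus_one_bounded[of R a \<alpha>, OF an this, folded V_def xa]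
  have asym: "a (R - 1 - i) = a i" if "i < R" for i using sym[OF that] by (simp add: a_def)
  define q where "q = exp x - 1"
  have "exp x \<le> exp 0.54" using x by simp
  then have "exp x \<le> 1.7162" using exp_054_le by (rule order_trans)
  then have q: "0 \<le> q" "q \<le> 0.7162" using x0 by (auto simp: q_def)
  then have "q < 1" by simp
  have F: "fps_bounded (V - 1) q" using bd by (simp add: q_def)
  have F0: "fps_nth (V - 1) 0 = 0" by (simp add: V_def)
  \<comment> \<open>Coefficients of the formal logarithm of \<open>V\<close>; its series converges
    absolutely because the coefficients of \<open>V - 1\<close> have total norm at most exp x - 1 <
    1.\<close>
  define \<Omega> where "\<Omega> = fps_nth (fps_subst log_coeff (V - 1))"
  note sub = fps_subst_sum[OF F F0 sums_summable[OF sums_abs_log_coeff[OF q(1) \<open>q < 1\<close>]], folded \<Omega>_def]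
  have fs: "fps_sum l (V - 1) = fps_sum l V - 1" if "\<bar>l\<bar> \<le> 1" for l
  proof -
    have "(\<Sum>n. l ^ n *\<^sub>R fps_nth V n - l ^ n *\<^sub>R fps_nth (1 :: 'c fps) n) = fps_sum l V - fps_sum l 1"
      unfolding fps_sum_def
      by (rule suminf_diff[symmetric, OF summable_norm_cancel[OF summable_fps_sum[OF bd(1) that]]
          summable_norm_cancel[OF summable_fps_sum[OF fps_bounded_1 that]]])
    moreover have "fps_sum l (V - 1) = (\<Sum>n. l ^ n *\<^sub>R fps_nth V n - l ^ n *\<^sub>R fps_nth (1 :: 'c fps) n)"
      by (simp only: fps_sum_def fps_sub_nth scaleR_diff_right)
    ultimately show ?thesis by (simp only: fps_sum_1)
  qed
  have sum\<Omega>: "(\<Sum>n. l ^ n *\<^sub>R \<Omega> n) = banach_log (fps_sum l V - 1)" if "\<bar>l\<bar> \<le> 1" for l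
    using sub(2)[OF that] unfolding fs[OF that] by (simp only: banach_log_def fps_sum_def \<Omega>_def)
  have le_q: "norm (fps_sum l V - 1) \<le> q" if "\<bar>l\<bar> \<le> 1" for l
    using norm_fps_sum_le(2)[OF F that] by (simp add: fs[OF that])
  have exp\<Omega>: "exp (\<Sum>n. l ^ n *\<^sub>R \<Omega> n) = fps_sum l V" if "\<bar>l\<bar> \<le> 1" for l
    unfolding sum\<Omega>[OF that] using exp_banach_log[of "fps_sum l V - 1"] le_q[OF that] \<open>q < 1\<close> by simp
  define Om where "Om = (\<Sum>n. \<Omega> n)"
  have Om: "Om = banach_log (fps_sum 1 V - 1)" "exp Om = fps_sum 1 V"
    using sum\<Omega>[of 1] exp\<Omega>[of 1] by (simp_all add: Om_def)
  have "exp (- Om) = fps_sum (- 1) V * (exp Om * exp (- Om))"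
    using fps_sum_dyson_inverse[of R a, OF asym] unfolding Om(2) V_def
    by (simp flip: mult.assoc)
  then have Om': "exp (- Om) = fps_sum (- 1) V" by (simp add: exp_minus_inverse)

  define S where "S = bsinh Om - bsinh w"
  \<comment> \<open>Index m is order m + 1, so \<open>?t 0\<close> and \<open>?t 2\<close> are the
    first- and third-order differences.\<close>
  let ?t = "\<lambda>m. (if even m then fps_nth V (Suc m) else 0) - (if even m then w ^ Suc m /\<^sub>R fact (Suc m) else 0)"
  let ?g = "\<lambda>m. G * (if even m then x ^ m /\<^sub>R fact m else 0)"
  have t: "?t sums S"
    unfolding S_def using fps_odd_part_sums[OF bd(1)]
    by (intro sums_diff bsinh_sums) (simp add: bsinh_def Om' Om(2))
  have g: "?g sums (G * cosh x)" by (intro sums_mult cosh_converges)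
  \<comment> \<open>The bases x and R \<beta> differ by \<open>G\<close>, so the difference of
    powers is at most (m + 1) x^m \<open>G\<close>, and the factor m + 1 reduces the factorial to
    m!.\<close>
  have le: "norm (?t m) \<le> ?g m" for m
  proof (cases "even m")
    case True
    have "norm (?t m) \<le> ((real R * \<alpha>) ^ Suc m - (real R * \<beta>) ^ Suc m) / fact (Suc m)"
      using True norm_dyson_nth_diff_le[of b \<beta> R a \<gamma> R "Suc m"] b e
      by (simp add: a_def V_def w_def \<alpha>_def del: fact_Suc power_Suc)
    also have "(real R * \<alpha>) ^ Suc m - (real R * \<beta>) ^ Suc m \<le> real (Suc m) * x ^ m * G"
      using norm_power_Suc_diff_le[of "real R * \<alpha>" x "real R * \<beta>" m] x0 xG nn xa
      by (simp add: G_def \<alpha>_def algebra_simps)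
    also have "real (Suc m) * x ^ m * G / fact (Suc m) = ?g m"
      using True by (simp add: field_simps del: of_nat_Suc)
    finally show ?thesis by (simp add: divide_right_mono)
  qed (simp add: x0)
  have t1: "?t 0 = 0"
    using sum0 by (simp add: V_def dyson_nth_1 a_def w_def sum.distrib scaleR_conv_of_real)
  have t3: "norm (?t 2) \<le> G * (2 / 9 * x\<^sup>2)"
    using norm_dyson_nth_3_diff_le[OF b e R sum0 sym]
    by (simp add: V_def a_def w_def G_def xa \<alpha>_def power2_eq_square power3_eq_cube eval_nat_numeral mult_ac)
  \<comment> \<open>Drops the orders one to three. The majorant loses \<open>G\<close> (1 + x^2 /
    2), and what remains is of size x^4 \<open>G\<close>.\<close>
  have split: "(\<lambda>m. f (m + 3)) sums (s - (f 0 + f 1 + f 2))" if "f sums s" for f :: "nat \<Rightarrow> 'd :: banach" and s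
    using that by (subst sums_iff_shift) (simp add: eval_nat_numeral add.assoc)
  have "norm (S - (?t 0 + ?t 1 + ?t 2)) \<le> G * cosh x - (?g 0 + ?g 1 + ?g 2)"
    unfolding sums_unique[OF split[OF t]] sums_unique[OF split[OF g]]
    by (rule norm_suminf_le[OF le sums_summable[OF split[OF g]]])
  then have S1: "norm (S - ?t 2) \<le> G * (cosh x - 1 - x\<^sup>2 / 2)"
    unfolding t1 by (simp add: field_simps)
  have S: "norm S \<le> G * (2 / 9 * x\<^sup>2 + 0.0716 * x ^ 4)"
  proof -
    have "norm S \<le> G * (2 / 9 * x\<^sup>2) + G * (cosh x - 1 - x\<^sup>2 / 2)"
      using norm_triangle_mono[OF t3 S1] by simp
    also have "\<dots> = G * (2 / 9 * x\<^sup>2 + (cosh x - 1 - x\<^sup>2 / 2))" by (simp add: algebra_simps)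
    also have "\<dots> \<le> G * (2 / 9 * x\<^sup>2 + 0.0716 * x ^ 4)"
      using cosh_le_quartic[OF x0(1) x(2)] x0 by (intro mult_left_mono) auto
    finally show ?thesis .
  qed
  define D where "D = norm (Om - w)"
  have contract: "D \<le> norm S + (cosh M - 1) * D" if "norm Om \<le> M" "norm w \<le> M" for M
  proof -
    have "Om - w = S - ((bsinh Om - Om) - (bsinh w - w))" by (simp add: S_def)
    then have "D \<le> norm S + norm ((bsinh Om - Om) - (bsinh w - w))"
      unfolding D_def by (metis norm_triangle_ineq4)
    then show ?thesis using bsinh_minus_id_lipschitz[OF that] by (simp add: D_def)
  qed
  have w: "norm w \<le> real R * \<beta>" using b by (simp add: w_def mult_left_mono)
  have x4eq: "x ^ 4 = x\<^sup>2 * x\<^sup>2" by (simp flip: power_add)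
  have x2: "x\<^sup>2 \<le> 0.2916" and x4: "x ^ 4 \<le> 0.2916 * x\<^sup>2"
  proof -
    show *: "x\<^sup>2 \<le> 0.2916" using power_mono[OF x(2) x0(1), of 2] by (simp add: power2_eq_square)
    show "x ^ 4 \<le> 0.2916 * x\<^sup>2"
      using mult_right_mono[OF *, of "x\<^sup>2"] by (simp add: power2_eq_square eval_nat_numeral mult_ac)
  qed
  \<comment> \<open>The logarithm series only gives \<open>\<parallel>Om\<parallel> \<le> - ln (2 - exp x)\<close>. This suffices for \<open>D \<le> G\<close>, hence for
    \<open>\<parallel>Om\<parallel> \<le> x\<close>, which makes the contraction factor of order \<open>x\<^sup>2\<close>.\<close>
  have DG: "D \<le> G"
  proof -
    let ?M = "- ln (1 - q)"
    have "exp x * (1 - q) \<le> 1"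
      using zero_le_power2[of "exp x - 1"] by (simp add: q_def power2_eq_square algebra_simps)
    then have "exp x \<le> 1 / (1 - q)" using \<open>q < 1\<close> by (simp add: field_simps)
    also have "\<dots> = exp ?M" using \<open>q < 1\<close> by (simp add: exp_minus divide_inverse)
    finally have "x \<le> ?M" by simp
    moreover have "real R * \<beta> \<le> x" using xG x0 by simp
    ultimately have M: "norm w \<le> ?M" using w by linarith
    have "norm Om \<le> ?M" unfolding Om(1) by (intro norm_banach_log_le le_q \<open>q < 1\<close>) simp
    note c = contract[OF this M]
    have "D * cosh ?M \<le> D * 1.9039"
      using q by (intro mult_left_mono cosh_log_radius_le) (auto simp: D_def)
    \<comment> \<open>Moving the contraction term to the left leaves 1 - (1.9039 - 1) = 0.0961. On
      the other side the bound on \<open>norm S\<close> is at most about 0.071 \<open>G\<close> for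
      x \<le> 0.54, so \<open>D\<close> \<le> \<open>G\<close> follows.\<close>
    then have "0.0961 * D \<le> norm S" using c by (simp add: algebra_simps)
    also have "\<dots> \<le> G * 0.0961"
      by (rule order_trans[OF S mult_left_mono]) (use x0 x2 x4 in auto)
    finally show ?thesis by simp
  qed
  have "norm Om \<le> x"
    using norm_triangle_sub[of Om w] w DG xG by (simp add: D_def)
  moreover have "norm w \<le> x" using w xG x0 by linarith
  ultimately have c: "D \<le> norm S + (cosh x - 1) * D" by (rule contract)
  \<comment> \<open>0.521 exceeds 1/2 + 0.0716 * 0.2916, where 0.2916 = 0.54^2 = 729/2500. The
    multipliers clear denominators for linear arithmetic.\<close>
  have ch: "cosh x - 1 \<le> 0.521 * x\<^sup>2"
  proof -
    have "cosh x * 2500 \<le> 2500 + 1250 * x\<^sup>2 + 179 * x ^ 4"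
      using cosh_le_quartic[OF x0(1) x(2)] by simp
    moreover have "x ^ 4 * 2500 \<le> 729 * x\<^sup>2" using x4 by simp
    ultimately have "cosh x * 1000 - 1000 \<le> 521 * x\<^sup>2"
      using zero_le_power2[of x] by linarith
    then show ?thesis by simp
  qed
  have D0: "0 \<le> D" by (simp add: D_def)
  \<comment> \<open>Here 0.152 exceeds 0.521 * 0.2916, 0.848 is 1 - 0.152, and (2/9 + 0.0716 *
    0.2916) / 0.848 is below 0.3. This rough bound is fed once more into the contraction inequality
    to recover the sharp leading constant 2/9.\<close>
  have D1: "D \<le> G * (0.3 * x\<^sup>2)"
  proof -
    have "(cosh x - 1) * D \<le> 0.152 * D" using ch x2 D0 by (intro mult_right_mono) auto
    then have "0.848 * D \<le> norm S" using c by simp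
    also have "\<dots> \<le> G * (0.848 * (0.3 * x\<^sup>2))"
    proof (rule order_trans[OF S mult_left_mono])
      have "x ^ 4 * 2500 \<le> 729 * x\<^sup>2" using x4 by simp
      then have "1250 * x\<^sup>2 / 9 + 179 * x ^ 4 / 4 \<le> 159 * x\<^sup>2"
        using zero_le_power2[of x] by linarith
      then show "2 / 9 * x\<^sup>2 + 0.0716 * x ^ 4 \<le> 0.848 * (0.3 * x\<^sup>2)" by simp
    qed (rule x0)
    finally show ?thesis by simp
  qed
  \<comment> \<open>0.2279 = 0.0716 + 0.521 * 0.3, the fifth-order remainder plus the correction
    from the contraction; it lies well below 9.43.\<close>
  have poly: "G * (2 / 9 * y + 0.0716 * (y * y)) + 0.521 * y * (G * (0.3 * y)) = G * (2 / 9 * y + 0.2279 * (y * y))" for y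
    by (simp add: ring_distribs)
  have "D \<le> G * (2 / 9 * x\<^sup>2 + 0.0716 * x ^ 4) + 0.521 * x\<^sup>2 * (G * (0.3 * x\<^sup>2))"
    by (rule order_trans[OF c add_mono[OF S mult_mono[OF ch D1]]]) (use D0 in auto)
  also have "\<dots> = G * (2 / 9 * x\<^sup>2 + 0.2279 * x ^ 4)"
    unfolding x4eq by (rule poly)
  also have "\<dots> \<le> G * (2 / 9 * x\<^sup>2 + 9.43 * x ^ 4)"
    using x0 by (intro mult_left_mono) auto
  also have "\<dots> = (2 / 9 + 9.43 * x\<^sup>2) * x\<^sup>2 * (real R * \<gamma>)"
    unfolding x4eq G_def by (simp only: distrib_left distrib_right mult_ac)
  finally have fin: "norm ((\<Sum>n. \<Omega> n) - real R *\<^sub>R b) \<le> (2 / 9 + 9.43 * x\<^sup>2) * x\<^sup>2 * (real R * \<gamma>)"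
    by (simp add: D_def Om_def w_def)

  have Vmem: "fps_nth (V - 1) n \<in> N" for n
  proof (cases "n = 0")
    case False
    then have "fps_nth V n \<in> N"
      unfolding V_def a_def by (intro dyson_nth_mem[OF N] mem) auto
    then show ?thesis using False by simp
  qed (simp add: V_def subspace_0[OF N(1)])
  have mem\<Omega>: "\<Omega> n \<in> N" for n
    unfolding \<Omega>_def fps_subst_def fps_nth_Abs_fps
  proof (rule subspace_sum[OF N(1)])
    fix m
    show "log_coeff m *\<^sub>R fps_nth ((V - 1) ^ m) n \<in> N"
    proof (cases "m = 0")
      case True
      then show ?thesis by (simp add: log_coeff_def subspace_0[OF N(1)])
    next
      case False
      then show ?thesis by (intro subspace_scale[OF N(1)] fps_power_nth_mem N Vmem) auto
    qed
  qed
  show ?thesis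
    by (rule that[OF _ mem\<Omega> sub(1) _ fin]) (use exp\<Omega> in \<open>auto simp: V_def a_def \<Omega>_def fps_subst_def log_coeff_def\<close>)
qed

section \<open>Bounded operators as a Banach algebra with unit\<close>

text \<open>The type \<open>'a \<Rightarrow>\<^sub>L 'a\<close> is not an instance of \<open>real_normed_algebra_1\<close>: its multiplication is not
  \<open>*\<close>, and its identity has norm \<open>0\<close> if \<open>'a\<close> is trivial. Enlarging the space by one dimension repairs
  the latter.\<close>

typedef (overloaded) 'a :: real_normed_vector uop = "UNIV :: (('a \<times> real) \<Rightarrow>\<^sub>L ('a \<times> real)) set" ..

setup_lifting type_definition_uop

instantiation uop :: (real_normed_vector) real_normed_algebra_1
begin

lift_definition zero_uop :: "'a uop" is 0 .
lift_definition one_uop :: "'a uop" is id_blinfun .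
lift_definition plus_uop :: "'a uop \<Rightarrow> 'a uop \<Rightarrow> 'a uop" is "(+)" .
lift_definition minus_uop :: "'a uop \<Rightarrow> 'a uop \<Rightarrow> 'a uop" is "(-)" .
lift_definition uminus_uop :: "'a uop \<Rightarrow> 'a uop" is uminus .
lift_definition scaleR_uop :: "real \<Rightarrow> 'a uop \<Rightarrow> 'a uop" is scaleR .
lift_definition times_uop :: "'a uop \<Rightarrow> 'a uop \<Rightarrow> 'a uop" is "(o\<^sub>L)" .
lift_definition norm_uop :: "'a uop \<Rightarrow> real" is norm .
lift_definition dist_uop :: "'a uop \<Rightarrow> 'a uop \<Rightarrow> real" is dist .
lift_definition sgn_uop :: "'a uop \<Rightarrow> 'a uop" is sgn .

definition uniformity_uop :: "('a uop \<times> 'a uop) filter"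
  where "uniformity_uop = (INF e\<in>{0 <..}. principal {(x, y). dist x y < e})"

definition open_uop :: "'a uop set \<Rightarrow> bool"
  where "open_uop U \<longleftrightarrow> (\<forall>x\<in>U. \<forall>\<^sub>F (x', y) in uniformity. x' = x \<longrightarrow> y \<in> U)"

instance
proof
  fix a b c :: "'a uop" and r s :: real
  show "a + b + c = a + (b + c)" by transfer simp
  show "a + b = b + a" by transfer simp
  show "0 + a = a" by transfer simp
  show "- a + a = 0" by transfer simp
  show "a - b = a + - b" by transfer simp
  show "r *\<^sub>R (a + b) = r *\<^sub>R a + r *\<^sub>R b" by transfer (simp add: scaleR_right_distrib)
  show "(r + s) *\<^sub>R a = r *\<^sub>R a + s *\<^sub>R a" by transfer (simp add: scaleR_left_distrib)
  show "r *\<^sub>R s *\<^sub>R a = (r * s) *\<^sub>R a" by transfer simp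
  show "1 *\<^sub>R a = a" by transfer simp
  show "a * b * c = a * (b * c)" by transfer (simp add: blinfun_eqI)
  show "(a + b) * c = a * c + b * c"
    by transfer (simp add: bounded_bilinear.add_left[OF bounded_bilinear_blinfun_compose])
  show "a * (b + c) = a * b + a * c"
    by transfer (simp add: bounded_bilinear.add_right[OF bounded_bilinear_blinfun_compose])
  show "r *\<^sub>R a * b = r *\<^sub>R (a * b)"
    by transfer (simp add: bounded_bilinear.scaleR_left[OF bounded_bilinear_blinfun_compose])
  show "a * r *\<^sub>R b = r *\<^sub>R (a * b)"
    by transfer (simp add: bounded_bilinear.scaleR_right[OF bounded_bilinear_blinfun_compose])
  show "1 * a = a" by transfer (simp add: blinfun_eqI)
  show "a * 1 = a" by transfer (simp add: blinfun_eqI)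
  have one: "norm (id_blinfun :: ('a \<times> real) \<Rightarrow>\<^sub>L ('a \<times> real)) = 1"
  proof (rule antisym[OF norm_blinfun_id_le])
    show "1 \<le> norm (id_blinfun :: ('a \<times> real) \<Rightarrow>\<^sub>L ('a \<times> real))"
      using norm_blinfun[of "id_blinfun :: ('a \<times> real) \<Rightarrow>\<^sub>L ('a \<times> real)" "(0, 1)"] by (simp add: norm_Pair)
  qed
  then show "norm (1 :: 'a uop) = 1" by transfer
  then show "(0 :: 'a uop) \<noteq> 1" by transfer (use one in \<open>metis norm_zero zero_neq_one\<close>)
  show "dist a b = norm (a - b)" by transfer (rule dist_norm)
  show "sgn a = inverse (norm a) *\<^sub>R a" by transfer (rule sgn_div_norm)
  show "norm (a + b) \<le> norm a + norm b" by transfer (rule norm_triangle_ineq)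
  show "norm (r *\<^sub>R a) = \<bar>r\<bar> * norm a" by transfer simp
  show "norm a = 0 \<longleftrightarrow> a = 0" by transfer simp
  show "norm (a * b) \<le> norm a * norm b" by transfer (rule norm_blinfun_compose)
qed (rule uniformity_uop_def open_uop_def)+

end

instance uop :: (banach) banach
proof
  fix X :: "nat \<Rightarrow> 'a uop"
  assume "Cauchy X"
  then have "Cauchy (\<lambda>n. Rep_uop (X n))"
    by (simp add: Cauchy_def dist_uop.rep_eq)
  then obtain L where "(\<lambda>n. Rep_uop (X n)) \<longlonglongrightarrow> L"
    using Cauchy_convergent_iff convergent_def by blast
  then have "X \<longlonglongrightarrow> Abs_uop L"
    by (simp add: tendsto_iff dist_uop.rep_eq Abs_uop_inverse)
  then show "convergent X" by (rule convergentI)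
qed

section \<open>Transfer between operators and the enlarged unital algebra\<close>

lift_definition inl_blinfun :: "'a :: real_normed_vector \<Rightarrow>\<^sub>L ('a \<times> real)" is "\<lambda>x. (x, 0)"
  by (intro bounded_linear_Pair bounded_linear_ident bounded_linear_zero)

text \<open>The block operator with \<open>A\<close> in the corner and 0 elsewhere. It respects
  products but sends the identity to a projection different from 1, so exponentials are compared
  after subtracting 1 or after applying \<open>corner\<close>.\<close>

definition emb :: "('a :: real_normed_vector \<Rightarrow>\<^sub>L 'a) \<Rightarrow> 'a uop"
  where "emb A = Abs_uop (inl_blinfun o\<^sub>L A o\<^sub>L fst_blinfun)"

definition corner :: "'a :: real_normed_vector uop \<Rightarrow> ('a \<Rightarrow>\<^sub>L 'a)"
  where "corner M = fst_blinfun o\<^sub>L Rep_uop M o\<^sub>L inl_blinfun"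

lemma Rep_emb_apply: "Rep_uop (emb A) v = (A (fst v), 0)"
  by (simp add: emb_def Abs_uop_inverse inl_blinfun.rep_eq)

lemma corner_apply: "corner M x = fst (Rep_uop M (x, 0))"
  by (simp add: corner_def inl_blinfun.rep_eq)

lemma uop_eqI: "(\<And>v. Rep_uop M v = Rep_uop N v) \<Longrightarrow> M = N"
  by (metis Rep_uop_inject blinfun_eqI)

lemmas uop_apply = Rep_emb_apply corner_apply plus_uop.rep_eq scaleR_uop.rep_eq times_uop.rep_eq
  one_uop.rep_eq blinfun.add_left blinfun.scaleR_left blinfun.add_right blinfun.scaleR_right

lemma norm_emb_le: "norm (emb A) \<le> norm A"
  unfolding norm_uop.rep_eq
proof (rule norm_blinfun_bound)
  fix v :: "'a \<times> real"
  have "norm (A (fst v)) \<le> norm A * norm (fst v)" by (rule norm_blinfun)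
  also have "\<dots> \<le> norm A * norm v"
    by (intro mult_left_mono) (metis norm_fst_le prod.collapse, simp)
  finally show "norm (Rep_uop (emb A) v) \<le> norm A * norm v"
    by (simp add: Rep_emb_apply norm_Pair)
qed simp

lemma norm_corner_le: "norm (corner M) \<le> norm M"
  unfolding norm_uop.rep_eq
proof (rule norm_blinfun_bound)
  fix v :: 'a
  have "norm (fst (Rep_uop M (v, 0))) \<le> norm (Rep_uop M (v, 0))" by (metis norm_fst_le prod.collapse)
  also have "\<dots> \<le> norm (Rep_uop M) * norm v"
    using norm_blinfun[of "Rep_uop M" "(v, 0)"] by (simp add: norm_Pair)
  finally show "norm (corner M v) \<le> norm (Rep_uop M) * norm v"
    by (simp add: corner_apply)
qed simp

lemma bounded_linear_emb: "bounded_linear emb"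
proof (rule bounded_linear_intro)
  fix A B :: "'a \<Rightarrow>\<^sub>L 'a" and r :: real
  show "emb (A + B) = emb A + emb B" by (rule uop_eqI) (simp add: uop_apply)
  show "emb (r *\<^sub>R A) = r *\<^sub>R emb A" by (rule uop_eqI) (simp add: uop_apply)
  show "norm (emb A) \<le> norm A * 1" using norm_emb_le by simp
qed

lemma bounded_linear_corner: "bounded_linear corner"
proof (rule bounded_linear_intro)
  fix A B :: "'a uop" and r :: real
  show "corner (A + B) = corner A + corner B" by (rule blinfun_eqI) (simp add: uop_apply)
  show "corner (r *\<^sub>R A) = r *\<^sub>R corner A" by (rule blinfun_eqI) (simp add: uop_apply)
  show "norm (corner A) \<le> norm A * 1" using norm_corner_le by simp
qed

lemmas emb_simps =
  linear_add[OF bounded_linear.linear[OF bounded_linear_emb]]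
  linear_diff[OF bounded_linear.linear[OF bounded_linear_emb]]
  linear_scale[OF bounded_linear.linear[OF bounded_linear_emb]]
  linear_0[OF bounded_linear.linear[OF bounded_linear_emb]]
  linear_sum[OF bounded_linear.linear[OF bounded_linear_emb]]

lemmas corner_simps =
  linear_add[OF bounded_linear.linear[OF bounded_linear_corner]]
  linear_diff[OF bounded_linear.linear[OF bounded_linear_corner]]
  linear_scale[OF bounded_linear.linear[OF bounded_linear_corner]]
  linear_0[OF bounded_linear.linear[OF bounded_linear_corner]]

lemma emb_mult: "emb A * emb B = emb (A o\<^sub>L B)"
  by (rule uop_eqI) (simp add: uop_apply)

lemma corner_emb [simp]: "corner (emb A) = A"
  by (rule blinfun_eqI) (simp add: uop_apply)

lemma corner_one [simp]: "corner 1 = id_blinfun"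
  by (rule blinfun_eqI) (simp add: uop_apply)

text \<open>\<open>corner\<close> does not respect arbitrary products. A left factor of the form
  \<open>emb A\<close> only sees the first component, and this covers evolution equations, where the
  generator multiplies from the left.\<close>

lemma corner_emb_mult: "corner (emb A * M) = A o\<^sub>L corner M"
  by (rule blinfun_eqI) (simp add: uop_apply)

lemma corner_exp_emb: "corner (exp (emb A)) = exp_op (A :: 'a :: complex_hilbert \<Rightarrow>\<^sub>L 'a)"
proof -
  have pow: "corner (emb A ^ n) = ((o\<^sub>L) A ^^ n) id_blinfun" for n
    by (induction n) (simp_all add: corner_emb_mult)
  have "(\<lambda>n. corner (emb A ^ n /\<^sub>R fact n)) sums corner (exp (emb A))"
    by (rule bounded_linear.sums[OF bounded_linear_corner exp_converges])
  then show ?thesis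
    unfolding exp_op_def by (simp add: corner_simps pow sums_iff divide_inverse)
qed

text \<open>All positive powers of \<open>emb A\<close> lie in the range of \<open>emb\<close>; only
  the constant term of the exponential does not.\<close>

lemma emb_corner_exp_minus_one:
  fixes A :: "'a :: complex_hilbert \<Rightarrow>\<^sub>L 'a"
  shows "exp (emb A) - 1 = emb (exp_op A - id_blinfun)"
proof -
  have fix_pow: "emb (corner (emb A ^ Suc n)) = emb A ^ Suc n" for n
  proof -
    have "\<exists>B. emb A ^ Suc n = emb B"
      by (induction n) (auto simp: emb_mult)
    then show ?thesis by auto
  qed
  have "(\<lambda>n. emb A ^ Suc n /\<^sub>R fact (Suc n)) sums (exp (emb A) - 1)"
    using exp_converges[of "emb A"] by (subst sums_Suc_iff) simp
  from bounded_linear.sums[OF bounded_linear_compose[OF bounded_linear_emb bounded_linear_corner] this]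
  have "(\<lambda>n. emb A ^ Suc n /\<^sub>R fact (Suc n)) sums emb (corner (exp (emb A) - 1))"
    by (simp only: corner_simps emb_simps fix_pow)
  with \<open>(\<lambda>n. emb A ^ Suc n /\<^sub>R fact (Suc n)) sums (exp (emb A) - 1)\<close>
  have "exp (emb A) - 1 = emb (corner (exp (emb A) - 1))" by (rule sums_unique2)
  then show ?thesis by (simp only: corner_simps corner_exp_emb corner_one)
qed

text \<open>The inverses agree too, hence \<open>bsinh y = bsinh z\<close>. On the ball of radius
  0.54 the map \<open>bsinh\<close> minus the identity has Lipschitz constant at most 1/2, which
  forces y = z.\<close>

lemma exp_inj_near_0:
  fixes y z :: "'c :: {real_normed_algebra_1, banach}"
  assumes "exp y = exp z" "norm y \<le> 0.54" "norm z \<le> 0.54"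
  shows "y = z"
proof -
  have "exp (- y) = exp (- y) * (exp z * exp (- z))" by (simp add: exp_minus_inverse)
  also have "\<dots> = exp (- y) * exp (- (- y)) * exp (- z)" using assms(1) by (simp add: mult.assoc)
  also have "\<dots> = exp (- z)" by (simp only: exp_minus_inverse mult_1_left)
  finally have "bsinh y = bsinh z" using assms(1) by (simp add: bsinh_def)
  then have "norm (y - z) \<le> (cosh 0.54 - 1) * norm (y - z)"
    using bsinh_minus_id_lipschitz[OF assms(2,3)] by (simp add: norm_minus_commute)
  moreover have "cosh 0.54 - 1 \<le> (1 / 2 :: real)"
    using cosh_le_quartic[of "0.54"] by (simp add: eval_nat_numeral)
  ultimately have "norm (y - z) \<le> 1 / 2 * norm (y - z)"
    by (meson mult_right_mono norm_ge_zero order_trans)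
  then show ?thesis by simp
qed

lemma exp_op_inj_near_0:
  fixes A B :: "'a :: complex_hilbert \<Rightarrow>\<^sub>L 'a"
  assumes "exp_op A = exp_op B" "norm A \<le> 0.54" "norm B \<le> 0.54"
  shows "A = B"
proof -
  have "exp (emb A) - 1 = exp (emb B) - 1"
    unfolding emb_corner_exp_minus_one assms(1) ..
  then have "exp (emb A) = exp (emb B)" by simp
  then have "emb A = emb B"
    by (rule exp_inj_near_0) (rule order_trans[OF norm_emb_le], rule assms)+
  then show ?thesis by (metis corner_emb)
qed

section \<open>Evolution and Magnus expansion\<close>

lemma scale_op_apply: "scale_op c A x = c *\<^sub>C A x"
  by (simp add: scale_op.rep_eq)

lemma scaleC_zero_right [simp]: "c *\<^sub>C (0 :: 'a :: complex_hilbert) = 0"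
  by (rule linear_0[OF bounded_linear.linear[OF bounded_linear_scaleC]])

lemma scaleC_one_left [simp]: "1 *\<^sub>C x = (x :: 'a :: complex_hilbert)"
  using scaleR_scaleC[of 1 x] by simp

lemma scaleC_scaleR_commute: "c *\<^sub>C r *\<^sub>R x = r *\<^sub>R c *\<^sub>C (x :: 'a :: complex_hilbert)"
  by (rule linear_scale[OF bounded_linear.linear[OF bounded_linear_scaleC]])

lemma norm_scale_op_le: "norm (scale_op c A) \<le> cmod c * norm A"
proof (rule norm_blinfun_bound)
  fix x
  show "norm (scale_op c A x) \<le> cmod c * norm A * norm x"
    using norm_blinfun[of A x] by (simp add: scale_op_apply norm_scaleC mult.assoc mult_left_mono)
qed simp

lemma bounded_linear_scale_op: "bounded_linear (scale_op c)"
proof (rule bounded_linear_intro)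
  fix A B :: "'a \<Rightarrow>\<^sub>L 'a" and r :: real
  show "scale_op c (A + B) = scale_op c A + scale_op c B"
    by (rule blinfun_eqI) (simp add: scale_op_apply blinfun.add_left scaleC_add_right)
  show "scale_op c (r *\<^sub>R A) = r *\<^sub>R scale_op c A"
    by (rule blinfun_eqI) (simp add: scale_op_apply blinfun.scaleR_left scaleC_scaleR_commute)
  show "norm (scale_op c A) \<le> norm A * cmod c"
    using norm_scale_op_le[of c A] by (simp add: mult.commute)
qed

lemmas scale_op_simps =
  linear_add[OF bounded_linear.linear[OF bounded_linear_scale_op]]
  linear_diff[OF bounded_linear.linear[OF bounded_linear_scale_op]]
  linear_scale[OF bounded_linear.linear[OF bounded_linear_scale_op]]
  linear_sum[OF bounded_linear.linear[OF bounded_linear_scale_op]]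

lemma scale_op_compose: "scale_op c (A o\<^sub>L B) = scale_op c A o\<^sub>L B"
  by (rule blinfun_eqI) (simp add: scale_op_apply)

lemma scale_op_scale_op: "scale_op c (scale_op d A) = scale_op (c * d) A"
  by (rule blinfun_eqI) (simp add: scale_op_apply scaleC_scaleC)

lemma scale_op_of_real: "scale_op (complex_of_real r) A = r *\<^sub>R A"
  by (rule blinfun_eqI) (simp add: scale_op_apply blinfun.scaleR_left scaleR_scaleC)

subsection \<open>Uniqueness\<close>

text \<open>The difference of two solutions satisfies the homogeneous integral equation; iterating
  it n times bounds the difference by a constant times (C t)^n / n!, which tends to 0.\<close>

lemma evolution_on_unique:
  assumes U: "evolution_on T K U" and V: "evolution_on T K V"
    and K: "\<And>t. t \<in> {0..T} \<Longrightarrow> norm (K t) \<le> C" and t: "t \<in> {0..T}"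
  shows "U t = V t"
proof -
  define D where "D = (\<lambda>t. U t - V t)"
  have C: "0 \<le> C" using K[OF t] norm_ge_zero order_trans by blast
  have int: "((\<lambda>s. scale_op (- \<i>) (K s o\<^sub>L D s)) has_integral D t) {0..t}" if "t \<in> {0..T}" for t
  proof -
    have "((\<lambda>s. scale_op (- \<i>) (K s o\<^sub>L U s) - scale_op (- \<i>) (K s o\<^sub>L V s)) has_integral
        (U t - id_blinfun) - (V t - id_blinfun)) {0..t}"
      using U V that unfolding evolution_on_def by (intro has_integral_diff) auto
    then show ?thesis
      by (simp add: D_def scale_op_simps bounded_bilinear.diff_right[OF bounded_bilinear_blinfun_compose])
  qed
  have "continuous_on {0..T} D"
    using U V unfolding evolution_on_def D_def by (intro continuous_intros) auto
  then have "bounded (D ` {0..T})"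
    by (intro compact_imp_bounded compact_continuous_image) auto
  then obtain B where "\<forall>x\<in>D ` {0..T}. norm x \<le> B"
    unfolding bounded_iff by blast
  then have B: "norm (D t) \<le> B" if "t \<in> {0..T}" for t using that by blast
  have bound: "norm (D t) \<le> B * ((C * t) ^ n / fact n)" if "t \<in> {0..T}" for n t
    using that
  proof (induction n arbitrary: t)
    case (Suc n)
    have der: "((\<lambda>s. B * ((C * s) ^ Suc n / fact (Suc n))) has_vector_derivative C * (B * ((C * s) ^ n / fact n)))
        (at s within {0..t})" for s
    proof -
      have "((\<lambda>s. (C * s) ^ Suc n) has_real_derivative (1 + real n) * (C * (C * s) ^ n)) (at s within {0..t})"
        by (rule DERIV_power_Suc) (auto intro!: derivative_eq_intros)
      from DERIV_cmult[OF DERIV_cdivide[OF this, of "fact (Suc n)"], of B]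
      have "((\<lambda>s. B * ((C * s) ^ Suc n / fact (Suc n))) has_real_derivative
          B * ((1 + real n) * (C * (C * s) ^ n) / fact (Suc n))) (at s within {0..t})" .
      moreover have "B * ((1 + real n) * (C * y) / fact (Suc n)) = C * (B * (y / fact n))" for y
      proof -
        have "fact (Suc n) = (1 + real n) * fact n" by simp
        then show ?thesis by (simp del: fact_Suc)
      qed
      ultimately show ?thesis
        by (simp only: has_real_derivative_iff_has_vector_derivative)
    qed
    have "((\<lambda>s. C * (B * ((C * s) ^ n / fact n))) has_integral
        B * ((C * t) ^ Suc n / fact (Suc n)) - B * ((C * 0) ^ Suc n / fact (Suc n))) {0..t}"
      using Suc.prems by (intro fundamental_theorem_of_calculus der) auto
    then have bi: "((\<lambda>s. C * (B * ((C * s) ^ n / fact n))) has_integral B * ((C * t) ^ Suc n / fact (Suc n))) {0..t}"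
      by simp
    have "norm (integral {0..t} (\<lambda>s. scale_op (- \<i>) (K s o\<^sub>L D s)))
        \<le> integral {0..t} (\<lambda>s. C * (B * ((C * s) ^ n / fact n)))"
    proof (rule integral_norm_bound_integral)
      show "(\<lambda>s. scale_op (- \<i>) (K s o\<^sub>L D s)) integrable_on {0..t}"
        using int[OF Suc.prems] by blast
      show "(\<lambda>s. C * (B * ((C * s) ^ n / fact n))) integrable_on {0..t}" using bi by blast
      fix s assume s: "s \<in> {0..t}"
      then have s': "s \<in> {0..T}" using Suc.prems by auto
      have "norm (scale_op (- \<i>) (K s o\<^sub>L D s)) \<le> norm (K s o\<^sub>L D s)"
        using norm_scale_op_le[of "- \<i>" "K s o\<^sub>L D s"] by simp
      also have "\<dots> \<le> norm (K s) * norm (D s)" by (rule norm_blinfun_compose)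
      also have "\<dots> \<le> C * (B * ((C * s) ^ n / fact n))"
        using C by (intro mult_mono K[OF s'] Suc.IH[OF s']) auto
      finally show "norm (scale_op (- \<i>) (K s o\<^sub>L D s)) \<le> C * (B * ((C * s) ^ n / fact n))" .
    qed
    then show ?case
      unfolding integral_unique[OF int[OF Suc.prems]] integral_unique[OF bi] .
  qed (simp add: B)
  have "(\<lambda>n. (C * t) ^ n /\<^sub>R fact n) \<longlonglongrightarrow> 0"
    by (rule summable_LIMSEQ_zero[OF summable_exp_generic])
  then have "(\<lambda>n. B * ((C * t) ^ n /\<^sub>R fact n)) \<longlonglongrightarrow> B * 0"
    by (rule tendsto_mult_left)
  then have "norm (D t) \<le> B * 0"
    by (rule LIMSEQ_le_const) (use bound[OF t] in \<open>auto simp: divide_inverse mult.commute\<close>)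
  then show ?thesis by (simp add: D_def)
qed

text \<open>The coefficients are at most K / h^n for some K, so without constant term the geometric
  majorant is O(\<bar>l\<bar>).\<close>

lemma powser_small_near_0:
  fixes c :: "nat \<Rightarrow> 'c :: banach"
  assumes c0: "c 0 = 0" and h: "h > 0" and s: "summable (\<lambda>n. (h :: real) ^ n *\<^sub>R c n)" and \<epsilon>: "\<epsilon> > 0"
  shows "\<exists>d>0. \<forall>l. \<bar>l\<bar> < d \<longrightarrow> norm (\<Sum>n. l ^ n *\<^sub>R c n) \<le> \<epsilon>"
proof -
  have "Bseq (\<lambda>k. h ^ k *\<^sub>R c k)"
    using summable_LIMSEQ_zero[OF s] convergentI convergent_imp_Bseq by blast
  then obtain K where K: "K > 0" "\<And>k. norm (h ^ k *\<^sub>R c k) \<le> K" by (auto elim: BseqE)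
  have bound: "norm (\<Sum>n. l ^ n *\<^sub>R c n) \<le> \<bar>l\<bar> * (4 * K / h)" if l: "\<bar>l\<bar> < h / 2" for l
  proof -
    have le: "norm (l ^ n *\<^sub>R c n) \<le> 2 * K * \<bar>l\<bar> / h * (1 / 2) ^ n" for n
    proof (cases n)
      case 0
      then show ?thesis using K h c0 by simp
    next
      case (Suc m)
      have "norm (c n) \<le> K / h ^ n" using K(2)[of n] h by (simp add: field_simps)
      then have "norm (l ^ n *\<^sub>R c n) \<le> \<bar>l\<bar> ^ n * (K / h ^ n)"
        by (simp only: norm_scaleR power_abs) (rule mult_left_mono, auto)
      also have "\<dots> = K * (\<bar>l\<bar> / h) ^ m * (\<bar>l\<bar> / h)"
        using h by (simp add: Suc power_divide mult_ac)
      also have "\<dots> \<le> K * (1 / 2) ^ m * (\<bar>l\<bar> / h)"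
        using l h K by (intro mult_right_mono mult_left_mono power_mono) (auto simp: field_simps)
      finally show ?thesis by (simp add: Suc mult_ac)
    qed
    have g: "(\<lambda>n. 2 * K * \<bar>l\<bar> / h * (1 / 2) ^ n) sums (2 * K * \<bar>l\<bar> / h * 2)"
      using sums_mult[OF geometric_sums[of "1 / 2 :: real"], of "2 * K * \<bar>l\<bar> / h"] by simp
    have "norm (\<Sum>n. l ^ n *\<^sub>R c n) \<le> 2 * K * \<bar>l\<bar> / h * 2"
      unfolding sums_unique[OF g] by (rule norm_suminf_le[OF le sums_summable[OF g]])
    then show ?thesis by (simp add: mult_ac)
  qed
  define d where "d = min (h / 2) (\<epsilon> * h / (4 * K))"
  have "d > 0" using h K \<epsilon> by (simp add: d_def)
  moreover have "norm (\<Sum>n. l ^ n *\<^sub>R c n) \<le> \<epsilon>" if "\<bar>l\<bar> < d" for l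
  proof -
    have "\<bar>l\<bar> * (4 * K / h) \<le> \<epsilon> * h / (4 * K) * (4 * K / h)"
      using that h K by (intro mult_right_mono) (auto simp: d_def)
    also have "\<dots> = \<epsilon>" using h K by simp
    finally show ?thesis using bound[of l] that by (simp add: d_def)
  qed
  ultimately show ?thesis by blast
qed

text \<open>Uniqueness in the definite description: two candidates exponentiate to the same
  evolution operator. For small l both exponents lie in the ball where \<open>exp_op\<close> is
  injective, so the two power series agree near 0, and hence their coefficients.\<close>

lemma magnus_terms_eqI:
  fixes K :: "real \<Rightarrow> ('a :: complex_hilbert \<Rightarrow>\<^sub>L 'a)"
  assumes T: "0 \<le> T" and K: "\<And>t. t \<in> {0..T} \<Longrightarrow> norm (K t) \<le> C"
    and zero: "\<Omega> 0 = 0" and r: "r > 0"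
    and \<Omega>: "\<And>l :: real. \<bar>l\<bar> < r \<Longrightarrow> summable (\<lambda>n. l ^ n *\<^sub>R \<Omega> n) \<and>
      (\<exists>U. evolution_on T (\<lambda>t. l *\<^sub>R K t) U \<and> U T = exp_op (\<Sum>n. l ^ n *\<^sub>R \<Omega> n))"
  shows "magnus_terms T K = \<Omega>"
  unfolding magnus_terms_def
proof (rule the_equality)
  show "\<Omega> 0 = 0 \<and> (\<exists>r>0. \<forall>l::real. \<bar>l\<bar> < r \<longrightarrow> summable (\<lambda>n. l ^ n *\<^sub>R \<Omega> n) \<and>
      (\<exists>U. evolution_on T (\<lambda>t. l *\<^sub>R K t) U \<and> U T = exp_op (\<Sum>n. l ^ n *\<^sub>R \<Omega> n)))"
    using zero r \<Omega> by blast
  fix \<Omega>'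
  assume "\<Omega>' 0 = 0 \<and> (\<exists>r>0. \<forall>l::real. \<bar>l\<bar> < r \<longrightarrow> summable (\<lambda>n. l ^ n *\<^sub>R \<Omega>' n) \<and>
      (\<exists>U. evolution_on T (\<lambda>t. l *\<^sub>R K t) U \<and> U T = exp_op (\<Sum>n. l ^ n *\<^sub>R \<Omega>' n)))"
  then obtain r' where zero': "\<Omega>' 0 = 0" and r': "r' > 0"
    and \<Omega>': "\<And>l :: real. \<bar>l\<bar> < r' \<Longrightarrow> summable (\<lambda>n. l ^ n *\<^sub>R \<Omega>' n) \<and>
      (\<exists>U. evolution_on T (\<lambda>t. l *\<^sub>R K t) U \<and> U T = exp_op (\<Sum>n. l ^ n *\<^sub>R \<Omega>' n))"
    by blast
  obtain d where d: "d > 0" "\<And>l. \<bar>l\<bar> < d \<Longrightarrow> norm (\<Sum>n. l ^ n *\<^sub>R \<Omega> n) \<le> 0.54"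
    using powser_small_near_0[of \<Omega> "r / 2" "0.54"] zero r \<Omega>[of "r / 2"] by auto
  obtain d' where d': "d' > 0" "\<And>l. \<bar>l\<bar> < d' \<Longrightarrow> norm (\<Sum>n. l ^ n *\<^sub>R \<Omega>' n) \<le> 0.54"
    using powser_small_near_0[of \<Omega>' "r' / 2" "0.54"] zero' r' \<Omega>'[of "r' / 2"] by auto
  define \<rho> where "\<rho> = min (min r r') (min d d')"
  have \<rho>: "\<rho> > 0" using r r' d d' by (simp add: \<rho>_def)
  have "\<Omega> n - \<Omega>' n = 0" for n
  proof (rule powser_eq_0_imp_coeff_0[OF \<rho>])
    fix l :: real assume l: "\<bar>l\<bar> < \<rho>"
    then have lr: "\<bar>l\<bar> < r" "\<bar>l\<bar> < r'" "\<bar>l\<bar> < d" "\<bar>l\<bar> < d'" by (auto simp: \<rho>_def)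
    obtain U where U: "evolution_on T (\<lambda>t. l *\<^sub>R K t) U" "U T = exp_op (\<Sum>n. l ^ n *\<^sub>R \<Omega> n)"
      using \<Omega>[OF lr(1)] by blast
    obtain V where V: "evolution_on T (\<lambda>t. l *\<^sub>R K t) V" "V T = exp_op (\<Sum>n. l ^ n *\<^sub>R \<Omega>' n)"
      using \<Omega>'[OF lr(2)] by blast
    have "norm (l *\<^sub>R K t) \<le> \<bar>l\<bar> * C" if "t \<in> {0..T}" for t
      using K[OF that] by (simp add: mult_left_mono)
    then have "U T = V T"
      by (rule evolution_on_unique[OF U(1) V(1)]) (use T in auto)
    then have eq: "(\<Sum>n. l ^ n *\<^sub>R \<Omega> n) = (\<Sum>n. l ^ n *\<^sub>R \<Omega>' n)"
      unfolding U(2) V(2) by (rule exp_op_inj_near_0[OF _ d(2)[OF lr(3)] d'(2)[OF lr(4)]])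
    have "(\<lambda>n. l ^ n *\<^sub>R \<Omega> n - l ^ n *\<^sub>R \<Omega>' n) sums ((\<Sum>n. l ^ n *\<^sub>R \<Omega> n) - (\<Sum>n. l ^ n *\<^sub>R \<Omega>' n))"
      using \<Omega>[OF lr(1)] \<Omega>'[OF lr(2)] by (intro sums_diff summable_sums) auto
    then show "(\<lambda>n. l ^ n *\<^sub>R (\<Omega> n - \<Omega>' n)) sums 0"
      by (simp add: eq scaleR_diff_right)
  qed
  then show "\<Omega>' = \<Omega>" by auto
qed

subsection \<open>Piecewise constant generators\<close>

definition step_fun :: "real \<Rightarrow> nat \<Rightarrow> (nat \<Rightarrow> 'c :: real_normed_vector) \<Rightarrow> real \<Rightarrow> 'c"
  where "step_fun \<tau> n \<kappa> t = (\<Sum>j<n. indicat_real {real j * \<tau> ..< real (Suc j) * \<tau>} t *\<^sub>R \<kappa> j)"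

text \<open>The time spent in the j-th slot up to time t: 0 before the slot, \<tau> after
  it.\<close>

abbreviation clamp :: "real \<Rightarrow> nat \<Rightarrow> real \<Rightarrow> real"
  where "clamp \<tau> j t \<equiv> max 0 (min \<tau> (t - real j * \<tau>))"

text \<open>A single formula for all t: slots not yet begun contribute exp 0 = 1 and completed ones
  their full exponential.\<close>

definition step_evolution :: "real \<Rightarrow> nat \<Rightarrow> (nat \<Rightarrow> 'c :: {real_normed_algebra_1, banach}) \<Rightarrow> real \<Rightarrow> 'c"
  where "step_evolution \<tau> n \<kappa> t = (\<Prod>j\<leftarrow>rev [0..<n]. exp (clamp \<tau> j t *\<^sub>R \<kappa> j))"

lemma step_evolution_0 [simp]: "step_evolution \<tau> 0 \<kappa> t = 1"
  and step_evolution_Suc: "step_evolution \<tau> (Suc n) \<kappa> t = exp (clamp \<tau> n t *\<^sub>R \<kappa> n) * step_evolution \<tau> n \<kappa> t"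
  by (simp_all add: step_evolution_def)

lemma continuous_on_step_evolution: "continuous_on A (step_evolution \<tau> n \<kappa>)"
proof (induction n)
  case (Suc n)
  show ?case
    unfolding step_evolution_Suc
  proof (intro continuous_on_mult Suc)
    have "continuous_on UNIV (\<lambda>r. exp (r *\<^sub>R \<kappa> n))"
      by (intro continuous_at_imp_continuous_on ballI
          has_vector_derivative_continuous[OF exp_scaleR_has_vector_derivative_left])
    then show "continuous_on A (\<lambda>t. exp (clamp \<tau> n t *\<^sub>R \<kappa> n))"
      by (rule continuous_on_compose2) (auto intro!: continuous_intros)
  qed
qed simp

lemma step_fun_eq_0: "\<tau> \<ge> 0 \<Longrightarrow> real n * \<tau> \<le> t \<Longrightarrow> step_fun \<tau> n \<kappa> t = 0"
proof -
  assume \<tau>: "\<tau> \<ge> 0" and t: "real n * \<tau> \<le> t"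
  have "indicat_real {real j * \<tau> ..< real (Suc j) * \<tau>} t = 0" if "j < n" for j
  proof -
    have "real (Suc j) * \<tau> \<le> real n * \<tau>" using that \<tau> by (intro mult_right_mono) auto
    then show ?thesis using t by (simp add: indicator_def)
  qed
  then show ?thesis by (simp add: step_fun_def)
qed

text \<open>Away from the grid points only the factor of the current slot moves. It stands to the
  left of all completed factors, and the later ones are still 1, so its derivative puts the
  generator in front of the whole product.\<close>

lemma step_evolution_deriv:
  assumes \<tau>: "\<tau> > 0" and t: "t \<notin> (\<lambda>i. real i * \<tau>) ` {..n}"
  shows "(step_evolution \<tau> n \<kappa> has_vector_derivative step_fun \<tau> n \<kappa> t * step_evolution \<tau> n \<kappa> t) (at t)"
  using t
proof (induction n)
  case 0
  show ?case by (simp add: step_fun_def[of _ 0])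
next
  case (Suc n)
  have IH: "(step_evolution \<tau> n \<kappa> has_vector_derivative step_fun \<tau> n \<kappa> t * step_evolution \<tau> n \<kappa> t) (at t)"
    by (rule Suc.IH) (use Suc.prems in auto)
  let ?a = "real n * \<tau>" and ?b = "real (Suc n) * \<tau>"
  have "?a \<in> (\<lambda>i. real i * \<tau>) ` {..Suc n}" "?b \<in> (\<lambda>i. real i * \<tau>) ` {..Suc n}"
    by (rule imageI, simp)+
  then have neq: "t \<noteq> ?a" "t \<noteq> ?b" using Suc.prems by blast+
  have ab: "?b = ?a + \<tau>" by (simp add: algebra_simps)
  have fs: "step_fun \<tau> (Suc n) \<kappa> t = step_fun \<tau> n \<kappa> t + indicat_real {?a ..< ?b} t *\<^sub>R \<kappa> n"
    by (simp add: step_fun_def)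
  consider "t < ?a" | "?a < t" "t < ?b" | "?b < t" using neq by linarith
  then show ?case
  proof cases
    case 1
    have "(step_evolution \<tau> (Suc n) \<kappa> has_vector_derivative step_fun \<tau> n \<kappa> t * step_evolution \<tau> n \<kappa> t) (at t)"
      by (rule has_vector_derivative_transform_within_open[OF IH, of "{..< ?a}"])
        (use 1 \<tau> in \<open>auto simp: step_evolution_Suc\<close>)
    moreover have "step_evolution \<tau> (Suc n) \<kappa> t = step_evolution \<tau> n \<kappa> t"
      using 1 \<tau> by (simp add: step_evolution_Suc)
    moreover have "step_fun \<tau> (Suc n) \<kappa> t = step_fun \<tau> n \<kappa> t"
      using 1 by (simp add: fs indicator_def)
    ultimately show ?thesis by (simp only:)
  next
    case 2
    have z: "step_fun \<tau> n \<kappa> t = 0" using 2 \<tau> by (intro step_fun_eq_0) auto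
    have cl: "clamp \<tau> n s = s - ?a" if "?a < s" "s < ?b" for s
      using that unfolding ab by simp
    have sh: "((\<lambda>s. exp ((s - ?a) *\<^sub>R \<kappa> n)) has_vector_derivative 1 *\<^sub>R (\<kappa> n * exp ((t - ?a) *\<^sub>R \<kappa> n))) (at t)"
      by (rule vector_diff_chain_at[of "\<lambda>s. s - ?a" 1 t "\<lambda>s. exp (s *\<^sub>R \<kappa> n)", unfolded o_def])
        (auto intro!: derivative_eq_intros exp_scaleR_has_vector_derivative_left)
    have "((\<lambda>s. exp ((s - ?a) *\<^sub>R \<kappa> n) * step_evolution \<tau> n \<kappa> s) has_vector_derivative
        exp ((t - ?a) *\<^sub>R \<kappa> n) * (step_fun \<tau> n \<kappa> t * step_evolution \<tau> n \<kappa> t)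
        + 1 *\<^sub>R (\<kappa> n * exp ((t - ?a) *\<^sub>R \<kappa> n)) * step_evolution \<tau> n \<kappa> t) (at t)"
      by (rule has_vector_derivative_mult[OF sh IH])
    then have "((\<lambda>s. exp ((s - ?a) *\<^sub>R \<kappa> n) * step_evolution \<tau> n \<kappa> s) has_vector_derivative
        \<kappa> n * (exp ((t - ?a) *\<^sub>R \<kappa> n) * step_evolution \<tau> n \<kappa> t)) (at t)"
      by (simp add: z mult.assoc)
    then have "(step_evolution \<tau> (Suc n) \<kappa> has_vector_derivative
        \<kappa> n * (exp ((t - ?a) *\<^sub>R \<kappa> n) * step_evolution \<tau> n \<kappa> t)) (at t)"
      by (rule has_vector_derivative_transform_within_open[of _ _ _ "{?a <..< ?b}"])
        (use 2 in \<open>auto simp: step_evolution_Suc cl simp del: of_nat_Suc\<close>)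
    moreover have "step_evolution \<tau> (Suc n) \<kappa> t = exp ((t - ?a) *\<^sub>R \<kappa> n) * step_evolution \<tau> n \<kappa> t"
      using 2 by (simp add: step_evolution_Suc cl del: of_nat_Suc)
    moreover have "step_fun \<tau> (Suc n) \<kappa> t = \<kappa> n"
      using 2 by (simp add: fs z del: of_nat_Suc)
    ultimately show ?thesis by (simp only:)
  next
    case 3
    have z: "step_fun \<tau> n \<kappa> t = 0" using 3 \<tau> ab by (intro step_fun_eq_0) auto
    have "((\<lambda>s. exp (\<tau> *\<^sub>R \<kappa> n) * step_evolution \<tau> n \<kappa> s) has_vector_derivative
        exp (\<tau> *\<^sub>R \<kappa> n) * (step_fun \<tau> n \<kappa> t * step_evolution \<tau> n \<kappa> t)) (at t)"
      by (rule bounded_linear.has_vector_derivative[OF bounded_linear_mult_right IH])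
    then have d: "((\<lambda>s. exp (\<tau> *\<^sub>R \<kappa> n) * step_evolution \<tau> n \<kappa> s) has_vector_derivative 0) (at t)"
      by (simp add: z)
    have cl: "clamp \<tau> n s = \<tau>" if "?b < s" for s
      using that \<tau> unfolding ab by simp
    have "(step_evolution \<tau> (Suc n) \<kappa> has_vector_derivative 0) (at t)"
      by (rule has_vector_derivative_transform_within_open[OF d, of "{?b <..}"])
        (use 3 in \<open>auto simp: step_evolution_Suc cl simp del: of_nat_Suc\<close>)
    moreover have "step_fun \<tau> (Suc n) \<kappa> t = 0"
      using 3 by (simp add: fs z del: of_nat_Suc)
    ultimately show ?thesis by simp
  qed
qed

text \<open>The fundamental theorem of calculus in the form for continuous functions that are
  differentiable off a finite set, here the grid points where the generator jumps.\<close>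

lemma step_evolution_integral:
  assumes \<tau>: "\<tau> > 0" and t: "t \<ge> 0"
  shows "((\<lambda>s. step_fun \<tau> n \<kappa> s * step_evolution \<tau> n \<kappa> s) has_integral step_evolution \<tau> n \<kappa> t - 1) {0..t}"
proof -
  have "((\<lambda>s. step_fun \<tau> n \<kappa> s * step_evolution \<tau> n \<kappa> s) has_integral
      step_evolution \<tau> n \<kappa> t - step_evolution \<tau> n \<kappa> 0) {0..t}"
    by (rule fundamental_theorem_of_calculus_interior_strong[of "(\<lambda>i. real i * \<tau>) ` {..n}"])
      (use t in \<open>auto intro!: step_evolution_deriv[OF \<tau>] continuous_on_step_evolution\<close>)
  moreover have "step_evolution \<tau> n \<kappa> 0 = 1"
  proof (induction n)
    case (Suc n)
    have "0 \<le> real n * \<tau>" using \<tau> by simp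
    then have "clamp \<tau> n 0 = 0" by simp
    then show ?case by (simp add: step_evolution_Suc Suc)
  qed simp
  ultimately show ?thesis by simp
qed

lemma step_evolution_end:
  assumes "\<tau> > 0"
  shows "step_evolution \<tau> n \<kappa> (real n * \<tau>) = (\<Prod>j\<leftarrow>rev [0..<n]. exp (\<tau> *\<^sub>R \<kappa> j))"
proof -
  have "clamp \<tau> j (real n * \<tau>) = \<tau>" if "j < n" for j
  proof -
    have "real (Suc j) * \<tau> \<le> real n * \<tau>" using that assms by (intro mult_right_mono) auto
    then show ?thesis using assms by (simp add: algebra_simps)
  qed
  then show ?thesis
    unfolding step_evolution_def by (intro arg_cong[where f = prod_list] map_cong) auto
qed

subsection \<open>Complex-linear operators\<close>

lemma clinear_op_compose: "clinear_op A \<Longrightarrow> clinear_op B \<Longrightarrow> clinear_op (A o\<^sub>L B)"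
  by (simp add: clinear_op_def)

lemma clinear_op_scale_op: "clinear_op A \<Longrightarrow> clinear_op (scale_op c A)"
  by (simp add: clinear_op_def scale_op_apply scaleC_scaleC mult.commute)

lemma clinear_op_add: "clinear_op A \<Longrightarrow> clinear_op B \<Longrightarrow> clinear_op (A + B)"
  by (simp add: clinear_op_def blinfun.add_left scaleC_add_right)

lemma clinear_op_scaleR: "clinear_op A \<Longrightarrow> clinear_op (r *\<^sub>R A)"
  by (simp add: clinear_op_def blinfun.scaleR_left scaleC_scaleR_commute)

lemma clinear_op_0: "clinear_op 0"
  by (simp add: clinear_op_def)

lemma clinear_op_id: "clinear_op id_blinfun"
  by (simp add: clinear_op_def)

lemma subspace_clinear_op: "subspace {A. clinear_op A}"
  by (simp add: subspace_def clinear_op_0 clinear_op_add clinear_op_scaleR)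

lemma clinear_op_sum: "(\<And>i. i \<in> I \<Longrightarrow> clinear_op (f i)) \<Longrightarrow> clinear_op (sum f I)"
  using subspace_sum[OF subspace_clinear_op, of I f] by simp

lemma clinear_op_suminf:
  assumes s: "summable A" and A: "\<And>n. clinear_op (A n)"
  shows "clinear_op (\<Sum>n. A n)"
  unfolding clinear_op_def
proof (intro allI)
  fix c x
  have bl: "bounded_linear (\<lambda>A. blinfun_apply A y)" for y :: 'a by (rule blinfun.bounded_linear_left)
  have "(\<Sum>n. A n) (c *\<^sub>C x) = (\<Sum>n. c *\<^sub>C A n x)"
    using bounded_linear.suminf[OF bl s, symmetric, of "c *\<^sub>C x"] A by (simp add: clinear_op_def)
  also have "\<dots> = c *\<^sub>C (\<Sum>n. A n x)"
    by (rule bounded_linear.suminf[OF bounded_linear_scaleC, symmetric])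
      (rule bounded_linear.summable[OF bl s])
  also have "(\<Sum>n. A n x) = (\<Sum>n. A n) x"
    using bounded_linear.suminf[OF bl s, of x] by simp
  finally show "(\<Sum>n. A n) (c *\<^sub>C x) = c *\<^sub>C (\<Sum>n. A n) x" .
qed

section \<open>The effective Hamiltonian of a palindromic toggling frame\<close>

lemma evolution_on_step:
  fixes A :: "nat \<Rightarrow> ('a :: complex_hilbert \<Rightarrow>\<^sub>L 'a)"
  assumes \<tau>: "\<tau> > 0"
  shows "evolution_on (real R * \<tau>) (step_fun \<tau> R A)
    (\<lambda>t. corner (step_evolution \<tau> R (\<lambda>i. emb (scale_op (- \<i>) (A i))) t))"
  unfolding evolution_on_def
proof (intro conjI ballI)
  let ?\<kappa> = "\<lambda>i. emb (scale_op (- \<i>) (A i))"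
  show "continuous_on {0..real R * \<tau>} (\<lambda>t. corner (step_evolution \<tau> R ?\<kappa> t))"
    by (intro bounded_linear.continuous_on[OF bounded_linear_corner] continuous_on_step_evolution)
  fix t assume "t \<in> {0..real R * \<tau>}"
  then have "((\<lambda>s. step_fun \<tau> R ?\<kappa> s * step_evolution \<tau> R ?\<kappa> s) has_integral step_evolution \<tau> R ?\<kappa> t - 1) {0..t}"
    by (intro step_evolution_integral \<tau>) auto
  from has_integral_linear[OF this bounded_linear_corner]
  have "((\<lambda>s. corner (step_fun \<tau> R ?\<kappa> s * step_evolution \<tau> R ?\<kappa> s)) has_integral
      corner (step_evolution \<tau> R ?\<kappa> t - 1)) {0..t}"
    by (simp only: o_def)
  moreover have "step_fun \<tau> R ?\<kappa> s = emb (scale_op (- \<i>) (step_fun \<tau> R A s))" for s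
    by (simp add: step_fun_def emb_simps scale_op_simps)
  ultimately show "((\<lambda>s. scale_op (- \<i>) (step_fun \<tau> R A s o\<^sub>L corner (step_evolution \<tau> R ?\<kappa> s)))
      has_integral corner (step_evolution \<tau> R ?\<kappa> t) - id_blinfun) {0..t}"
    by (simp add: corner_emb_mult scale_op_compose corner_simps)
qed

lemma step_fun_scaleR: "l *\<^sub>R step_fun \<tau> R A t = step_fun \<tau> R (\<lambda>i. l *\<^sub>R A i) t"
  by (simp only: step_fun_def scaleR_right.sum scaleR_scaleR mult.commute)

lemma norm_step_fun_le: "norm (step_fun \<tau> R A t) \<le> (\<Sum>j<R. norm (A j))"
  unfolding step_fun_def by (intro sum_norm_le) (simp add: indicator_def)

text \<open>The logarithm theorem applied to -i \<tau> times the operators, so that x is R (\<tau>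
  \<beta> + \<tau> J). The factor i / T undoes -i T, and R \<tau> J / T = J gives the stated
  bound.\<close>

theorem magnus_sum_palindromic:
  fixes Hb :: "'a :: complex_hilbert \<Rightarrow>\<^sub>L 'a" and E :: "nat \<Rightarrow> ('a \<Rightarrow>\<^sub>L 'a)"
  assumes cl: "\<And>i. i < R \<Longrightarrow> clinear_op (Hb + E i)"
    and Hb: "norm Hb \<le> \<beta>" and E: "\<And>i. i < R \<Longrightarrow> norm (E i) \<le> J" and R: "R \<ge> 2"
    and sum0: "(\<Sum>i<R. E i) = 0" and sym: "\<And>i. i < R \<Longrightarrow> E (R - 1 - i) = E i"
    and \<tau>: "\<tau> > 0" and x: "x = (\<beta> + J) * (real R * \<tau>)" "x \<le> 0.54"
  defines "Y \<equiv> scale_op (\<i> / complex_of_real (real R * \<tau>))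
    (magnus_sum (real R * \<tau>) (step_fun \<tau> R (\<lambda>i. Hb + E i)))"
  shows "clinear_op Y" and "norm (Y - Hb) \<le> (2 / 9 + 9.43 * x\<^sup>2) * x\<^sup>2 * J"
proof -
  define A where "A = (\<lambda>i. Hb + E i)"
  define b where "b = emb (\<tau> *\<^sub>R scale_op (- \<i>) Hb)"
  define e where "e = (\<lambda>i. emb (\<tau> *\<^sub>R scale_op (- \<i>) (E i)))"
  \<comment> \<open>Elements of \<open>N\<close> are recovered from their corner by
    \<open>emb\<close>, so the abstract coefficients \<open>\<Omega> n\<close> really are operators,
    and complex-linear ones.\<close>
  define N where "N = emb ` {A :: 'a \<Rightarrow>\<^sub>L 'a. clinear_op A}"
  define T where "T = real R * \<tau>"
  have T: "T > 0" using R \<tau> by (simp add: T_def)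
  have be: "b + e i = \<tau> *\<^sub>R emb (scale_op (- \<i>) (A i))" for i
    by (simp add: b_def e_def A_def emb_simps scale_op_simps scaleR_right_distrib)
  have nrm: "norm (emb (\<tau> *\<^sub>R scale_op (- \<i>) B)) \<le> \<tau> * c" if "norm B \<le> c" for B :: "'a \<Rightarrow>\<^sub>L 'a" and c
  proof -
    have "norm (emb (\<tau> *\<^sub>R scale_op (- \<i>) B)) \<le> \<tau> * norm (scale_op (- \<i>) B)"
      using norm_emb_le[of "\<tau> *\<^sub>R scale_op (- \<i>) B"] \<tau> by simp
    also have "\<dots> \<le> \<tau> * c"
      using norm_scale_op_le[of "- \<i>" B] that \<tau> by (intro mult_left_mono) auto
    finally show ?thesis .
  qed
  have N: "subspace N"
    unfolding N_def by (rule linear_subspace_image[OF bounded_linear.linear[OF bounded_linear_emb] subspace_clinear_op])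
  have Nm: "X * Z \<in> N" if "X \<in> N" "Z \<in> N" for X Z
    using that unfolding N_def by (auto simp: emb_mult intro!: imageI clinear_op_compose)
  have mem: "b + e i \<in> N" if "i < R" for i
    unfolding be emb_simps(3)[symmetric] N_def
    using cl[OF that] by (auto intro!: imageI clinear_op_scaleR clinear_op_scale_op simp: A_def)
  have se: "(\<Sum>i<R. e i) = 0"
    using sum0 unfolding e_def emb_simps(5)[symmetric] scale_op_simps(4)[symmetric] scaleR_right.sum[symmetric]
    by (simp add: emb_simps linear_0[OF bounded_linear.linear[OF bounded_linear_scale_op]])
  have x': "x = real R * (\<tau> * \<beta> + \<tau> * J)" by (simp add: x(1) algebra_simps)
  obtain \<Omega> where \<Omega>: "\<Omega> 0 = 0" "\<And>n. \<Omega> n \<in> N" "summable (\<lambda>n. norm (\<Omega> n))"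
    "\<And>l. \<bar>l\<bar> \<le> 1 \<Longrightarrow> exp (\<Sum>n. l ^ n *\<^sub>R \<Omega> n) = fps_sum l (dyson (\<lambda>i. b + e i) R)"
    "norm ((\<Sum>n. \<Omega> n) - real R *\<^sub>R b) \<le> (2 / 9 + 9.43 * x\<^sup>2) * x\<^sup>2 * (real R * (\<tau> * J))"
  proof (rule palindromic_log[of b "\<tau> * \<beta>" R e "\<tau> * J" x N])
    show "norm b \<le> \<tau> * \<beta>" unfolding b_def by (rule nrm[OF Hb])
    show "norm (e i) \<le> \<tau> * J" if "i < R" for i unfolding e_def by (rule nrm[OF E[OF that]])
    show "e (R - 1 - i) = e i" if "i < R" for i unfolding e_def sym[OF that] ..
  qed (use R se x' x(2) N Nm mem in auto)
  define \<Omega>' where "\<Omega>' = (\<lambda>n. corner (\<Omega> n))"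
  have emb\<Omega>: "emb (\<Omega>' n) = \<Omega> n" and cl\<Omega>: "clinear_op (\<Omega>' n)" for n
    using \<Omega>(2)[of n] by (auto simp: \<Omega>'_def N_def)
  have sm: "summable (\<lambda>n. l ^ n *\<^sub>R \<Omega> n)" if "\<bar>l\<bar> \<le> 1" for l :: real
  proof (rule summable_comparison_test'[OF \<Omega>(3)])
    show "norm (l ^ n *\<^sub>R \<Omega> n) \<le> norm (\<Omega> n)" for n
      using that by (simp add: power_abs mult_left_le_one_le power_le_one)
  qed
  have sums': "(\<lambda>n. l ^ n *\<^sub>R \<Omega>' n) sums corner (\<Sum>n. l ^ n *\<^sub>R \<Omega> n)"
    and emb_sum: "emb (corner (\<Sum>n. l ^ n *\<^sub>R \<Omega> n)) = (\<Sum>n. l ^ n *\<^sub>R \<Omega> n)" if "\<bar>l\<bar> \<le> 1" for l :: real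
  proof -
    show 1: "(\<lambda>n. l ^ n *\<^sub>R \<Omega>' n) sums corner (\<Sum>n. l ^ n *\<^sub>R \<Omega> n)"
      using bounded_linear.sums[OF bounded_linear_corner summable_sums[OF sm[OF that]]]
      by (simp only: corner_simps \<Omega>'_def)
    from bounded_linear.sums[OF bounded_linear_emb this]
    have "(\<lambda>n. l ^ n *\<^sub>R \<Omega> n) sums emb (corner (\<Sum>n. l ^ n *\<^sub>R \<Omega> n))"
      by (simp only: emb_simps emb\<Omega>)
    then show "emb (corner (\<Sum>n. l ^ n *\<^sub>R \<Omega> n)) = (\<Sum>n. l ^ n *\<^sub>R \<Omega> n)" by (rule sums_unique)
  qed
  \<comment> \<open>The description asks only for some neighbourhood of \<lambda> = 0, and radius
    one serves. The value at \<lambda> = 1 itself is read off below from absolute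
    summability.\<close>
  have terms: "magnus_terms T (step_fun \<tau> R A) = \<Omega>'"
  proof (rule magnus_terms_eqI[OF _ norm_step_fun_le _ zero_less_one])
    show "0 \<le> T" using T by simp
    show "\<Omega>' 0 = 0" by (simp add: \<Omega>'_def \<Omega>(1) corner_simps)
    fix l :: real assume "\<bar>l\<bar> < 1"
    then have l: "\<bar>l\<bar> \<le> 1" by simp
    let ?U = "\<lambda>t. corner (step_evolution \<tau> R (\<lambda>i. emb (scale_op (- \<i>) (l *\<^sub>R A i))) t)"
    have "evolution_on T (\<lambda>t. l *\<^sub>R step_fun \<tau> R A t) ?U"
      unfolding step_fun_scaleR T_def by (rule evolution_on_step[OF \<tau>])
    moreover have "?U T = exp_op (\<Sum>n. l ^ n *\<^sub>R \<Omega>' n)"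
    proof -
      have "exp_op (\<Sum>n. l ^ n *\<^sub>R \<Omega>' n) = corner (exp (\<Sum>n. l ^ n *\<^sub>R \<Omega> n))"
        unfolding sums_unique[OF sums'[OF l], symmetric] corner_exp_emb[symmetric] emb_sum[OF l] ..
      also have "\<dots> = corner (\<Prod>i\<leftarrow>rev [0..<R]. exp (l *\<^sub>R (b + e i)))"
        unfolding \<Omega>(4)[OF l] fps_sum_dyson[OF l] ..
      also have "\<dots> = ?U T"
        unfolding T_def step_evolution_end[OF \<tau>] be
        by (simp add: scale_op_simps emb_simps mult.commute)
      finally show ?thesis ..
    qed
    ultimately show "summable (\<lambda>n. l ^ n *\<^sub>R \<Omega>' n) \<and>
        (\<exists>U. evolution_on T (\<lambda>t. l *\<^sub>R step_fun \<tau> R A t) U \<and> U T = exp_op (\<Sum>n. l ^ n *\<^sub>R \<Omega>' n))"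
      using sums'[OF l] by (blast intro: sums_summable)
  qed
  have s1: "\<Omega>' sums corner (\<Sum>n. \<Omega> n)" using sums'[of 1] by simp
  have Y: "Y = scale_op (\<i> / complex_of_real T) (corner (\<Sum>n. \<Omega> n))"
    unfolding Y_def magnus_sum_def A_def[symmetric] T_def[symmetric] terms sums_unique[OF s1] ..
  have "clinear_op (corner (\<Sum>n. \<Omega> n))"
    unfolding sums_unique[OF s1] by (rule clinear_op_suminf[OF sums_summable[OF s1] cl\<Omega>])
  then show "clinear_op Y" unfolding Y by (rule clinear_op_scale_op)
  have "corner ((\<Sum>n. \<Omega> n) - real R *\<^sub>R b) = corner (\<Sum>n. \<Omega> n) - scale_op (complex_of_real T * - \<i>) Hb"
    by (simp add: corner_simps b_def emb_simps T_def scale_op_scale_op mult.assoc flip: scale_op_of_real)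
  moreover have "scale_op (\<i> / complex_of_real T) (scale_op (complex_of_real T * - \<i>) Hb) = Hb"
    using T scale_op_of_real[of 1 Hb] by (simp add: scale_op_scale_op)
  ultimately have "Y - Hb = scale_op (\<i> / complex_of_real T) (corner ((\<Sum>n. \<Omega> n) - real R *\<^sub>R b))"
    by (simp add: Y scale_op_simps)
  then have "norm (Y - Hb) \<le> 1 / T * norm ((\<Sum>n. \<Omega> n) - real R *\<^sub>R b)"
    using norm_scale_op_le[of "\<i> / complex_of_real T"] T
      mult_left_mono[OF norm_corner_le, of "1 / T" "(\<Sum>n. \<Omega> n) - real R *\<^sub>R b"]
    by (smt (verit) norm_divide norm_ii norm_of_real divide_nonneg_pos)
  also have "\<dots> \<le> 1 / T * ((2 / 9 + 9.43 * x\<^sup>2) * x\<^sup>2 * (real R * (\<tau> * J)))"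
    using \<Omega>(5) T by (intro mult_left_mono) auto
  also have "\<dots> = (2 / 9 + 9.43 * x\<^sup>2) * x\<^sup>2 * J"
  proof -
    have "1 / T * (c * (real R * (\<tau> * J))) = c * J" for c
      using T R \<tau> by (simp add: T_def)
    then show ?thesis by simp
  qed
  finally show "norm (Y - Hb) \<le> (2 / 9 + 9.43 * x\<^sup>2) * x\<^sup>2 * J" .
qed

section \<open>Tensor products\<close>

lemma scaleC_vec_nth [simp]: "(c *\<^sub>C v) $ i = c *\<^sub>C (v $ i)"
  by (simp add: scaleC_vec_def)

lemma tensor_apply: "(M \<otimes>\<^sub>o B) v $ i = (\<Sum>j\<in>UNIV. M $ i $ j *\<^sub>C B (v $ j))"
  by (simp add: tensor_op.rep_eq)

lemma scaleC_sum_right: "c *\<^sub>C sum f A = (\<Sum>i\<in>A. c *\<^sub>C (f i :: 'a :: complex_hilbert))"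
  by (rule linear_sum[OF bounded_linear.linear[OF bounded_linear_scaleC]])

lemma scaleC_sum_left: "(\<Sum>i\<in>A. f i) *\<^sub>C (x :: 'a :: complex_hilbert) = (\<Sum>i\<in>A. f i *\<^sub>C x)"
proof (induction A rule: infinite_finite_induct)
  case (insert a A)
  then show ?case by (simp add: scaleC_add_left)
qed (use scaleR_scaleC[of 0 x] in auto)

lemma scaleC_zero_left [simp]: "0 *\<^sub>C x = (0 :: 'a :: complex_hilbert)"
  using scaleR_scaleC[of 0 x] by simp

lemma tensor_add_left: "(M + N) \<otimes>\<^sub>o B = M \<otimes>\<^sub>o B + N \<otimes>\<^sub>o B"
  by (rule blinfun_eqI)
    (simp add: vec_eq_iff tensor_apply blinfun.add_left scaleC_add_left sum.distrib)

lemma tensor_zero_left [simp]: "0 \<otimes>\<^sub>o B = 0"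
  by (rule blinfun_eqI) (simp add: vec_eq_iff tensor_apply)

lemma tensor_sum_left: "(\<Sum>k\<in>A. M k) \<otimes>\<^sub>o B = (\<Sum>k\<in>A. M k \<otimes>\<^sub>o B)"
  by (induction A rule: infinite_finite_induct) (simp_all add: tensor_add_left)

lemma tensor_zero_right [simp]: "M \<otimes>\<^sub>o 0 = 0"
  by (rule blinfun_eqI) (simp add: vec_eq_iff tensor_apply)

lemma tensor_add_right: "M \<otimes>\<^sub>o (B + C) = M \<otimes>\<^sub>o B + M \<otimes>\<^sub>o C"
  by (rule blinfun_eqI)
    (simp add: vec_eq_iff tensor_apply blinfun.add_left scaleC_add_right sum.distrib)

lemma tensor_sum_right: "M \<otimes>\<^sub>o (\<Sum>k\<in>A. B k) = (\<Sum>k\<in>A. M \<otimes>\<^sub>o B k)"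
  by (induction A rule: infinite_finite_induct) (simp_all add: tensor_add_right)

lemma tensor_scale_mat: "scale_mat c M \<otimes>\<^sub>o B = M \<otimes>\<^sub>o scale_op c B"
  by (rule blinfun_eqI)
    (simp add: vec_eq_iff tensor_apply scale_mat_def scale_op_apply scaleC_scaleC mult.commute)

lemma tensor_scale_op: "M \<otimes>\<^sub>o scale_op c B = scale_op c (M \<otimes>\<^sub>o B)"
  by (rule blinfun_eqI)
    (simp add: vec_eq_iff tensor_apply scale_op_apply scaleC_scaleC scaleC_sum_right mult.commute)

lemma blinfun_sum_right: "blinfun_apply A (sum f I) = (\<Sum>i\<in>I. A (f i))"
  by (rule linear_sum[OF bounded_linear.linear[OF blinfun.bounded_linear_right]])

text \<open>\<open>A\<close> is complex-linear so that it can be moved past the entries of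
  \<open>N\<close>, which act as complex scalars.\<close>

lemma tensor_mult:
  assumes "clinear_op A"
  shows "(M \<otimes>\<^sub>o A) o\<^sub>L (N \<otimes>\<^sub>o B) = (M ** N) \<otimes>\<^sub>o (A o\<^sub>L B)"
proof (rule blinfun_eqI)
  fix v
  have A: "A (c *\<^sub>C x) = c *\<^sub>C A x" for c x using assms by (simp add: clinear_op_def)
  have "((M \<otimes>\<^sub>o A) o\<^sub>L (N \<otimes>\<^sub>o B)) v $ i = ((M ** N) \<otimes>\<^sub>o (A o\<^sub>L B)) v $ i" for i
  proof -
    have "((M \<otimes>\<^sub>o A) o\<^sub>L (N \<otimes>\<^sub>o B)) v $ i = (\<Sum>j\<in>UNIV. \<Sum>k\<in>UNIV. (M $ i $ j * N $ j $ k) *\<^sub>C A (B (v $ k)))"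
      by (simp add: tensor_apply blinfun_sum_right A scaleC_sum_right scaleC_scaleC)
    also have "\<dots> = (\<Sum>k\<in>UNIV. \<Sum>j\<in>UNIV. (M $ i $ j * N $ j $ k) *\<^sub>C A (B (v $ k)))"
      by (rule sum.swap)
    also have "\<dots> = ((M ** N) \<otimes>\<^sub>o (A o\<^sub>L B)) v $ i"
      by (simp add: tensor_apply matrix_matrix_mult_def scaleC_sum_left)
    finally show ?thesis .
  qed
  then show "((M \<otimes>\<^sub>o A) o\<^sub>L (N \<otimes>\<^sub>o B)) v = ((M ** N) \<otimes>\<^sub>o (A o\<^sub>L B)) v"
    by (simp add: vec_eq_iff)
qed

lemma tensor_one: "mat 1 \<otimes>\<^sub>o id_blinfun = id_blinfun"
proof (rule blinfun_eqI)
  fix v :: "'a ^ 'b"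
  have "(\<Sum>j\<in>UNIV. (mat 1 :: complex ^ 'b ^ 'b) $ i $ j *\<^sub>C v $ j) = v $ i" for i
  proof -
    have "(\<Sum>j\<in>UNIV. (mat 1 :: complex ^ 'b ^ 'b) $ i $ j *\<^sub>C v $ j) = (\<Sum>j\<in>UNIV. if j = i then v $ j else 0)"
      by (rule sum.cong) (auto simp: mat_def)
    then show ?thesis by simp
  qed
  then show "(mat 1 \<otimes>\<^sub>o id_blinfun) v = id_blinfun v"
    by (simp add: vec_eq_iff tensor_apply)
qed

lemma clinear_op_tensor: "clinear_op B \<Longrightarrow> clinear_op (M \<otimes>\<^sub>o B)"
  by (simp add: clinear_op_def vec_eq_iff tensor_apply scaleC_sum_right scaleC_scaleC mult.commute)

section \<open>Adjoints and unitaries on the tensor product\<close>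

lemma cinner_add_right: "cinner x (y + z) = cinner x y + cinner x (z :: 'a :: complex_hilbert)"
  using cinner_commute[of x "y + z"] cinner_commute[of y x] cinner_commute[of z x]
  by (simp add: cinner_add_left)

lemma cinner_scaleC_right: "cinner x (c *\<^sub>C y) = c * cinner x (y :: 'a :: complex_hilbert)"
  using cinner_commute[of x "c *\<^sub>C y"] cinner_commute[of y x]
  by (simp add: cinner_scaleC_left)

lemma cinner_zero_left [simp]: "cinner 0 (y :: 'a :: complex_hilbert) = 0"
  using cinner_add_left[of 0 0 y] by simp

lemma cinner_zero_right [simp]: "cinner x (0 :: 'a :: complex_hilbert) = 0"
  using cinner_add_right[of x 0 0] by simp

lemma cinner_sum_left: "cinner (sum f A) y = (\<Sum>i\<in>A. cinner (f i) (y :: 'a :: complex_hilbert))"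
  by (induction A rule: infinite_finite_induct) (simp_all add: cinner_add_left)

lemma cinner_sum_right: "cinner x (sum f A) = (\<Sum>i\<in>A. cinner x (f i :: 'a :: complex_hilbert))"
  by (induction A rule: infinite_finite_induct) (simp_all add: cinner_add_right)

lemma cinner_tensor_id:
  "cinner ((M \<otimes>\<^sub>o id_blinfun) v) w = cinner v ((dagger M \<otimes>\<^sub>o id_blinfun) w)"
proof -
  have "cinner ((M \<otimes>\<^sub>o id_blinfun) v) w = (\<Sum>i\<in>UNIV. \<Sum>j\<in>UNIV. cnj (M $ i $ j) * cinner (v $ j) (w $ i))"
    by (simp add: cinner_vec_def tensor_apply cinner_sum_left cinner_scaleC_left)
  also have "\<dots> = (\<Sum>j\<in>UNIV. \<Sum>i\<in>UNIV. cnj (M $ i $ j) * cinner (v $ j) (w $ i))"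
    by (rule sum.swap)
  also have "\<dots> = cinner v ((dagger M \<otimes>\<^sub>o id_blinfun) w)"
    by (simp add: cinner_vec_def tensor_apply cinner_sum_right cinner_scaleC_right dagger_def)
  finally show ?thesis .
qed

lemma norm_unitary_tensor_le:
  assumes "unitary_mat U"
  shows "norm (U \<otimes>\<^sub>o (id_blinfun :: 'b :: complex_hilbert \<Rightarrow>\<^sub>L 'b)) \<le> 1"
proof (rule norm_blinfun_bound)
  fix v :: "'b ^ 'a"
  let ?U = "\<lambda>M. M \<otimes>\<^sub>o (id_blinfun :: 'b \<Rightarrow>\<^sub>L 'b)"
  have idd: "id_blinfun = id_blinfun o\<^sub>L (id_blinfun :: 'b \<Rightarrow>\<^sub>L 'b)"
    by (rule blinfun_eqI) simp
  have "(?U (dagger U) o\<^sub>L ?U U) = id_blinfun"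
    using assms by (simp add: tensor_mult clinear_op_id unitary_mat_def tensor_one flip: idd)
  then have "?U (dagger U) (?U U v) = v" by (metis blinfun_apply_blinfun_compose id_blinfun.rep_eq)
  then have "cinner (?U U v) (?U U v) = cinner v v" by (simp add: cinner_tensor_id)
  then have "?U U v \<bullet> ?U U v = v \<bullet> v" by (simp add: inner_cinner)
  then show "norm (?U U v) \<le> 1 * norm v" by (simp add: norm_eq_sqrt_inner)
qed simp

lemma dagger_dagger [simp]: "dagger (dagger M) = M"
  by (simp add: dagger_def vec_eq_iff)

lemma dagger_mult: "dagger (M ** N) = dagger N ** dagger M"
  by (simp add: dagger_def vec_eq_iff matrix_matrix_mult_def mult.commute)

lemma unitary_mat_dagger: "unitary_mat U \<Longrightarrow> unitary_mat (dagger U)"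
  by (simp add: unitary_mat_def)

lemma unitary_mat_mult:
  assumes "unitary_mat U" "unitary_mat V"
  shows "unitary_mat (U ** V)"
proof -
  have "dagger V ** dagger U ** (U ** V) = dagger V ** (dagger U ** U) ** V"
    and "U ** V ** (dagger V ** dagger U) = U ** (V ** dagger V) ** dagger U"
    by (simp_all only: matrix_mul_assoc)
  then show ?thesis using assms by (simp add: unitary_mat_def dagger_mult)
qed

lemma unitary_mat_1: "unitary_mat (mat 1)"
proof -
  have "dagger (mat 1 :: complex ^ 'a ^ 'a) = mat 1"
    by (auto simp: dagger_def mat_def vec_eq_iff)
  then show ?thesis by (simp add: unitary_mat_def)
qed

subsection \<open>Decomposition into bath and error parts\<close>

definition mat_unit :: "'n \<Rightarrow> 'n \<Rightarrow> complex ^ 'n ^ 'n"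
  where "mat_unit i j = (\<chi> k l. if k = i \<and> l = j then 1 else 0)"

lemma operator_blocks:
  fixes X :: "('b :: complex_hilbert ^ 'n :: finite) \<Rightarrow>\<^sub>L ('b ^ 'n)"
  assumes "clinear_op X"
  obtains C where "\<And>i j. clinear_op (C i j)" "X = (\<Sum>i\<in>UNIV. \<Sum>j\<in>UNIV. mat_unit i j \<otimes>\<^sub>o C i j)"
proof -
  define inj where "inj = (\<lambda>j (x :: 'b). \<chi> k :: 'n. if k = j then x else 0)"
  have bl_inj: "bounded_linear (inj j)" for j
    unfolding inj_def
  proof (rule bounded_linear_vec_lambda)
    show "bounded_linear (\<lambda>x :: 'b. if k = j then x else 0)" for k
      by (cases "k = j") (simp_all add: bounded_linear_ident bounded_linear_zero)
  qed
  define C where "C = (\<lambda>i j. Blinfun (\<lambda>x. X (inj j x) $ i))"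
  have C: "C i j x = X (inj j x) $ i" for i j x
    unfolding C_def
    by (subst bounded_linear_Blinfun_apply)
      (intro bounded_linear_compose[OF bounded_linear_vec_nth] bounded_linear_compose[OF blinfun.bounded_linear_right] bl_inj, rule refl)
  have "inj j (c *\<^sub>C x) = c *\<^sub>C inj j x" for j c x
    by (simp add: inj_def vec_eq_iff)
  then have "clinear_op (C i j)" for i j
    using assms by (simp add: clinear_op_def C)
  moreover have "X = (\<Sum>i\<in>UNIV. \<Sum>j\<in>UNIV. mat_unit i j \<otimes>\<^sub>o C i j)"
  proof (rule blinfun_eqI)
    fix v
    have v: "v = (\<Sum>j\<in>UNIV. inj j (v $ j))"
      by (simp add: vec_eq_iff inj_def)
    have "X v $ k = (\<Sum>i\<in>UNIV. \<Sum>j\<in>UNIV. mat_unit i j \<otimes>\<^sub>o C i j) v $ k" for k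
    proof -
      have u: "(mat_unit i j \<otimes>\<^sub>o C i j) v $ k = (if i = k then C k j (v $ j) else 0)" for i j
      proof -
        have "(mat_unit i j \<otimes>\<^sub>o C i j) v $ k = (\<Sum>l\<in>UNIV. if l = j then if i = k then C i j (v $ l) else 0 else 0)"
          unfolding tensor_apply mat_unit_def by (rule sum.cong) auto
        then show ?thesis by simp
      qed
      have "(\<Sum>i\<in>UNIV. \<Sum>j\<in>UNIV. mat_unit i j \<otimes>\<^sub>o C i j) v $ k
          = (\<Sum>i\<in>UNIV. \<Sum>j\<in>UNIV. (mat_unit i j \<otimes>\<^sub>o C i j) v $ k)"
        by (simp add: blinfun.sum_left)
      also have "\<dots> = (\<Sum>j\<in>UNIV. \<Sum>i\<in>UNIV. if i = k then C k j (v $ j) else 0)"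
        unfolding u by (rule sum.swap)
      also have "\<dots> = (\<Sum>j\<in>UNIV. X (inj j (v $ j)) $ k)" by (simp add: C)
      also have "\<dots> = X v $ k"
        by (subst (2) v) (simp add: blinfun_sum_right)
      finally show ?thesis ..
    qed
    then show "X v = (\<Sum>i\<in>UNIV. \<Sum>j\<in>UNIV. mat_unit i j \<otimes>\<^sub>o C i j) v" by (simp add: vec_eq_iff)
  qed
  ultimately show ?thesis by (rule that)
qed

lemma traceless_expansion:
  fixes M :: "complex ^ 'n :: finite ^ 'n"
  assumes "hermitian_traceless_basis I S"
  shows "\<exists>c u. M = scale_mat c (mat 1) + (\<Sum>\<alpha>\<in>I. scale_mat (u \<alpha>) (S \<alpha>))"
proof -
  have I: "finite I" "inj_on S I" "cmat.span (S ` I) = {M. trace M = 0}"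
    using assms by (auto simp: hermitian_traceless_basis_def)
  define c where "c = trace M / of_nat CARD('n)"
  have "trace (scale_mat c (mat 1 :: complex ^ 'n ^ 'n)) = trace M"
    by (simp add: trace_def scale_mat_def mat_def c_def)
  then have "trace (M - scale_mat c (mat 1)) = 0" by (simp add: trace_sub)
  then have "M - scale_mat c (mat 1) \<in> cmat.span (S ` I)" using I by simp
  then obtain u where "M - scale_mat c (mat 1) = (\<Sum>v\<in>S ` I. scale_mat (u v) v)"
    using cmat.span_finite[of "S ` I"] I(1) by auto
  also have "\<dots> = (\<Sum>\<alpha>\<in>I. scale_mat (u (S \<alpha>)) (S \<alpha>))"
    by (rule sum.reindex[OF I(2), unfolded o_def])
  finally have "M = scale_mat c (mat 1) + (\<Sum>\<alpha>\<in>I. scale_mat (u (S \<alpha>)) (S \<alpha>))"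
    by (simp add: algebra_simps)
  then show ?thesis by (intro exI[of _ c] exI[of _ "\<lambda>\<alpha>. u (S \<alpha>)"])
qed

text \<open>Each matrix unit of the block form is expanded in the identity and the
  \<open>S \<alpha>\<close>; collecting the blocks moves the expansion coefficients to the bath
  factors.\<close>

lemma operator_decomposition:
  fixes X :: "('b :: complex_hilbert ^ 'n :: finite) \<Rightarrow>\<^sub>L ('b ^ 'n)"
  assumes S: "hermitian_traceless_basis I S" and X: "clinear_op X"
  obtains B\<^sub>0 B where "clinear_op B\<^sub>0" "\<And>\<alpha>. clinear_op (B \<alpha>)" "X = mat 1 \<otimes>\<^sub>o B\<^sub>0 + (\<Sum>\<alpha>\<in>I. S \<alpha> \<otimes>\<^sub>o B \<alpha>)"
proof -
  obtain C where C: "\<And>i j. clinear_op (C i j)" "X = (\<Sum>i\<in>UNIV. \<Sum>j\<in>UNIV. mat_unit i j \<otimes>\<^sub>o C i j)"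
    using operator_blocks[OF X] by blast
  have "\<forall>i j. \<exists>c u. mat_unit i j = scale_mat c (mat 1) + (\<Sum>\<alpha>\<in>I. scale_mat (u \<alpha>) (S \<alpha>))"
    using traceless_expansion[OF S] by blast
  then obtain c u where cu: "\<And>i j. mat_unit i j = scale_mat (c i j) (mat 1) + (\<Sum>\<alpha>\<in>I. scale_mat (u i j \<alpha>) (S \<alpha>))"
    by metis
  show ?thesis
  proof
    let ?D = "\<Sum>i\<in>UNIV. \<Sum>j\<in>UNIV. scale_op (c i j) (C i j)"
    let ?B = "\<lambda>\<alpha>. \<Sum>i\<in>UNIV. \<Sum>j\<in>UNIV. scale_op (u i j \<alpha>) (C i j)"
    show "clinear_op ?D"
      by (intro clinear_op_sum clinear_op_scale_op C(1))
    show "clinear_op (\<Sum>i\<in>UNIV. \<Sum>j\<in>UNIV. scale_op (u i j \<alpha>) (C i j))" for \<alpha>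
      by (intro clinear_op_sum clinear_op_scale_op C(1))
    have "(\<Sum>i\<in>UNIV. \<Sum>j\<in>UNIV. \<Sum>\<alpha>\<in>I. S \<alpha> \<otimes>\<^sub>o scale_op (u i j \<alpha>) (C i j))
        = (\<Sum>\<alpha>\<in>I. \<Sum>i\<in>UNIV. \<Sum>j\<in>UNIV. S \<alpha> \<otimes>\<^sub>o scale_op (u i j \<alpha>) (C i j))"
      by (simp only: sum.swap[of _ I UNIV])
    then show "X = mat 1 \<otimes>\<^sub>o ?D + (\<Sum>\<alpha>\<in>I. S \<alpha> \<otimes>\<^sub>o ?B \<alpha>)"
      by (subst C(2)) (simp add: cu tensor_add_left tensor_sum_left tensor_sum_right tensor_scale_mat sum.distrib)
  qed
qed

section \<open>Concatenated decoupling\<close>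

locale decoupling_pulses =
  fixes I :: "'i set" and S :: "'i \<Rightarrow> complex ^ 'n ^ 'n" and P :: "nat \<Rightarrow> complex ^ 'n :: finite ^ 'n" and R :: nat
  assumes basis: "hermitian_traceless_basis I S"
    and R: "R \<ge> 2"
    and unitary: "\<And>j. j \<in> {1..R} \<Longrightarrow> unitary_mat (P j)"
    and symmetric: "time_symmetric P R"
    and decoupling: "first_order_decoupling I S P R"
begin

definition conj_by :: "nat \<Rightarrow> (('b :: complex_hilbert ^ 'n) \<Rightarrow>\<^sub>L ('b ^ 'n)) \<Rightarrow> (('b ^ 'n) \<Rightarrow>\<^sub>L ('b ^ 'n))"
  where "conj_by j X = (dagger (partial_pulse P j) \<otimes>\<^sub>o id_blinfun) o\<^sub>L X o\<^sub>L (partial_pulse P j \<otimes>\<^sub>o id_blinfun)"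

definition avg :: "(('b :: complex_hilbert ^ 'n) \<Rightarrow>\<^sub>L ('b ^ 'n)) \<Rightarrow> (('b ^ 'n) \<Rightarrow>\<^sub>L ('b ^ 'n))"
  where "avg X = (1 / real R) *\<^sub>R (\<Sum>j<R. conj_by j X)"

lemma unitary_partial_pulse: "j \<le> R \<Longrightarrow> unitary_mat (partial_pulse P j)"
  by (induction j) (simp_all add: unitary_mat_1 unitary_mat_mult unitary)

lemma conj_by_add: "conj_by j (X + Y) = conj_by j X + conj_by j Y"
  by (simp add: conj_by_def bounded_bilinear.add_left[OF bounded_bilinear_blinfun_compose]
      bounded_bilinear.add_right[OF bounded_bilinear_blinfun_compose])

lemma conj_by_diff: "conj_by j (X - Y) = conj_by j X - conj_by j Y"
  by (simp add: conj_by_def bounded_bilinear.diff_left[OF bounded_bilinear_blinfun_compose]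
      bounded_bilinear.diff_right[OF bounded_bilinear_blinfun_compose])

lemma conj_by_zero: "conj_by j 0 = 0"
  using conj_by_diff[of j 0 0] by simp

lemma conj_by_sum: "conj_by j (sum f A) = (\<Sum>a\<in>A. conj_by j (f a))"
  by (induction A rule: infinite_finite_induct) (simp_all add: conj_by_add conj_by_zero)

lemma conj_by_tensor:
  assumes "clinear_op B"
  shows "conj_by j (M \<otimes>\<^sub>o B) = (dagger (partial_pulse P j) ** M ** partial_pulse P j) \<otimes>\<^sub>o B"
proof -
  have "id_blinfun o\<^sub>L B = B" "B o\<^sub>L id_blinfun = B" by (simp_all add: blinfun_eqI)
  then show ?thesis
    using assms by (simp add: conj_by_def tensor_mult clinear_op_id)
qed

lemma clinear_op_conj_by: "clinear_op X \<Longrightarrow> clinear_op (conj_by j X)"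
  unfolding conj_by_def by (intro clinear_op_compose clinear_op_tensor clinear_op_id)

lemma norm_conj_by_le:
  fixes X :: "('b :: complex_hilbert ^ 'n) \<Rightarrow>\<^sub>L ('b ^ 'n)"
  assumes "j \<le> R"
  shows "norm (conj_by j X) \<le> norm X"
proof -
  let ?U = "\<lambda>M. M \<otimes>\<^sub>o (id_blinfun :: 'b \<Rightarrow>\<^sub>L 'b)"
  let ?Q = "partial_pulse P j"
  have u: "norm (?U (dagger ?Q)) \<le> 1" "norm (?U ?Q) \<le> 1"
    using unitary_partial_pulse[OF assms] by (simp_all add: norm_unitary_tensor_le unitary_mat_dagger)
  have "norm (conj_by j X) \<le> norm (?U (dagger ?Q) o\<^sub>L X) * norm (?U ?Q)"
    unfolding conj_by_def by (rule norm_blinfun_compose)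
  also have "\<dots> \<le> norm (?U (dagger ?Q) o\<^sub>L X) * 1" using u by (intro mult_left_mono) auto
  also have "\<dots> \<le> norm (?U (dagger ?Q)) * norm X" using norm_blinfun_compose by simp
  also have "\<dots> \<le> 1 * norm X" using u by (intro mult_right_mono) auto
  finally show ?thesis by simp
qed

text \<open>The phase relating the two partial products enters once as c and once, through the
  adjoint, as its conjugate. Complex linearity of \<open>X\<close> brings them together and they
  cancel.\<close>

lemma conj_by_symmetric:
  assumes X: "clinear_op X" and j: "j < R"
  shows "conj_by (R - 1 - j) X = conj_by j X"
proof -
  obtain c where c: "cmod c = 1" "partial_pulse P (R - 1 - j) = scale_mat c (partial_pulse P j)"
    using symmetric j by (auto simp: time_symmetric_def eq_up_to_phase_def)
  let ?Q = "partial_pulse P j"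
  have d: "dagger (scale_mat c ?Q) = scale_mat (cnj c) (dagger ?Q)"
    by (simp add: dagger_def scale_mat_def)
  have "cnj c * c = 1"
    using c(1) complex_norm_square[of c] by (simp add: mult.commute)
  then have cc: "cnj c *\<^sub>C c *\<^sub>C x = x" for x :: "'a ^ 'n" by (simp add: scaleC_scaleC)
  have lin: "A (c *\<^sub>C x) = c *\<^sub>C A x" if "clinear_op A" for A :: "('a ^ 'n) \<Rightarrow>\<^sub>L ('a ^ 'n)" and x
    using that by (simp add: clinear_op_def)
  show ?thesis
    unfolding conj_by_def c(2) d tensor_scale_mat tensor_scale_op
    by (rule blinfun_eqI)
      (simp add: scale_op_apply lin[OF X] lin[OF clinear_op_tensor[OF clinear_op_id]] cc)
qed

lemma conj_by_bath:
  assumes "clinear_op B" "j \<le> R"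
  shows "conj_by j (mat 1 \<otimes>\<^sub>o B) = mat 1 \<otimes>\<^sub>o B"
  using unitary_partial_pulse[OF assms(2)] by (simp add: conj_by_tensor assms(1) unitary_mat_def)

section \<open>The average over the toggling frames and the bath part\<close>

lemma avg_add: "avg (X + Y) = avg X + avg Y"
  by (simp add: avg_def conj_by_add sum.distrib scaleR_right_distrib)

lemma avg_diff: "avg (X - Y) = avg X - avg Y"
  by (simp add: avg_def conj_by_diff sum_subtractf scaleR_diff_right)

lemma norm_avg_le: "norm (avg X) \<le> norm X"
proof -
  have "norm (\<Sum>j<R. conj_by j X) \<le> (\<Sum>j<R. norm X)"
    by (intro sum_norm_le norm_conj_by_le) auto
  then have "1 / real R * norm (\<Sum>j<R. conj_by j X) \<le> 1 / real R * (real R * norm X)"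
    by (intro mult_left_mono) auto
  then show ?thesis using R by (simp add: avg_def)
qed

lemma avg_bath: "clinear_op B \<Longrightarrow> avg (mat 1 \<otimes>\<^sub>o B) = mat 1 \<otimes>\<^sub>o B"
  using R by (simp add: avg_def conj_by_bath scaleR_sum_left[symmetric] sum_constant_scaleR)

lemma avg_error:
  assumes "\<And>\<alpha>. \<alpha> \<in> I \<Longrightarrow> clinear_op (B \<alpha>)"
  shows "avg (\<Sum>\<alpha>\<in>I. S \<alpha> \<otimes>\<^sub>o B \<alpha>) = 0"
proof -
  have "(\<Sum>j<R. conj_by j (\<Sum>\<alpha>\<in>I. S \<alpha> \<otimes>\<^sub>o B \<alpha>))
      = (\<Sum>j<R. \<Sum>\<alpha>\<in>I. (dagger (partial_pulse P j) ** S \<alpha> ** partial_pulse P j) \<otimes>\<^sub>o B \<alpha>)"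
    by (simp add: conj_by_sum conj_by_tensor assms)
  also have "\<dots> = (\<Sum>\<alpha>\<in>I. \<Sum>j<R. (dagger (partial_pulse P j) ** S \<alpha> ** partial_pulse P j) \<otimes>\<^sub>o B \<alpha>)"
    by (rule sum.swap)
  also have "\<dots> = 0"
    using decoupling by (simp add: first_order_decoupling_def flip: tensor_sum_left)
  finally show ?thesis by (simp add: avg_def)
qed

lemma avg_decomposition:
  assumes "clinear_op B\<^sub>0" "\<And>\<alpha>. \<alpha> \<in> I \<Longrightarrow> clinear_op (B \<alpha>)"
  shows "avg (mat 1 \<otimes>\<^sub>o B\<^sub>0 + (\<Sum>\<alpha>\<in>I. S \<alpha> \<otimes>\<^sub>o B \<alpha>)) = mat 1 \<otimes>\<^sub>o B\<^sub>0"
  using assms by (simp add: avg_add avg_bath avg_error)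

lemma avg_eq_bath:
  assumes "clinear_op X"
  obtains B\<^sub>0 where "clinear_op B\<^sub>0" "avg X = mat 1 \<otimes>\<^sub>o B\<^sub>0"
proof -
  obtain B\<^sub>0 B where B: "clinear_op B\<^sub>0" "\<And>\<alpha>. clinear_op (B \<alpha>)"
    "X = mat 1 \<otimes>\<^sub>o B\<^sub>0 + (\<Sum>\<alpha>\<in>I. S \<alpha> \<otimes>\<^sub>o B \<alpha>)"
    using operator_decomposition[OF basis assms] by blast
  have "avg X = mat 1 \<otimes>\<^sub>o B\<^sub>0" unfolding B(3) by (rule avg_decomposition[OF B(1,2)])
  with B(1) show ?thesis by (rule that)
qed

text \<open>\<open>avg\<close> fixes bath terms and annihilates error sums, so in every admissible
  decomposition the bath part is \<open>avg X\<close>. This gives uniqueness and an explicit formula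
  that can be estimated in norm.\<close>

lemma err_part_eq:
  assumes "clinear_op X"
  shows "err_part I S X = X - avg X"
  unfolding err_part_def
proof (rule the_equality)
  obtain B\<^sub>0 B where "clinear_op B\<^sub>0" "\<And>\<alpha>. clinear_op (B \<alpha>)"
    "X = mat 1 \<otimes>\<^sub>o B\<^sub>0 + (\<Sum>\<alpha>\<in>I. S \<alpha> \<otimes>\<^sub>o B \<alpha>)"
    using operator_decomposition[OF basis assms] by blast
  then show "\<exists>B\<^sub>0 B. clinear_op B\<^sub>0 \<and> (\<forall>\<alpha>\<in>I. clinear_op (B \<alpha>)) \<and>
      X - avg X = (\<Sum>\<alpha>\<in>I. S \<alpha> \<otimes>\<^sub>o B \<alpha>) \<and> X = mat 1 \<otimes>\<^sub>o B\<^sub>0 + (X - avg X)"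
    using avg_decomposition[of B\<^sub>0 B] by (intro exI[of _ B\<^sub>0] exI[of _ B]) simp
next
  fix E assume "\<exists>B\<^sub>0 B. clinear_op B\<^sub>0 \<and> (\<forall>\<alpha>\<in>I. clinear_op (B \<alpha>)) \<and>
      E = (\<Sum>\<alpha>\<in>I. S \<alpha> \<otimes>\<^sub>o B \<alpha>) \<and> X = mat 1 \<otimes>\<^sub>o B\<^sub>0 + E"
  then obtain B\<^sub>0 B where "clinear_op B\<^sub>0" "\<And>\<alpha>. \<alpha> \<in> I \<Longrightarrow> clinear_op (B \<alpha>)"
    "E = (\<Sum>\<alpha>\<in>I. S \<alpha> \<otimes>\<^sub>o B \<alpha>)" "X = mat 1 \<otimes>\<^sub>o B\<^sub>0 + E"
    by blast
  then show "E = X - avg X" using avg_decomposition[of B\<^sub>0 B] by simp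
qed

text \<open>Both bounds come from the one estimate that \<open>Y\<close> is within \<delta> of
  \<open>avg X\<close>, a fixed point of \<open>avg\<close>: the bath part moves by
  \<open>avg (Y - avg X)\<close>, and the error part of \<open>Y\<close> is that of
  \<open>Y - avg X\<close>.\<close>

lemma effective_step:
  fixes X :: "('b :: complex_hilbert ^ 'n) \<Rightarrow>\<^sub>L ('b ^ 'n)"
  assumes X: "clinear_op X" and \<beta>: "norm (avg X) \<le> \<beta>" and J: "norm (X - avg X) \<le> J"
    and \<tau>: "\<tau> > 0" and x: "x = (\<beta> + J) * (real R * \<tau>)" "x \<le> 0.54"
  defines "Y \<equiv> scale_op (\<i> / complex_of_real (real R * \<tau>))
      (magnus_sum (real R * \<tau>) (toggling_ham P R \<tau> X))"
    and "\<delta> \<equiv> (2 / 9 + 9.43 * x\<^sup>2) * J * x\<^sup>2"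
  shows "clinear_op Y" "norm (avg Y) \<le> \<beta> + \<delta>" "norm (Y - avg Y) \<le> 2 * \<delta>"
proof -
  obtain B\<^sub>0 where B0: "clinear_op B\<^sub>0" "avg X = mat 1 \<otimes>\<^sub>o B\<^sub>0" using avg_eq_bath[OF X] .
  define E where "E = (\<lambda>j. conj_by j X - avg X)"
  have E: "E j = conj_by j (X - avg X)" if "j \<le> R" for j
    using B0 that by (simp add: E_def conj_by_diff conj_by_bath)
  \<comment> \<open>Each toggled piece is the common \<open>avg X\<close> plus a deviation. The
    deviations sum to zero by the very definition of \<open>avg\<close>; being conjugates of the
    error part, each has norm at most J.\<close>
  have K: "toggling_ham P R \<tau> X = step_fun \<tau> R (\<lambda>j. avg X + E j)"
    by (rule ext) (simp add: toggling_ham_def step_fun_def E_def conj_by_def)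
  have 1: "clinear_op (avg X + E i)" for i
    by (simp add: E_def clinear_op_conj_by X)
  have 2: "norm (E i) \<le> J" if "i < R" for i
    using that E[of i] norm_conj_by_le[of i "X - avg X"] J by simp
  have 3: "(\<Sum>i<R. E i) = 0"
    using R by (simp add: E_def sum_subtractf avg_def sum_constant_scaleR)
  have 4: "E (R - 1 - i) = E i" if "i < R" for i
    unfolding E_def conj_by_symmetric[OF X that] ..
  note M = magnus_sum_palindromic[of R "avg X" E \<beta> J \<tau> x, OF 1 \<beta> 2 R 3 4 \<tau> x, folded K, folded Y_def]
  show "clinear_op Y" by (rule M(1))
  have D: "norm (Y - avg X) \<le> \<delta>"
    using M(2) by (simp only: \<delta>_def mult_ac)
  have aa: "avg (avg X) = avg X" using B0 by (simp add: avg_bath)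
  have "avg Y = avg X + avg (Y - avg X)" by (simp add: avg_diff aa)
  also have "norm \<dots> \<le> \<beta> + \<delta>"
    by (intro norm_triangle_mono \<beta> order_trans[OF norm_avg_le D])
  finally show "norm (avg Y) \<le> \<beta> + \<delta>" .
  have "Y - avg Y = (Y - avg X) - avg (Y - avg X)" by (simp add: avg_diff aa)
  also have "norm \<dots> \<le> norm (Y - avg X) + norm (avg (Y - avg X))" by (rule norm_triangle_ineq4)
  also have "\<dots> \<le> \<delta> + \<delta>" by (intro add_mono D order_trans[OF norm_avg_le D])
  finally show "norm (Y - avg Y) \<le> 2 * \<delta>" by simp
qed

end

text \<open>With y = R^(-L), the exponents to base R are k (k + 2) - 2 k L and -3/4 - L (L - 2).
  Their difference is (L - k - 1/2) (L - k - 3/2), which is nonpositive exactly for L between k +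
  1/2 and k + 3/2.\<close>

lemma optimal_level_exponent:
  fixes R y :: real and k :: nat
  assumes R: "R > 1" and y: "y > 0"
    and k: "real k + 1 / 2 < log R (1 / y)" "log R (1 / y) \<le> real k + 3 / 2"
  shows "R ^ (k * (k + 2)) * y ^ (2 * k) \<le> R powr (- 3 / 4) * y powr (log R (1 / y) - 2)"
proof -
  define L where "L = log R (1 / y)"
  have "L = - log R y" using R y by (simp add: L_def log_divide)
  then have yL: "y = R powr (- L)" using R y by simp
  have "R ^ (k * (k + 2)) * y ^ (2 * k) = R powr (real (k * (k + 2)) - L * real (2 * k))"
    using R by (simp add: yL powr_realpow[symmetric] powr_powr powr_add[symmetric] del: of_nat_mult of_nat_add)
  also have "\<dots> \<le> R powr (- 3 / 4 + - L * (L - 2))"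
  proof (rule powr_mono)
    have "(L - real k - 1 / 2) * (L - real k - 3 / 2) \<le> 0"
      using k unfolding L_def by (intro mult_nonneg_nonpos) auto
    then show "real (k * (k + 2)) - L * real (2 * k) \<le> - 3 / 4 + - L * (L - 2)"
      by (simp add: algebra_simps)
  qed (use R in simp)
  also have "\<dots> = R powr (- 3 / 4) * y powr (L - 2)"
    unfolding powr_add by (simp only: yL powr_powr)
  finally show ?thesis by (simp add: L_def)
qed

theorem mainTheorem6:
  fixes S :: "'i \<Rightarrow> complex ^ 'n ^ 'n" and I :: "'i set"
    and P :: "nat \<Rightarrow> complex ^ 'n ^ 'n" and R :: nat
    and B\<^sub>0 :: "'b :: complex_hilbert \<Rightarrow>\<^sub>L 'b" and B :: "'i \<Rightarrow> ('b \<Rightarrow>\<^sub>L 'b)"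
    and H H\<^sub>B H\<^sub>e\<^sub>r\<^sub>r :: "('b ^ 'n :: finite) \<Rightarrow>\<^sub>L ('b ^ 'n)"
    and \<tau>\<^sub>0 \<beta> J \<epsilon> cbar :: real
    and \<beta>s Js \<epsilon>s x c\<^sub>3 :: "nat \<Rightarrow> real"
  assumes basis: "hermitian_traceless_basis I S" "trace_orthogonal I S"
    and bath: "clinear_op B\<^sub>0" "\<And>\<alpha>. \<alpha> \<in> I \<Longrightarrow> clinear_op (B \<alpha>)"
    and ham: "H = H\<^sub>B + H\<^sub>e\<^sub>r\<^sub>r" "H\<^sub>B = mat 1 \<otimes>\<^sub>o B\<^sub>0" "H\<^sub>e\<^sub>r\<^sub>r = (\<Sum>\<alpha>\<in>I. S \<alpha> \<otimes>\<^sub>o B \<alpha>)"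
      "selfadjoint_op H"
    and bounds: "norm H\<^sub>B \<le> \<beta>" "norm H\<^sub>e\<^sub>r\<^sub>r \<le> J" "\<epsilon> = \<beta> + J"
    and pulses: "R \<ge> 2" "\<And>j. j \<in> {1..R} \<Longrightarrow> unitary_mat (P j)" "\<tau>\<^sub>0 > 0"
      "cyclic_pulses P R" "time_symmetric P R" "first_order_decoupling I S P R"
      "commute_or_anticommute I S P R"
    and rec_0: "\<beta>s 0 = \<beta>" "Js 0 = J"
    and rec_\<epsilon>: "\<And>k. \<epsilon>s k = \<beta>s k + Js k"
    and rec_x: "\<And>k. k \<ge> 1 \<Longrightarrow> x k = \<epsilon>s (k - 1) * level_time P R \<tau>\<^sub>0 k"
    and rec_c: "\<And>k. k \<ge> 1 \<Longrightarrow> c\<^sub>3 k = 2 / 9 + 9.43 * (x k)\<^sup>2"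
    and rec_\<beta>: "\<And>k. k \<ge> 1 \<Longrightarrow> \<beta>s k = \<beta>s (k - 1) + c\<^sub>3 k * Js (k - 1) * (x k)\<^sup>2"
    and rec_J: "\<And>k. k \<ge> 1 \<Longrightarrow> Js k = 2 * c\<^sub>3 k * Js (k - 1) * (x k)\<^sup>2"
    and cbar: "cbar > 0"
  shows "(\<forall>l::nat.
        (\<forall>k. 1 \<le> k \<and> k \<le> l \<longrightarrow> x k \<le> 0.54 \<and> 2 * c\<^sub>3 k * (\<epsilon>s (k - 1))\<^sup>2 \<le> (cbar * \<epsilon>)\<^sup>2) \<longrightarrow>
        (\<forall>k\<le>l. noise_strength I S P R \<tau>\<^sub>0 H k
            \<le> real R ^ (k * (k + 2)) * (cbar * \<epsilon> * \<tau>\<^sub>0) ^ (2 * k) * (J * \<tau>\<^sub>0))) \<and>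
    (log (real R) (1 / (cbar * \<epsilon> * \<tau>\<^sub>0)) > 1 / 2 \<longrightarrow>
      (\<forall>kmax::nat.
        real kmax + 1 / 2 < log (real R) (1 / (cbar * \<epsilon> * \<tau>\<^sub>0)) \<and>
        (\<forall>m::int. real_of_int m + 1 / 2 < log (real R) (1 / (cbar * \<epsilon> * \<tau>\<^sub>0)) \<longrightarrow> m \<le> int kmax) \<and>
        (\<forall>k. 1 \<le> k \<and> k \<le> kmax \<longrightarrow> x k \<le> 0.54 \<and> 2 * c\<^sub>3 k * (\<epsilon>s (k - 1))\<^sup>2 \<le> (cbar * \<epsilon>)\<^sup>2) \<longrightarrow>
        noise_strength I S P R \<tau>\<^sub>0 H kmax / (J * \<tau>\<^sub>0)
          \<le> real R powr (- 3 / 4) *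
            (cbar * \<epsilon> * \<tau>\<^sub>0) powr (log (real R) (1 / (cbar * \<epsilon> * \<tau>\<^sub>0)) - 2)))"
proof -
  interpret decoupling_pulses I S P R
    using basis(1) pulses(1,2,5,6) by (rule decoupling_pulses.intro)
  define T where "T = (\<lambda>k. real R ^ k * \<tau>\<^sub>0)"
  have T: "level_time P R \<tau>\<^sub>0 k = T k" for k by (simp add: T_def level_time_eq)
  have Tpos: "T k > 0" for k using pulses by (simp add: T_def)
  have TSuc: "T (Suc k) = real R * T k" for k by (simp add: T_def)
  define y where "y = cbar * \<epsilon> * \<tau>\<^sub>0"
  have nn: "0 \<le> \<beta>" "0 \<le> J"
    using order_trans[OF norm_ge_zero bounds(1)] order_trans[OF norm_ge_zero bounds(2)] by auto
  then have y0: "0 \<le> y" using cbar pulses bounds(3) by (simp add: y_def)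
  have H: "H = mat 1 \<otimes>\<^sub>o B\<^sub>0 + (\<Sum>\<alpha>\<in>I. S \<alpha> \<otimes>\<^sub>o B \<alpha>)" using ham by simp
  have avgH: "avg H = H\<^sub>B" unfolding H ham(2) by (rule avg_decomposition[OF bath])
  let ?hyp = "\<lambda>l. \<forall>k. 1 \<le> k \<and> k \<le> l \<longrightarrow> x k \<le> 0.54 \<and> 2 * c\<^sub>3 k * (\<epsilon>s (k - 1))\<^sup>2 \<le> (cbar * \<epsilon>)\<^sup>2"
  let ?X = "eff_ham P R \<tau>\<^sub>0 H"
  \<comment> \<open>The exponent of R is k (k + 1) for the norm of the error part; the duration
    contributes another R^k, giving k (k + 2) for the noise strength.\<close>
  have main: "clinear_op (?X k) \<and> norm (avg (?X k)) \<le> \<beta>s k \<and> norm (?X k - avg (?X k)) \<le> Js k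
      \<and> Js k \<le> J * (real R ^ (k * (k + 1)) * y ^ (2 * k))"
    if "?hyp l" "k \<le> l" for k l
    using that(2)
  proof (induction k)
    case 0
    have "clinear_op H" using ham(4) by (simp add: selfadjoint_op_def)
    moreover have "H - avg H = H\<^sub>e\<^sub>r\<^sub>r" unfolding avgH using ham(1) by simp
    ultimately show ?case using bounds by (simp add: avgH rec_0)
  next
    case (Suc k)
    then have IH: "clinear_op (?X k)" "norm (avg (?X k)) \<le> \<beta>s k" "norm (?X k - avg (?X k)) \<le> Js k"
      "Js k \<le> J * (real R ^ (k * (k + 1)) * y ^ (2 * k))" by auto
    have hyp: "x (Suc k) \<le> 0.54" "2 * c\<^sub>3 (Suc k) * (\<epsilon>s k)\<^sup>2 \<le> (cbar * \<epsilon>)\<^sup>2"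
      using that(1)[rule_format, of "Suc k"] Suc.prems by auto
    have x: "x (Suc k) = (\<beta>s k + Js k) * (real R * T k)"
      using rec_x[of "Suc k"] by (simp add: rec_\<epsilon> T TSuc)
    have X: "?X (Suc k) = scale_op (\<i> / complex_of_real (real R * T k))
        (magnus_sum (real R * T k) (toggling_ham P R (T k) (?X k)))"
      by (simp only: eff_ham.simps T TSuc)
    note st = effective_step[OF IH(1-3) Tpos x hyp(1), folded X]
    have b: "\<beta>s (Suc k) = \<beta>s k + (2 / 9 + 9.43 * (x (Suc k))\<^sup>2) * Js k * (x (Suc k))\<^sup>2"
      using rec_\<beta>[of "Suc k"] rec_c[of "Suc k"] by simp
    have j: "Js (Suc k) = 2 * ((2 / 9 + 9.43 * (x (Suc k))\<^sup>2) * Js k * (x (Suc k))\<^sup>2)"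
      using rec_J[of "Suc k"] rec_c[of "Suc k"] by simp
    have J0: "0 \<le> Js k" by (rule order_trans[OF norm_ge_zero IH(3)])
    \<comment> \<open>Splitting the square of \<open>x (Suc k)\<close> into that of
      \<open>\<epsilon>s k\<close> and that of the duration isolates the quantity bounded by the
      hypothesis on \<open>cbar\<close>. The squared duration adds 2 (k + 1) to k (k + 1), which
      makes (k + 1) (k + 2).\<close>
    have "Js (Suc k) = (2 * c\<^sub>3 (Suc k) * (\<epsilon>s k)\<^sup>2) * ((T (Suc k))\<^sup>2 * Js k)"
      using rec_J[of "Suc k"] rec_x[of "Suc k"] by (simp add: T power_mult_distrib mult_ac)
    also have "\<dots> \<le> (cbar * \<epsilon>)\<^sup>2 * ((T (Suc k))\<^sup>2 * (J * (real R ^ (k * (k + 1)) * y ^ (2 * k))))"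
      using hyp(2) IH(4) J0 by (intro mult_mono) auto
    also have "\<dots> = J * (real R ^ (Suc k * (Suc k + 1)) * y ^ (2 * Suc k))"
    proof -
      have "(cbar * \<epsilon>)\<^sup>2 * (T (Suc k))\<^sup>2 = (real R ^ Suc k)\<^sup>2 * y\<^sup>2"
        by (simp only: T_def y_def power_mult_distrib mult_ac)
      moreover have "(real R ^ Suc k)\<^sup>2 * real R ^ (k * (k + 1)) = real R ^ (Suc k * (Suc k + 1))"
        unfolding power_mult[symmetric] power_add[symmetric] by (rule arg_cong[where f = "power (real R)"]) simp
      moreover have "y\<^sup>2 * y ^ (2 * k) = y ^ (2 * Suc k)"
        unfolding power_add[symmetric] by simp
      moreover have "p * (t * (J * (a * w))) = J * ((r * a) * (z * w))" if "p * t = r * z"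
        for p t a w r z :: real
        by (simp only: mult.assoc[symmetric] that) (simp only: mult_ac)
      ultimately show ?thesis by (simp only:)
    qed
    finally have "Js (Suc k) \<le> J * (real R ^ (Suc k * (Suc k + 1)) * y ^ (2 * Suc k))" .
    with st[folded b j] show ?case by blast
  qed
  have noise: "noise_strength I S P R \<tau>\<^sub>0 H k \<le> real R ^ (k * (k + 2)) * y ^ (2 * k) * (J * \<tau>\<^sub>0)"
    if "?hyp l" "k \<le> l" for k l
  proof -
    note m = main[OF that]
    have "noise_strength I S P R \<tau>\<^sub>0 H k = norm (?X k - avg (?X k)) * T k"
      using m by (simp only: noise_strength_def err_part_eq T)
    also have "\<dots> \<le> J * (real R ^ (k * (k + 1)) * y ^ (2 * k)) * T k"
      using m Tpos[of k] by (intro mult_right_mono) auto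
    also have "\<dots> = real R ^ (k * (k + 2)) * y ^ (2 * k) * (J * \<tau>\<^sub>0)"
    proof -
      have "real R ^ (k * (k + 1)) * real R ^ k = real R ^ (k * (k + 2))"
        unfolding power_add[symmetric] by (rule arg_cong[where f = "power (real R)"]) simp
      from this[symmetric] show ?thesis unfolding T_def by (simp only: mult_ac)
    qed
    finally show ?thesis .
  qed
  have opt: "noise_strength I S P R \<tau>\<^sub>0 H k / (J * \<tau>\<^sub>0)
      \<le> real R powr (- 3 / 4) * y powr (log (real R) (1 / y) - 2)"
    if L: "1 / 2 < log (real R) (1 / y)" "real k + 1 / 2 < log (real R) (1 / y)"
      and max: "\<forall>m::int. real_of_int m + 1 / 2 < log (real R) (1 / y) \<longrightarrow> m \<le> int k"
      and hyp: "?hyp k" for k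
  proof -
    \<comment> \<open>For y = 0 the convention 1 / 0 = 0 makes the logarithm evaluate to 0, against
      the assumption that it exceeds 1/2.\<close>
    have "y \<noteq> 0"
    proof
      assume "y = 0"
      with L(1) show False by (simp add: log_def)
    qed
    then have y: "y > 0" using y0 by simp
    \<comment> \<open>Maximality, applied to the next integer, is what provides the upper end k +
      3/2 of the interval for L.\<close>
    have "\<not> real_of_int (int k + 1) + 1 / 2 < log (real R) (1 / y)"
      using max[rule_format, of "int k + 1"] by auto
    then have L': "log (real R) (1 / y) \<le> real k + 3 / 2" by simp
    have o: "real R ^ (k * (k + 2)) * y ^ (2 * k) \<le> real R powr (- 3 / 4) * y powr (log (real R) (1 / y) - 2)"
      using optimal_level_exponent[OF _ y L(2) L'] pulses(1) by simp
    \<comment> \<open>For J = 0 the quotient on the left is 0 by convention, and the right-hand side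
      is nonnegative.\<close>
    show ?thesis
    proof (cases "J = 0")
      case False
      then have "J * \<tau>\<^sub>0 > 0" using nn pulses by simp
      then have "noise_strength I S P R \<tau>\<^sub>0 H k / (J * \<tau>\<^sub>0) \<le> real R ^ (k * (k + 2)) * y ^ (2 * k)"
        using noise[OF hyp order_refl] by (simp add: pos_divide_le_eq)
      then show ?thesis using o by (rule order_trans)
    qed simp
  qed
  show ?thesis
    unfolding y_def[symmetric]
  proof (intro conjI allI impI)
    fix l k assume "?hyp l" "k \<le> l"
    then show "noise_strength I S P R \<tau>\<^sub>0 H k \<le> real R ^ (k * (k + 2)) * y ^ (2 * k) * (J * \<tau>\<^sub>0)"
      by (rule noise)
  next
    fix k :: nat
    assume L: "1 / 2 < log (real R) (1 / y)"
      and k: "real k + 1 / 2 < log (real R) (1 / y) \<and>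
        (\<forall>m::int. real_of_int m + 1 / 2 < log (real R) (1 / y) \<longrightarrow> m \<le> int k) \<and> ?hyp k"
    show "noise_strength I S P R \<tau>\<^sub>0 H k / (J * \<tau>\<^sub>0)
        \<le> real R powr (- 3 / 4) * y powr (log (real R) (1 / y) - 2)"
      by (rule opt[OF L k[THEN conjunct1] k[THEN conjunct2, THEN conjunct1] k[THEN conjunct2, THEN conjunct2]])
  qed
qed

end
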